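(* Let $(f_n)_{n\ge 0}$ be a uniformly attracting sequence of automorphisms of $\mathbb C^2$ with constants $1>D>C>0$, i.e. $C\|z\|\le\|f_n(z)\|\le D\|z\|$ for all $n\in\mathbb N$ and all $z$ in the unit ball $\mathbb B$. Suppose that $$D^{11/5}<C.$$ Then the basin of attraction $\Omega_{(f_n)}$ is biholomorphic to $\mathbb C^2$.
   Context: An automorphism of $\mathbb C^2$ is a biholomorphic map $\mathbb C^2\to\mathbb C^2$. The sequence $(f_n)$ is called uniformly attracting if there are constants $1>D>C>0$, independent of $n$, such that $C\|z\|\le\|f_n(z)\|\le D\|z\|$ for all $n$ and all $z\in\mathbb B$, where $\mathbb B$ is the unit ball of $\mathbb C^2$ for the Euclidean norm. The basin of attraction is $\Omega_{(f_n)}=\{z\in\mathbb C^2 : f_n\circ\cdots\circ f_0(z)\to 0 \text{ as } n\to\infty\}$. *)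

theory Defs
  imports "HOL-Analysis.Analysis"
begin

text \<open>Points of complex \<open>n\<close>-space are vectors \<open>complex ^ 'n\<close>, whose library norm is the
  Euclidean (Hermitian) one. A map is holomorphic on an open set iff at each point it has a
  Frechet derivative that is complex linear; \<open>has_derivative\<close> only gives real linearity, so
  compatibility with complex scalars is demanded separately.\<close>

definition holomorphic_map_on ::
    "(complex ^ 'n \<Rightarrow> complex ^ 'm) \<Rightarrow> (complex ^ 'n) set \<Rightarrow> bool"
  where "holomorphic_map_on f U \<longleftrightarrow> open U \<and>
    (\<forall>z\<in>U. \<exists>f'. (f has_derivative f') (at z) \<and> (\<forall>c v. f' (c *s v) = c *s f' v))"

definition biholomorphic_map ::
    "(complex ^ 'n) set \<Rightarrow> (complex ^ 'm) set \<Rightarrow> (complex ^ 'n \<Rightarrow> complex ^ 'm) \<Rightarrow> bool"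
  where "biholomorphic_map U V f \<longleftrightarrow>
    bij_betw f U V \<and> holomorphic_map_on f U \<and> holomorphic_map_on (inv_into U f) V"

definition biholomorphic :: "(complex ^ 'n) set \<Rightarrow> (complex ^ 'm) set \<Rightarrow> bool"
  where "biholomorphic U V \<longleftrightarrow> (\<exists>f. biholomorphic_map U V f)"

definition automorphism :: "(complex ^ 'n \<Rightarrow> complex ^ 'n) \<Rightarrow> bool"
  where "automorphism f \<longleftrightarrow> biholomorphic_map UNIV UNIV f"

definition uniformly_attracting_with ::
    "real \<Rightarrow> real \<Rightarrow> (nat \<Rightarrow> complex ^ 'n \<Rightarrow> complex ^ 'n) \<Rightarrow> bool"
  where "uniformly_attracting_with C D f \<longleftrightarrow> 1 > D \<and> D > C \<and> C > 0 \<and>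
    (\<forall>n. \<forall>z\<in>ball 0 1. C * norm z \<le> norm (f n z) \<and> norm (f n z) \<le> D * norm z)"

text \<open>\<open>iterated_comp f n\<close> is \<open>f n \<circ> \<dots> \<circ> f 0\<close>, with \<open>n + 1\<close> factors.\<close>

primrec iterated_comp :: "(nat \<Rightarrow> 'a \<Rightarrow> 'a) \<Rightarrow> nat \<Rightarrow> 'a \<Rightarrow> 'a"
  where
    "iterated_comp f 0 = f 0"
  | "iterated_comp f (Suc n) = f (Suc n) \<circ> iterated_comp f n"

definition basin_of_attraction ::
    "(nat \<Rightarrow> complex ^ 'n \<Rightarrow> complex ^ 'n) \<Rightarrow> (complex ^ 'n) set"
  where "basin_of_attraction f = {z. (\<lambda>n. iterated_comp f n z) \<longlonglongrightarrow> 0}"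

end

theory Submission
  imports Defs "HOL-Complex_Analysis.Conformal_Mappings" "HOL-Real_Asymp.Real_Asymp"
begin

text \<open>Unitary coordinate changes make the derivatives of the \<open>f n\<close> at \<open>0\<close> lower triangular,
  \<open>(a x, b y + c x)\<close>. One looks for quadratic maps \<open>h n = id + H n\<close> with
  \<open>h (n + 1) \<circ> f n = g n \<circ> h n\<close> up to third order, where \<open>g n\<close> is \<open>(a x, b y + c x + d x\<^sup>2)\<close>. The
  equations for the coefficients of \<open>H n\<close> are solved backwards in time; only the one for \<open>y\<^sup>2\<close> in the
  first component, with factor \<open>b\<^sup>2 / a\<close>, may be expanding. It is therefore solved separately on each
  train \<open>{2 ^ k..<2 ^ (k + 1)}\<close>, starting from \<open>0\<close> at its end, and at the end of each train the two
  coordinates are swapped, so that the resulting jump is again a lower triangular term \<open>d x\<^sup>2\<close> for the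
  preceding train. The compositions of the \<open>g n\<close> over a train are then of degree two, which is slow
  enough for the basin of \<open>(g n)\<close> to be all of the plane.

  The coefficients of \<open>H n\<close> and \<open>d n\<close> grow at most like \<open>W ^ n\<close> with \<open>W = D powr (- 1/4)\<close>, so the
  error of the conjugation along an orbit is of order \<open>W ^ (2 n) D ^ (3 n)\<close>, much smaller than
  \<open>C ^ n\<close>. Hence the maps \<open>(g (n - 1) \<circ> \<dots> \<circ> g 0)\<^sup>-\<^sup>1 \<circ> h n \<circ> f (n - 1) \<circ> \<dots> \<circ> f 0\<close> converge on the basin,
  and so do the analogous maps in the opposite direction with \<open>id - H n\<close> in place of \<open>h n\<close>; the two
  limits are inverse to each other.\<close>

section \<open>Holomorphic maps in several variables\<close>

text \<open>The factor b^2 / a is at most D^2 / C, which the hypothesis puts below D^(-1/5). Solving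
  backwards from 0 at the end of a train {N..<2N} therefore costs at most D^(-N/5), which is still
  of order D^(-n/5) at every n of the train. Much longer trains would spoil this bound; trains
  growing more slowly would let the degree of the compositions outrun the contraction. The exponent
  1/4 in W leaves a margin over 1/5, and this margin pays for a polynomial cost of the swaps in the
  remaining, nonresonant equations. Since the coefficients grow, the local estimates hold only on
  balls of radius r W^(-n). This suffices because orbits shrink almost like D^n, which is faster.
  Inverting n maps near the origin expands distances almost by C^(-n), and the error is W^(2n)
  D^(3n) = D^(5n/2); as D^(5/2) < D^(11/5) < C, the errors still sum up.\<close>

lemma norm_vector_scalar_mult: "norm (c *s v) = cmod c * norm v" for v :: "complex ^ 'n"
  by (simp add: norm_vec_def norm_mult L2_set_right_distrib)

lemma norm_le_sum_norm_nth: "norm v \<le> (\<Sum>i\<in>UNIV. norm (v $ i))" for v :: "complex ^ 'n"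
  by (simp add: norm_vec_def L2_set_le_sum)

lemma has_derivative_vec_componentwise:
  fixes f :: "'a::real_normed_vector \<Rightarrow> complex ^ 'm"
  assumes "\<And>i. ((\<lambda>z. f z $ i) has_derivative (\<lambda>v. f' v $ i)) F"
  shows "(f has_derivative f') F"
proof -
  have lin: "bounded_linear (axis i :: complex \<Rightarrow> complex ^ 'm)" for i
    unfolding linear_conv_bounded_linear[symmetric] by (auto intro!: linearI simp: axis_def vec_eq_iff)
  have eq: "(\<Sum>i\<in>UNIV. axis i (w $ i)) = w" for w :: "complex ^ 'm"
    by (simp add: vec_eq_iff axis_def if_distrib cong: if_cong)
  have "((\<lambda>z. \<Sum>i\<in>UNIV. axis i (f z $ i)) has_derivative (\<lambda>v. \<Sum>i\<in>UNIV. axis i (f' v $ i))) F"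
    by (intro has_derivative_sum bounded_linear.has_derivative[OF lin] assms)
  then show ?thesis by (simp add: eq)
qed

text \<open>Scalar form of holomorphy at a point, closed under the ring operations, so that
  polynomial maps can be checked one component at a time.\<close>

definition complex_differentiable_at :: "(complex ^ 'n \<Rightarrow> complex) \<Rightarrow> complex ^ 'n \<Rightarrow> bool"
  where "complex_differentiable_at \<phi> z \<longleftrightarrow>
    (\<exists>\<phi>'. (\<phi> has_derivative \<phi>') (at z) \<and> (\<forall>c v. \<phi>' (c *s v) = c * \<phi>' v))"

named_theorems complex_diff_intros

lemma complex_differentiable_at_const [complex_diff_intros]:
  "complex_differentiable_at (\<lambda>z. c) z"
  unfolding complex_differentiable_at_def by (rule exI[of _ "\<lambda>v. 0"]) auto

lemma complex_differentiable_at_nth [complex_diff_intros]: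
  "complex_differentiable_at (\<lambda>z. z $ i) z"
  unfolding complex_differentiable_at_def
  by (rule exI[of _ "\<lambda>v. v $ i"]) (auto intro!: bounded_linear_imp_has_derivative)

lemma complex_differentiable_at_add [complex_diff_intros]:
  assumes "complex_differentiable_at f z" "complex_differentiable_at g z"
  shows "complex_differentiable_at (\<lambda>z. f z + g z) z"
proof -
  obtain f' g' where *: "(f has_derivative f') (at z)" "\<forall>c v. f' (c *s v) = c * f' v"
    "(g has_derivative g') (at z)" "\<forall>c v. g' (c *s v) = c * g' v"
    using assms unfolding complex_differentiable_at_def by blast
  show ?thesis unfolding complex_differentiable_at_def
    by (rule exI[of _ "\<lambda>v. f' v + g' v"])
      (use * in \<open>auto intro!: derivative_eq_intros simp: algebra_simps\<close>)
qed

lemma complex_differentiable_at_diff [complex_diff_intros]: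
  assumes "complex_differentiable_at f z" "complex_differentiable_at g z"
  shows "complex_differentiable_at (\<lambda>z. f z - g z) z"
proof -
  obtain f' g' where *: "(f has_derivative f') (at z)" "\<forall>c v. f' (c *s v) = c * f' v"
    "(g has_derivative g') (at z)" "\<forall>c v. g' (c *s v) = c * g' v"
    using assms unfolding complex_differentiable_at_def by blast
  show ?thesis unfolding complex_differentiable_at_def
    by (rule exI[of _ "\<lambda>v. f' v - g' v"])
      (use * in \<open>auto intro!: derivative_eq_intros simp: algebra_simps\<close>)
qed

lemma complex_differentiable_at_mult [complex_diff_intros]:
  assumes "complex_differentiable_at f z" "complex_differentiable_at g z"
  shows "complex_differentiable_at (\<lambda>z. f z * g z) z"
proof -
  obtain f' g' where *: "(f has_derivative f') (at z)" "\<forall>c v. f' (c *s v) = c * f' v"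
    "(g has_derivative g') (at z)" "\<forall>c v. g' (c *s v) = c * g' v"
    using assms unfolding complex_differentiable_at_def by blast
  show ?thesis unfolding complex_differentiable_at_def
    by (rule exI[of _ "\<lambda>v. f z * g' v + f' v * g z"])
      (use * in \<open>auto intro!: derivative_eq_intros simp: algebra_simps\<close>)
qed

lemma complex_differentiable_at_power [complex_diff_intros]:
  assumes "complex_differentiable_at f z"
  shows "complex_differentiable_at (\<lambda>z. f z ^ n) z"
  by (induction n) (auto intro!: complex_diff_intros assms)

lemma holomorphic_map_onI_componentwise:
  fixes f :: "complex ^ 'n \<Rightarrow> complex ^ 'm"
  assumes "open U" "\<And>z i. z \<in> U \<Longrightarrow> complex_differentiable_at (\<lambda>z. f z $ i) z"
  shows "holomorphic_map_on f U"
  unfolding holomorphic_map_on_def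
proof (intro conjI ballI)
  fix z assume "z \<in> U"
  then have "\<forall>i. \<exists>\<phi>'. ((\<lambda>z. f z $ i) has_derivative \<phi>') (at z) \<and> (\<forall>c v. \<phi>' (c *s v) = c * \<phi>' v)"
    using assms(2) unfolding complex_differentiable_at_def by blast
  then obtain \<phi>' where *: "\<And>i. ((\<lambda>z. f z $ i) has_derivative \<phi>' i) (at z)"
    "\<And>i c v. \<phi>' i (c *s v) = c * \<phi>' i v" by metis
  show "\<exists>f'. (f has_derivative f') (at z) \<and> (\<forall>c v. f' (c *s v) = c *s f' v)"
    by (rule exI[of _ "\<lambda>v. \<chi> i. \<phi>' i v"])
      (use * in \<open>auto intro!: has_derivative_vec_componentwise simp: vec_eq_iff\<close>)
qed fact

lemma holomorphic_map_on_compose: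
  assumes "holomorphic_map_on f U" "holomorphic_map_on g V" "f ` U \<subseteq> V"
  shows "holomorphic_map_on (g \<circ> f) U"
  unfolding holomorphic_map_on_def
proof (intro conjI ballI)
  show "open U" using assms(1) by (simp add: holomorphic_map_on_def)
  fix z assume z: "z \<in> U"
  obtain f' where f': "(f has_derivative f') (at z)" "\<forall>c v. f' (c *s v) = c *s f' v"
    using assms(1) z unfolding holomorphic_map_on_def by blast
  obtain g' where g': "(g has_derivative g') (at (f z))" "\<forall>c v. g' (c *s v) = c *s g' v"
    using assms(2,3) z unfolding holomorphic_map_on_def by blast
  show "\<exists>h'. (g \<circ> f has_derivative h') (at z) \<and> (\<forall>c v. h' (c *s v) = c *s h' v)"
    by (rule exI[of _ "g' \<circ> f'"]) (use f' g' in \<open>auto intro: diff_chain_at\<close>)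
qed

lemma holomorphic_map_on_subset:
  "holomorphic_map_on f U \<Longrightarrow> open V \<Longrightarrow> V \<subseteq> U \<Longrightarrow> holomorphic_map_on f V"
  unfolding holomorphic_map_on_def by blast

lemma holomorphic_map_on_diff:
  assumes "holomorphic_map_on f U" "holomorphic_map_on g U"
  shows "holomorphic_map_on (\<lambda>z. f z - g z) U"
  unfolding holomorphic_map_on_def
proof (intro conjI ballI)
  show "open U" using assms(1) by (simp add: holomorphic_map_on_def)
  fix z assume z: "z \<in> U"
  obtain f' where f': "(f has_derivative f') (at z)" "\<forall>c v. f' (c *s v) = c *s f' v"
    using assms(1) z unfolding holomorphic_map_on_def by blast
  obtain g' where g': "(g has_derivative g') (at z)" "\<forall>c v. g' (c *s v) = c *s g' v"
    using assms(2) z unfolding holomorphic_map_on_def by blast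
  show "\<exists>h'. ((\<lambda>z. f z - g z) has_derivative h') (at z) \<and> (\<forall>c v. h' (c *s v) = c *s h' v)"
    by (rule exI[of _ "\<lambda>v. f' v - g' v"])
      (use f' g' in \<open>auto intro!: derivative_eq_intros simp: vector_ssub_ldistrib\<close>)
qed

section \<open>Restriction to complex lines and Cauchy estimates\<close>

lemma holomorphic_map_on_continuous_on:
  "holomorphic_map_on f U \<Longrightarrow> continuous_on U f"
  unfolding holomorphic_map_on_def
  by (blast intro: continuous_at_imp_continuous_on has_derivative_continuous)

text \<open>Restriction to complex lines brings in one-variable function theory. In the second claim
  \<open>f'\<close> may be any real derivative: by uniqueness it is the complex linear one.\<close>

lemma holomorphic_map_on_line:
  assumes "holomorphic_map_on f U"
  shows "(\<lambda>t. f (z + t *s v) $ i) holomorphic_on {t. z + t *s v \<in> U}"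
    and "z \<in> U \<Longrightarrow> (f has_derivative f') (at z) \<Longrightarrow> 
      ((\<lambda>t. f (z + t *s v) $ i) has_field_derivative f' v $ i) (at 0)"
proof -
  have lin: "((\<lambda>t. z + t *s v) has_derivative (\<lambda>t. t *s v)) (at t)" for t
  proof -
    have "bounded_linear (\<lambda>t. t *s v)"
      by (rule bounded_linear_intro[where K="norm v"])
        (auto simp: vec_eq_iff algebra_simps norm_vector_scalar_mult)
    from bounded_linear_imp_has_derivative[OF this] show ?thesis
      by (auto intro!: derivative_eq_intros)
  qed
  have der: "((\<lambda>t. f (z + t *s v) $ i) has_field_derivative f' v $ i) (at t)"
    if "(f has_derivative f') (at (z + t *s v))" "\<forall>c v. f' (c *s v) = c *s f' v" for t f'
  proof -
    have "((\<lambda>t. f (z + t *s v)) has_derivative (\<lambda>t. f' (t *s v))) (at t)"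
      using diff_chain_at[OF lin that(1)] by (simp add: o_def)
    from bounded_linear.has_derivative[OF bounded_linear_vec_nth this, of i]
    have "((\<lambda>t. f (z + t *s v) $ i) has_derivative (\<lambda>t. f' (t *s v) $ i)) (at t)" .
    moreover have "(\<lambda>t. f' (t *s v) $ i) = (*) (f' v $ i)"
      using that(2) by (auto simp: fun_eq_iff)
    ultimately show ?thesis by (simp add: has_field_derivative_def)
  qed
  have opn: "open {t. z + t *s v \<in> U}"
  proof -
    have "continuous_on UNIV (\<lambda>t. z + t *s v)"
      by (intro continuous_at_imp_continuous_on ballI has_derivative_continuous[OF lin])
    from open_vimage[OF _ this, of U] show ?thesis
      using assms by (simp add: vimage_def holomorphic_map_on_def)
  qed
  show "(\<lambda>t. f (z + t *s v) $ i) holomorphic_on {t. z + t *s v \<in> U}"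
    unfolding holomorphic_on_open[OF opn]
  proof (intro ballI)
    fix t assume "t \<in> {t. z + t *s v \<in> U}"
    then obtain f' where "(f has_derivative f') (at (z + t *s v))" "\<forall>c v. f' (c *s v) = c *s f' v"
      using assms unfolding holomorphic_map_on_def by blast
    from der[OF this] show "\<exists>l. ((\<lambda>t. f (z + t *s v) $ i) has_field_derivative l) (at t)" by blast
  qed
  assume z: "z \<in> U" and f': "(f has_derivative f') (at z)"
  obtain g where g: "(f has_derivative g) (at z)" "\<forall>c v. g (c *s v) = c *s g v"
    using assms z unfolding holomorphic_map_on_def by blast
  have "g = f'" by (rule has_derivative_unique[OF g(1) f'])
  then show "((\<lambda>t. f (z + t *s v) $ i) has_field_derivative f' v $ i) (at 0)"
    using der[of f' 0] f' g(2) by simp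
qed

text \<open>Cauchy's inequality on the complex line through \<open>z\<close> in direction
  \<open>v\<close>, applied to each component; adding the components costs the factor
  \<open>CARD('m)\<close>.\<close>

lemma holomorphic_map_derivative_bound:
  fixes f :: "complex ^ 'n \<Rightarrow> complex ^ 'm"
  assumes "holomorphic_map_on f U" "ball z r \<subseteq> U" "0 < r"
    and B: "\<And>w. w \<in> ball z r \<Longrightarrow> norm (f w) \<le> B"
    and f': "(f has_derivative f') (at z)"
  shows "norm (f' v) \<le> CARD('m) * (B / r) * norm v"
proof -
  have lin: "linear f'" using f' has_derivative_linear by blast
  have zU: "z \<in> U" using assms(2,3) by auto
  have "norm (f' v $ i) \<le> B / \<rho>" if v: "norm v = 1" and \<rho>: "0 < \<rho>" "\<rho> < r" for \<rho> v i
  proof -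
    let ?g = "\<lambda>t. f (z + t *s v) $ i"
    have inb: "z + t *s v \<in> ball z r" if "t \<in> cball 0 \<rho>" for t
      using that \<rho> v by (auto simp: dist_norm norm_vector_scalar_mult)
    have hol: "?g holomorphic_on cball 0 \<rho>"
      by (rule holomorphic_on_subset[OF holomorphic_map_on_line(1)[OF assms(1)]])
        (use inb assms(2) in auto)
    have "norm ((deriv ^^ 1) ?g 0) \<le> fact 1 * B / \<rho> ^ 1"
    proof (rule Cauchy_inequality)
      show "?g holomorphic_on ball 0 \<rho>" using hol holomorphic_on_subset by fastforce
      show "continuous_on (cball 0 \<rho>) ?g" using hol by (rule holomorphic_on_imp_continuous_on)
      show "norm (f (z + t *s v) $ i) \<le> B" if "norm (0 - t) = \<rho>" for t
      proof -
        have "norm (f (z + t *s v) $ i) \<le> norm (f (z + t *s v))" by (rule Finite_Cartesian_Product.norm_nth_le)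
        also have "\<dots> \<le> B" by (rule B[OF inb]) (use that in \<open>auto simp: dist_norm\<close>)
        finally show ?thesis .
      qed
    qed fact
    moreover have "deriv ?g 0 = f' v $ i"
      using holomorphic_map_on_line(2)[OF assms(1) zU f'] by (rule DERIV_imp_deriv)
    ultimately show ?thesis by simp
  qed
  \<comment> \<open>Cauchy's inequality needs closed discs inside the open ball, so it is used for
    radii \<rho> < r, and then \<rho> tends to \<open>r\<close>.\<close>
  then have 1: "norm (f' v $ i) \<le> B / r" if v: "norm v = 1" for v i
  proof -
    have "norm (f' v $ i) * \<rho> \<le> B" if "0 < \<rho>" "\<rho> < r" for \<rho>
      using \<open>\<And>v i \<rho>. \<lbrakk>norm v = 1; 0 < \<rho>; \<rho> < r\<rbrakk> \<Longrightarrow> norm (f' v $ i) \<le> B / \<rho>\<close>[OF v that, of i] that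
      by (simp add: field_simps)
    moreover have "((\<lambda>\<rho>. norm (f' v $ i) * \<rho>) \<longlongrightarrow> norm (f' v $ i) * r) (at_left r)"
      by (intro tendsto_intros)
    ultimately have "norm (f' v $ i) * r \<le> B"
      using \<open>0 < r\<close>
      by (intro tendsto_upperbound[where F="at_left r"])
        (auto simp: eventually_at_left[OF \<open>0 < r\<close>] trivial_limit_at_left_real intro!: exI[of _ 0])
    then show ?thesis using \<open>0 < r\<close> by (simp add: field_simps)
  qed
  have 2: "norm (f' v) \<le> CARD('m) * (B / r)" if "norm v = 1" for v
    by (rule order_trans[OF norm_le_sum_norm_nth sum_bounded_above]) (rule 1[OF that])
  show ?thesis
  proof (cases "v = 0")
    case True
    then show ?thesis using lin linear_0 by auto
  next
    case False
    have "f' v = norm v *\<^sub>R f' (v /\<^sub>R norm v)"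
      using lin False by (simp add: linear_scale)
    then have "norm (f' v) = norm v * norm (f' (v /\<^sub>R norm v))" by simp
    also have "\<dots> \<le> norm v * (CARD('m) * (B / r))"
      by (intro mult_left_mono 2) (use False in auto)
    finally show ?thesis by (simp add: mult.commute)
  qed
qed

text \<open>Cauchy's estimate makes the derivatives converge uniformly as well.\<close>

lemma holomorphic_map_geometric_limit:
  fixes f :: "nat \<Rightarrow> complex ^ 'n \<Rightarrow> complex ^ 'm"
  assumes hol: "\<And>n. holomorphic_map_on (f n) U"
    and step: "\<And>n z. z \<in> U \<Longrightarrow> norm (f (Suc n) z - f n z) \<le> A * q ^ n"
    and q: "0 \<le> q" "q < 1"
    and lim: "\<And>z. z \<in> U \<Longrightarrow> (\<lambda>n. f n z) \<longlonglongrightarrow> g z"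
  shows "holomorphic_map_on g U"
  unfolding holomorphic_map_on_def
proof (intro conjI ballI)
  show opn: "open U" using hol by (simp add: holomorphic_map_on_def)
  fix z0 assume z0: "z0 \<in> U"
  then obtain e where e: "0 < e" "ball z0 e \<subseteq> U"
    using opn open_contains_ball by blast
  \<comment> \<open>Halving the radius gives every point of \<open>?S\<close> a ball of the same
    radius inside \<open>U\<close>, so Cauchy's estimate is uniform on \<open>?S\<close>.\<close>
  define r where "r = e / 2"
  have r: "0 < r" "ball z0 (2 * r) \<subseteq> U" using e by (auto simp: r_def)
  let ?S = "ball z0 r"
  have SU: "?S \<subseteq> U" using subset_ball[of r "2 * r" z0] r by auto
  have "\<forall>n z. \<exists>f'. z \<in> U \<longrightarrow> (f n has_derivative f') (at z) \<and> (\<forall>c v. f' (c *s v) = c *s f' v)"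
    using hol unfolding holomorphic_map_on_def by blast
  then obtain f' where f': "\<And>n z. z \<in> U \<Longrightarrow> (f n has_derivative f' n z) (at z)"
    "\<And>n z c v. z \<in> U \<Longrightarrow> f' n z (c *s v) = c *s f' n z v" by metis
  define K where "K = CARD('m) * (A / r)"
  have A: "0 \<le> A" using order_trans[OF norm_ge_zero step[OF z0, of 0]] by simp
  then have K: "0 \<le> K" using r by (simp add: K_def)
  have dstep: "norm (f' (Suc n) z v - f' n z v) \<le> K * q ^ n * norm v" if z: "z \<in> ?S" for n z v
  proof -
    have sub: "ball z r \<subseteq> U"
    proof -
      have "ball z r \<subseteq> ball z0 (2 * r)"
      proof
        fix w assume "w \<in> ball z r"
        then show "w \<in> ball z0 (2 * r)" using z dist_triangle[of z0 w z] by simp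
      qed
      then show ?thesis using r by auto
    qed
    have zU: "z \<in> U" using z SU by blast
    have "norm (f' (Suc n) z v - f' n z v) \<le> CARD('m) * (A * q ^ n / r) * norm v"
    proof (rule holomorphic_map_derivative_bound[where f = "\<lambda>z. f (Suc n) z - f n z" and U = U])
      show "norm (f (Suc n) w - f n w) \<le> A * q ^ n" if "w \<in> ball z r" for w
        using step that sub by blast
      show "((\<lambda>z. f (Suc n) z - f n z) has_derivative (\<lambda>v. f' (Suc n) z v - f' n z v)) (at z)"
        by (rule has_derivative_diff[OF f'(1)[OF zU] f'(1)[OF zU]])
    qed (use sub r holomorphic_map_on_diff[OF hol hol] in auto)
    then show ?thesis by (simp add: K_def mult_ac)
  qed
  have tele: "norm (f' (n + k) z v - f' n z v) \<le> (\<Sum>i<k. K * q ^ (n + i) * norm v)" if z: "z \<in> ?S" for n k z v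
  proof (induction k)
    case (Suc k)
    have "norm (f' (n + Suc k) z v - f' n z v) \<le> norm (f' (Suc (n + k)) z v - f' (n + k) z v) + norm (f' (n + k) z v - f' n z v)"
      using norm_triangle_ineq[of "f' (Suc (n + k)) z v - f' (n + k) z v" "f' (n + k) z v - f' n z v"] by simp
    then show ?case using Suc dstep[OF z, of "n+k" v] by simp
  qed simp
  have tele': "norm (f' m z v - f' n z v) \<le> K / (1 - q) * q ^ n * norm v" if z: "z \<in> ?S" and "n \<le> m" for n m z v
  proof -
    obtain k where m: "m = n + k" using \<open>n \<le> m\<close> le_Suc_ex by blast
    have "(\<Sum>i<k. q ^ i) \<le> 1 / (1 - q)"
      using q sum_le_suminf[OF summable_geometric[of q], of "{..<k}"] suminf_geometric[of q] by auto
    then have "K * q ^ n * norm v * (\<Sum>i<k. q ^ i) \<le> K * q ^ n * norm v * (1 / (1 - q))"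
      using K q by (intro mult_left_mono) auto
    moreover have "(\<Sum>i<k. K * q ^ (n + i) * norm v) = K * q ^ n * norm v * (\<Sum>i<k. q ^ i)"
      by (simp add: sum_distrib_left power_add mult_ac)
    ultimately show ?thesis using tele[OF z, of n k v] m by (simp add: mult_ac)
  qed
  have small: "(\<lambda>n. K / (1 - q) * q ^ n * N) \<longlonglongrightarrow> 0" for N
    using q by (auto intro!: tendsto_eq_intros LIMSEQ_realpow_zero)
  have conv: "convergent (\<lambda>n. f' n z v)" if z: "z \<in> ?S" for z v
  proof (rule Cauchy_convergent, rule metric_CauchyI)
    fix e :: real assume "0 < e"
    then obtain N where N: "\<And>n. n \<ge> N \<Longrightarrow> norm (K / (1 - q) * q ^ n * norm v) < e / 2"
      using LIMSEQ_D[OF small[of "norm v"], of "e / 2"] by (auto simp del: norm_mult)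
    have *: "dist (f' m z v) (f' N z v) < e / 2" if "m \<ge> N" for m
      using tele'[OF z that, of v] N[of N] by (simp only: dist_norm real_norm_def) linarith
    show "\<exists>M. \<forall>m\<ge>M. \<forall>n\<ge>M. dist (f' m z v) (f' n z v) < e"
    proof (intro exI allI impI)
      fix m n assume "N \<le> m" "N \<le> n"
      then show "dist (f' m z v) (f' n z v) < e"
        using dist_triangle_half_l[OF *[of m] *[of n]] by simp
    qed
  qed
  define G where "G z v = lim (\<lambda>n. f' n z v)" for z v
  have G: "(\<lambda>n. f' n z v) \<longlonglongrightarrow> G z v" if "z \<in> ?S" for z v
    using conv[OF that] by (simp add: G_def convergent_LIMSEQ_iff)
  have bnd: "norm (f' n z v - G z v) \<le> K / (1 - q) * q ^ n * norm v" if z: "z \<in> ?S" for n z v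
  proof -
    have "(\<lambda>m. norm (f' m z v - f' n z v)) \<longlonglongrightarrow> norm (G z v - f' n z v)"
      by (intro tendsto_intros G z)
    then have "norm (G z v - f' n z v) \<le> K / (1 - q) * q ^ n * norm v"
      by (rule LIMSEQ_le_const2) (intro exI allI impI tele'[OF z])
    then show ?thesis by (simp add: norm_minus_commute)
  qed
  have z0S: "z0 \<in> ?S" using r by simp
  have d1: "(f n has_derivative f' n x) (at x within ?S)" if "x \<in> ?S" for n x
    by (rule has_derivative_at_withinI, rule f'(1)) (use that SU in auto)
  have d2: "\<forall>\<^sub>F n in sequentially. \<forall>x\<in>?S. \<forall>h. norm (f' n x h - G x h) \<le> e * norm h" if "0 < e" for e
  proof -
    have ev: "\<forall>\<^sub>F n in sequentially. K / (1 - q) * q ^ n * 1 < e"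
      using order_tendstoD(2)[OF small[of 1] that] by simp
    have "norm (f' n x v - G x v) \<le> e * norm v"
      if "K / (1 - q) * q ^ n * 1 < e" "x \<in> ?S" for n x v
      by (rule order_trans[OF bnd[OF that(2)]], rule mult_right_mono) (use that(1) in auto)
    then show ?thesis by (intro eventually_mono[OF ev]) blast
  qed
  have ex: "\<exists>h. \<forall>x\<in>?S. (\<lambda>n. f n x) \<longlonglongrightarrow> h x \<and> (h has_derivative G x) (at x within ?S)"
    by (rule has_derivative_sequence[OF convex_ball d1 d2 z0S lim[OF z0]])
  from ex obtain h where h: "\<And>x. x \<in> ?S \<Longrightarrow> (\<lambda>n. f n x) \<longlonglongrightarrow> h x"
    "\<And>x. x \<in> ?S \<Longrightarrow> (h has_derivative G x) (at x within ?S)" by blast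
  have hg: "h x = g x" if "x \<in> ?S" for x
    by (rule LIMSEQ_unique[OF h(1)[OF that] lim]) (use that SU in auto)
  have "(h has_derivative G z0) (at z0)"
    using h(2)[OF z0S] at_within_open[OF z0S] by simp
  then have "(g has_derivative G z0) (at z0)"
    by (rule has_derivative_transform_within_open[OF _ open_ball z0S]) (use hg in auto)
  moreover have "G z0 (c *s v) = c *s G z0 v" for c v
  proof -
    have cont: "(\<lambda>n. c *s f' n z0 v) \<longlonglongrightarrow> c *s G z0 v"
      by (rule vec_tendstoI) (auto intro!: tendsto_intros tendsto_vec_nth G z0S)
    have "(\<lambda>n. f' n z0 (c *s v)) = (\<lambda>n. c *s f' n z0 v)"
      using f'(2) z0 by auto
    then show ?thesis using LIMSEQ_unique[OF G[OF z0S, of "c *s v"]] cont by simp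
  qed
  ultimately show "\<exists>g'. (g has_derivative g') (at z0) \<and> (\<forall>c v. g' (c *s v) = c *s g' v)" by blast
qed

section \<open>Almost conjugate non-autonomous systems\<close>

text \<open>Unlike \<open>iterated_comp\<close>, this starts with the identity:
  \<open>orbit f n\<close> applies \<open>f 0\<close> up to \<open>f (n - 1)\<close>, so its value
  is the state at time \<open>n\<close>, to which \<open>f n\<close> and \<open>h n\<close>
  apply.\<close>

primrec orbit :: "(nat \<Rightarrow> 'a \<Rightarrow> 'a) \<Rightarrow> nat \<Rightarrow> 'a \<Rightarrow> 'a"
  where
    "orbit f 0 z = z"
  | "orbit f (Suc n) z = f n (orbit f n z)"

section \<open>Automorphisms and their compositions\<close>

lemma automorphismD:
  assumes "automorphism f"
  shows "bij f" "holomorphic_map_on f UNIV" "holomorphic_map_on (inv f) UNIV"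
  using assms by (auto simp: automorphism_def biholomorphic_map_def)

lemma automorphism_compose:
  assumes "automorphism f" "automorphism g"
  shows "automorphism (g \<circ> f)"
proof -
  have "bij (g \<circ> f)" using assms by (simp add: automorphismD bij_comp)
  moreover have "inv (g \<circ> f) = inv f \<circ> inv g"
    using assms by (simp add: automorphismD o_inv_distrib)
  ultimately show ?thesis
    using assms by (simp add: automorphism_def biholomorphic_map_def)
      (meson holomorphic_map_on_compose subset_UNIV)
qed

lemma automorphismI:
  assumes "holomorphic_map_on f UNIV" "holomorphic_map_on g UNIV"
    and gf: "\<And>z. g (f z) = z" and fg: "\<And>z. f (g z) = z"
  shows "automorphism f" "inv f = g"
proof -
  have bij: "bij f" using gf fg by (metis bijI')
  show "inv f = g" using gf fg by (metis inv_equality ext)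
  with bij assms show "automorphism f" by (simp add: automorphism_def biholomorphic_map_def)
qed

lemma automorphism_id: "automorphism (\<lambda>z :: complex ^ 'n. z)"
  by (rule automorphismI(1)[where g = "\<lambda>z. z"])
    (auto intro!: holomorphic_map_onI_componentwise complex_diff_intros)

lemma automorphism_orbit:
  assumes "\<And>n. automorphism (f n)"
  shows "automorphism (orbit f n)"
proof (induction n)
  case 0
  then show ?case using automorphism_id by (simp add: fun_eq_iff[symmetric])
next
  case (Suc n)
  have "orbit f (Suc n) = f n \<circ> orbit f n" by auto
  then show ?case using automorphism_compose[OF Suc assms[of n]] by (simp only:)
qed

text \<open>A path lifting argument: the preimage of the segment from \<open>f u\<close> to \<open>p\<close> cannot
  leave the ball of radius \<open>s\<close>.\<close>

lemma norm_inv_automorphism_le: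
  assumes f: "automorphism f" and "0 < s" "0 < C"
    and low: "\<And>q. norm (q - u) \<le> s \<Longrightarrow> C * norm (q - u) \<le> norm (f q - f u)"
    and p: "norm (p - f u) \<le> C * s"
  shows "norm (inv f p - u) \<le> s"
proof (rule ccontr)
  assume far: "\<not> norm (inv f p - u) \<le> s"
  have bij: "bij f" using automorphismD f by blast
  then have finv: "f (inv f w) = w" "inv f (f w) = w" for w
    by (auto simp: bij_is_surj surj_f_inv_f bij_is_inj inv_f_f)
  define \<gamma> where "\<gamma> t = norm (inv f (f u + t *\<^sub>R (p - f u)) - u)" for t :: real
  have "continuous_on UNIV (inv f)"
    using automorphismD(3)[OF f] by (rule holomorphic_map_on_continuous_on)
  then have "continuous_on {0..1} (\<lambda>t :: real. inv f (f u + t *\<^sub>R (p - f u)))"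
    by (rule continuous_on_compose2) (auto intro!: continuous_intros)
  then have "continuous_on {0..1} \<gamma>"
    unfolding \<gamma>_def by (intro continuous_intros)
  then obtain t where t: "0 \<le> t" "t \<le> 1" "\<gamma> t = s"
    using IVT'[of \<gamma> 0 s 1] far \<open>0 < s\<close> by (auto simp: \<gamma>_def finv)
  \<comment> \<open>Only a proper initial piece of the segment is used, which makes the final
    inequality strict.\<close>
  have "t \<noteq> 1" using t far by (auto simp: \<gamma>_def)
  have "p \<noteq> f u" using far \<open>0 < s\<close> finv by auto
  have "C * s \<le> norm (t *\<^sub>R (p - f u))"
    using low[of "inv f (f u + t *\<^sub>R (p - f u))"] t by (simp add: \<gamma>_def finv)
  also have "\<dots> < norm (p - f u)" using t \<open>t \<noteq> 1\<close> \<open>p \<noteq> f u\<close> by simp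
  finally show False using p by simp
qed

text \<open>\<open>s\<close> is the rate at which the balls of validity shrink, \<open>D1\<close>
  and \<open>C1\<close> bound the maps from above and below on them, and \<tau> is the error rate. A
  cubic defect with coefficient \<open>s ^ (-2 n)\<close> on an orbit of size \<open>D1 ^ n\<close>
  is of order \<open>\<tau> ^ n\<close>; as \<tau> < C1 it survives backward iteration, and as
  \<tau> < s it does not push points out of the balls.\<close>

locale tame_constants =
  fixes s r D1 C1 \<tau> :: real
  assumes s: "0 < s" "s \<le> 1" and r: "0 < r" and D1: "0 < D1" "D1 < s"
    and tau: "0 < \<tau>" "\<tau> < C1" "\<tau> < s" "D1 ^ 3 \<le> \<tau> * s ^ 2"
begin

definition tame :: "(nat \<Rightarrow> complex ^ 'n \<Rightarrow> complex ^ 'n) \<Rightarrow> bool"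
  where "tame \<phi> \<longleftrightarrow> (\<forall>n. automorphism (\<phi> n)) \<and>
    (\<forall>n z. norm z \<le> r * s ^ n \<longrightarrow> norm (\<phi> n z) \<le> D1 * norm z) \<and>
    (\<forall>n z w. norm z \<le> r * s ^ n \<longrightarrow> norm w \<le> r * s ^ n \<longrightarrow>
      C1 * norm (z - w) \<le> norm (\<phi> n z - \<phi> n w))"

text \<open>Entering one of the balls is enough: since \<open>D1 < s\<close>, a tame orbit then
  stays in all the later ones.\<close>

definition fast_basin :: "(nat \<Rightarrow> complex ^ 'n \<Rightarrow> complex ^ 'n) \<Rightarrow> (complex ^ 'n) set"
  where "fast_basin \<phi> = {z. \<exists>n. norm (orbit \<phi> n z) < r * s ^ n}"

text \<open>The defect has order three, and its coefficient may grow like the square of the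
  coefficients of \<open>h n\<close>; this is the denominator \<open>s ^ (2 * n)\<close>.\<close>

definition almost_conj :: "(nat \<Rightarrow> complex ^ 'n \<Rightarrow> complex ^ 'n) \<Rightarrow> (nat \<Rightarrow> complex ^ 'n \<Rightarrow> complex ^ 'n) \<Rightarrow>
    (nat \<Rightarrow> complex ^ 'n \<Rightarrow> complex ^ 'n) \<Rightarrow> real \<Rightarrow> bool"
  where "almost_conj h \<phi> \<psi> K \<longleftrightarrow> (\<forall>n. holomorphic_map_on (h n) UNIV) \<and>
    (\<forall>n z. norm z \<le> r * s ^ n \<longrightarrow> norm (h n z) \<le> 2 * norm z) \<and>
    (\<forall>n z. norm z \<le> r * s ^ n \<longrightarrow> norm (h (Suc n) (\<phi> n z) - \<psi> n (h n z)) \<le> K * norm z ^ 3 / s ^ (2 * n))"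

lemma tame_iter_le:
  assumes "tame \<phi>" "norm (orbit \<phi> n z) \<le> r * s ^ n"
  shows "norm (orbit \<phi> (n + k) z) \<le> D1 ^ k * norm (orbit \<phi> n z)
    \<and> norm (orbit \<phi> (n + k) z) \<le> r * s ^ (n + k)"
proof (induction k)
  case (Suc k)
  let ?z = "orbit \<phi> (n + k) z"
  have 1: "norm (\<phi> (n + k) ?z) \<le> D1 * norm ?z" using assms(1) Suc by (simp add: tame_def)
  also have "\<dots> \<le> D1 * (D1 ^ k * norm (orbit \<phi> n z))"
    using Suc D1 by (intro mult_left_mono) auto
  finally have 2: "norm (\<phi> (n + k) ?z) \<le> D1 ^ Suc k * norm (orbit \<phi> n z)" by (simp add: mult_ac)
  have "D1 * norm ?z \<le> s * (r * s ^ (n + k))"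
    using Suc D1 by (intro mult_mono) auto
  with 1 2 show ?case by (simp add: mult_ac)
qed (use assms in auto)

lemma tame_iter_geometric:
  assumes "tame \<phi>" "norm (orbit \<phi> n z) \<le> r * s ^ n" "n \<le> m"
  shows "norm (orbit \<phi> m z) \<le> r / D1 ^ n * D1 ^ m" "norm (orbit \<phi> m z) \<le> r * s ^ m"
proof -
  obtain k where m: "m = n + k" using assms(3) le_Suc_ex by blast
  have "r * s ^ n \<le> r" using r s by (simp add: mult_left_le power_le_one)
  then have "D1 ^ k * norm (orbit \<phi> n z) \<le> D1 ^ k * r"
    using assms(2) D1 by (intro mult_left_mono) auto
  moreover have "r / D1 ^ n * D1 ^ m = D1 ^ k * r" using D1 by (simp add: m power_add)
  ultimately show "norm (orbit \<phi> m z) \<le> r / D1 ^ n * D1 ^ m"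
    "norm (orbit \<phi> m z) \<le> r * s ^ m"
    using tame_iter_le[OF assms(1,2), of k] m by auto
qed

lemma eventually_small:
  assumes "0 \<le> A" "0 \<le> B"
  shows "\<exists>N. \<forall>m\<ge>N. A * D1 ^ m + B * \<tau> ^ m < r * s ^ m"
proof -
  have "(\<lambda>m. A * (D1 / s) ^ m + B * (\<tau> / s) ^ m) \<longlonglongrightarrow> A * 0 + B * 0"
    using s D1 tau by (intro tendsto_intros LIMSEQ_realpow_zero) auto
  then have "\<forall>\<^sub>F m in sequentially. A * (D1 / s) ^ m + B * (\<tau> / s) ^ m < r"
    using r by (auto intro: order_tendstoD(2))
  then obtain N where N: "\<And>m. m \<ge> N \<Longrightarrow> A * (D1 / s) ^ m + B * (\<tau> / s) ^ m < r"
    by (auto simp: eventually_sequentially)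
  have "A * D1 ^ m + B * \<tau> ^ m < r * s ^ m" if "m \<ge> N" for m
    using N[OF that] s by (simp add: power_divide field_simps)
  then show ?thesis by blast
qed

lemma tame_iter_lower:
  assumes "tame \<phi>" "\<And>m. n \<le> m \<Longrightarrow> m \<le> n + k \<Longrightarrow> norm (orbit \<phi> m z) \<le> r * s ^ m"
    "\<And>m. n \<le> m \<Longrightarrow> m \<le> n + k \<Longrightarrow> norm (orbit \<phi> m w) \<le> r * s ^ m"
  shows "C1 ^ k * norm (orbit \<phi> n z - orbit \<phi> n w)
    \<le> norm (orbit \<phi> (n + k) z - orbit \<phi> (n + k) w)"
  using assms(2,3)
proof (induction k)
  case (Suc k)
  have "C1 ^ Suc k * norm (orbit \<phi> n z - orbit \<phi> n w)
      \<le> C1 * norm (orbit \<phi> (n + k) z - orbit \<phi> (n + k) w)"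
    using Suc tau by (auto simp: mult.assoc intro!: mult_left_mono)
  also have "\<dots> \<le> norm (orbit \<phi> (n + Suc k) z - orbit \<phi> (n + Suc k) w)"
    using Suc assms(1) by (simp add: tame_def)
  finally show ?case .
qed auto

text \<open>Distances shrink by at most \<open>C1\<close> per step, so two orbits that approach each
  other at the faster rate \<tau> must already coincide.\<close>

lemma tame_eq_if_close:
  assumes "tame \<phi>" "norm (orbit \<phi> n z) \<le> r * s ^ n" "norm (orbit \<phi> n w) \<le> r * s ^ n"
    and close: "\<And>m. m \<ge> n \<Longrightarrow> norm (orbit \<phi> m z - orbit \<phi> m w) \<le> B * \<tau> ^ m"
  shows "z = w"
proof -
  let ?d = "norm (orbit \<phi> n z - orbit \<phi> n w)"
  have "?d \<le> B * \<tau> ^ n * (\<tau> / C1) ^ k" for k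
  proof -
    have "C1 ^ k * ?d \<le> norm (orbit \<phi> (n + k) z - orbit \<phi> (n + k) w)"
      by (rule tame_iter_lower) (use assms tame_iter_geometric(2) in auto)
    also have "\<dots> \<le> B * \<tau> ^ (n + k)" by (rule close) auto
    finally show ?thesis using tau by (simp add: field_simps power_divide power_add)
  qed
  moreover have "(\<lambda>k. B * \<tau> ^ n * (\<tau> / C1) ^ k) \<longlonglongrightarrow> B * \<tau> ^ n * 0"
    using tau by (intro tendsto_intros LIMSEQ_realpow_zero) auto
  ultimately have "?d \<le> 0" by (intro LIMSEQ_le_const) auto
  then have "orbit \<phi> n z = orbit \<phi> n w" by simp
  moreover have "bij (orbit \<phi> n)"
    using assms(1) automorphismD(1) automorphism_orbit unfolding tame_def by blast
  ultimately show ?thesis by (metis bij_is_inj injD)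
qed

text \<open>\<open>u n z\<close> is a \<psi>-orbit up to errors of order \<open>\<tau> ^ n\<close>,
  and pulling back by \<open>n\<close> steps of \<psi> expands by at most \<open>C1 ^ (-n)\<close>
  up to a constant, so the pullbacks converge geometrically. Fixing the entry time \<open>n0\<close>
  makes all constants uniform on \<open>U\<close>, which the holomorphy of the limit
  requires.\<close>

lemma local_conjugacy:
  fixes n0 :: nat and h \<phi> \<psi> :: "nat \<Rightarrow> complex ^ 'n \<Rightarrow> complex ^ 'n"
  assumes \<phi>: "tame \<phi>" and \<psi>: "tame \<psi>" and h: "almost_conj h \<phi> \<psi> K" and K: "0 \<le> K"
  defines "u \<equiv> \<lambda>n z. h n (orbit \<phi> n z)"
  defines "U \<equiv> {z. norm (orbit \<phi> n0 z) < r * s ^ n0}"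
  shows "\<exists>y. holomorphic_map_on y U \<and> (\<forall>z\<in>U. (\<lambda>n. inv (orbit \<psi> n) (u n z)) \<longlonglongrightarrow> y z) \<and>
    (\<exists>B N. \<forall>z\<in>U. \<forall>m\<ge>N. norm (orbit \<psi> m (y z) - u m z) \<le> B * \<tau> ^ m)"
proof -
  have aut\<phi>: "automorphism (orbit \<phi> n)" and aut\<psi>: "automorphism (orbit \<psi> n)" for n
    using \<phi> \<psi> by (auto simp: tame_def intro: automorphism_orbit)
  have finv: "orbit \<psi> n (inv (orbit \<psi> n) w) = w"
    "inv (orbit \<psi> n) (orbit \<psi> n w) = w" for n w
    using automorphismD(1)[OF aut\<psi>] by (auto simp: bij_is_surj surj_f_inv_f bij_is_inj inv_f_f)
  have invstep: "orbit \<psi> n w = inv (\<psi> n) (orbit \<psi> (Suc n) w)" for n w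
    using \<psi> automorphismD(1)[of "\<psi> n"] by (simp add: tame_def bij_is_inj inv_f_f)
  have opn: "open U"
  proof -
    have "continuous_on UNIV (orbit \<phi> n0)"
      by (intro holomorphic_map_on_continuous_on automorphismD aut\<phi>)
    then show ?thesis unfolding U_def by (intro open_Collect_less continuous_intros)
  qed
  define A where "A = r / D1 ^ n0"
  have A: "0 < A" using r D1 by (simp add: A_def)
  \<comment> \<open>Chosen to reproduce itself in the backward error recursion:
    \<open>C1 * B = B * \<tau> + (K * A ^ 3 + 1)\<close>. The summand 1 keeps \<open>B\<close>
    positive when \<open>K = 0\<close>.\<close>
  define B where "B = (K * A ^ 3 + 1) / (C1 - \<tau>)"
  have B: "0 < B" using K A tau by (auto simp: B_def intro!: divide_pos_pos add_nonneg_pos)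
  obtain N' where N': "\<And>m. m \<ge> N' \<Longrightarrow> 2 * A * D1 ^ m + B * \<tau> ^ m < r * s ^ m"
    using eventually_small[of "2 * A" B] A B by auto
  define N where "N = max N' n0"
  have orb: "norm (orbit \<phi> m z) \<le> A * D1 ^ m" "norm (orbit \<phi> m z) \<le> r * s ^ m"
    if "z \<in> U" "m \<ge> N" for z m
    using tame_iter_geometric[OF \<phi>, of n0 z m] that by (auto simp: U_def A_def N_def)
  have u: "norm (u m z) \<le> 2 * A * D1 ^ m" if "z \<in> U" "m \<ge> N" for z m
  proof -
    have "norm (u m z) \<le> 2 * norm (orbit \<phi> m z)"
      using h orb(2)[OF that] by (simp add: almost_conj_def u_def)
    then show ?thesis using orb(1)[OF that] by simp
  qed
  have inball: "norm p \<le> r * s ^ m" if "z \<in> U" "m \<ge> N" "norm (p - u m z) \<le> B * \<tau> ^ m" for z m p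
    using u[OF that(1,2)] N'[of m] that norm_triangle_ineq[of "p - u m z" "u m z"] by (auto simp: N_def)
  have ustep: "norm (u (Suc m) z - \<psi> m (u m z)) \<le> B * (C1 - \<tau>) * \<tau> ^ m" if "z \<in> U" "m \<ge> N" for z m
  proof -
    have "norm (u (Suc m) z - \<psi> m (u m z)) \<le> K * norm (orbit \<phi> m z) ^ 3 / s ^ (2 * m)"
      using h orb(2)[OF that] by (simp add: almost_conj_def u_def)
    also have "\<dots> \<le> K * (A * D1 ^ m) ^ 3 / s ^ (2 * m)"
      using K s orb[OF that] by (intro divide_right_mono mult_left_mono power_mono) auto
    also have "\<dots> = K * A ^ 3 * (D1 ^ 3 / s ^ 2) ^ m"
      by (simp add: power_mult_distrib power_divide power_mult[symmetric] mult.commute)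
    also have "\<dots> \<le> (K * A ^ 3 + 1) * \<tau> ^ m"
      using K A s tau D1 by (intro mult_mono power_mono) (auto simp: divide_le_eq)
    also have "\<dots> = B * (C1 - \<tau>) * \<tau> ^ m" using tau by (simp add: B_def)
    finally show ?thesis .
  qed
  define x where "x n z = inv (orbit \<psi> n) (u n z)" for n z
  \<comment> \<open>Downward induction from \<open>m = n\<close>, where the two points coincide.
    Going back one step adds one defect and then divides the distance by \<open>C1\<close> at
    worst.\<close>
  have shadow: "norm (orbit \<psi> m (x n z) - u m z) \<le> B * \<tau> ^ m"
    if z: "z \<in> U" and mn: "N \<le> m" "m \<le> n" for z m n
    using mn(2,1)
  proof (induction rule: inc_induct)
    case base
    then show ?case using B tau by (simp add: x_def finv)
  next
    case (step m)
    let ?p = "orbit \<psi> (Suc m) (x n z)"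
    have "norm (inv (\<psi> m) ?p - u m z) \<le> B * \<tau> ^ m"
    proof (rule norm_inv_automorphism_le)
      show "automorphism (\<psi> m)" using \<psi> by (simp add: tame_def)
      show "0 < B * \<tau> ^ m" "0 < C1" using B tau by auto
      show "C1 * norm (q - u m z) \<le> norm (\<psi> m q - \<psi> m (u m z))" if "norm (q - u m z) \<le> B * \<tau> ^ m" for q
        using \<psi> inball[OF z step.prems that] inball[OF z step.prems, of "u m z"] B tau
        by (simp add: tame_def)
      have "norm (?p - \<psi> m (u m z)) \<le> norm (?p - u (Suc m) z) + norm (u (Suc m) z - \<psi> m (u m z))"
        using norm_triangle_ineq[of "?p - u (Suc m) z" "u (Suc m) z - \<psi> m (u m z)"] by simp
      also have "\<dots> \<le> B * \<tau> ^ Suc m + B * (C1 - \<tau>) * \<tau> ^ m"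
        using step.IH step.prems ustep[OF z step.prems] by (intro add_mono) auto
      also have "\<dots> = C1 * (B * \<tau> ^ m)" by (simp add: algebra_simps)
      finally show "norm (?p - \<psi> m (u m z)) \<le> C1 * (B * \<tau> ^ m)" .
    qed
    then show ?case by (subst invstep)
  qed
  \<comment> \<open>The estimates start at time \<open>N\<close>, so convergence is proved for the
    states at time \<open>N\<close> and carried back to time 0 by the automorphism
    \<open>inv (orbit \<psi> N)\<close>.\<close>
  define y where "y n z = orbit \<psi> N (x (N + n) z)" for n z
  have ystep: "norm (y (Suc k) z - y k z) \<le> B * \<tau> ^ N * (\<tau> / C1) ^ k" if z: "z \<in> U" for k z
  proof -
    have "C1 ^ k * norm (orbit \<psi> N (x (N + Suc k) z) - orbit \<psi> N (x (N + k) z))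
        \<le> norm (orbit \<psi> (N + k) (x (N + Suc k) z) - orbit \<psi> (N + k) (x (N + k) z))"
      by (rule tame_iter_lower[OF \<psi>]) (auto intro!: inball[OF z] shadow[OF z])
    also have "orbit \<psi> (N + k) (x (N + k) z) = u (N + k) z" by (simp add: x_def finv)
    also have "norm (orbit \<psi> (N + k) (x (N + Suc k) z) - u (N + k) z) \<le> B * \<tau> ^ (N + k)"
      by (rule shadow[OF z]) auto
    finally show ?thesis using tau by (simp add: y_def field_simps power_divide power_add)
  qed
  have q: "0 \<le> \<tau> / C1" "\<tau> / C1 < 1" using tau by auto
  have "convergent (\<lambda>n. y n z)" if z: "z \<in> U" for z
  proof -
    have "summable (\<lambda>k. B * \<tau> ^ N * (\<tau> / C1) ^ k)"
      using q by (intro summable_mult summable_geometric) auto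
    then have "summable (\<lambda>k. y (Suc k) z - y k z)"
      by (rule summable_comparison_test[OF _ , rotated]) (use ystep[OF z] in auto)
    then have "convergent (\<lambda>n. y n z - y 0 z)"
      by (simp add: summable_iff_convergent sum_lessThan_telescope[of "\<lambda>n. y n z"])
    then show ?thesis by (simp add: convergent_diff_const_right_iff)
  qed
  then have ylim: "(\<lambda>n. y n z) \<longlonglongrightarrow> lim (\<lambda>n. y n z)" if "z \<in> U" for z
    using that convergent_LIMSEQ_iff by blast
  define g where "g z = lim (\<lambda>n. y n z)" for z
  have holu: "holomorphic_map_on (u n) UNIV" for n
    using holomorphic_map_on_compose[OF automorphismD(2)[OF aut\<phi>], of "h n" UNIV n] h
    by (simp add: u_def almost_conj_def o_def)
  have holx: "holomorphic_map_on (x n) UNIV" for n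
    using holomorphic_map_on_compose[OF holu automorphismD(3)[OF aut\<psi>], of n n] by (simp add: x_def[abs_def] o_def)
  have "holomorphic_map_on (y n) UNIV" for n
    using holomorphic_map_on_compose[OF holx automorphismD(2)[OF aut\<psi>], of "N + n" N] by (simp add: y_def[abs_def] o_def)
  then have "holomorphic_map_on (y n) U" for n
    by (rule holomorphic_map_on_subset[OF _ opn]) auto
  then have holg: "holomorphic_map_on g U"
    by (rule holomorphic_map_geometric_limit[where f = y, OF _ ystep q]) (use ylim in \<open>auto simp: g_def\<close>)
  define Y where "Y z = inv (orbit \<psi> N) (g z)" for z
  have "holomorphic_map_on Y U"
    using holomorphic_map_on_compose[OF holg automorphismD(3)[OF aut\<psi>], of N] by (simp add: Y_def[abs_def] o_def)
  moreover have lim: "(\<lambda>n. x n z) \<longlonglongrightarrow> Y z" if "z \<in> U" for z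
  proof -
    have "isCont (inv (orbit \<psi> N)) (g z)"
      using holomorphic_map_on_continuous_on[OF automorphismD(3)[OF aut\<psi>]]
      by (simp add: continuous_on_eq_continuous_at)
    then have "(\<lambda>n. inv (orbit \<psi> N) (y n z)) \<longlonglongrightarrow> Y z"
      using ylim[OF that] isCont_tendsto_compose unfolding g_def Y_def by blast
    then have "(\<lambda>n. x (N + n) z) \<longlonglongrightarrow> Y z" by (simp add: y_def finv)
    then show ?thesis using LIMSEQ_offset[of "\<lambda>n. x n z" N] by (simp add: add.commute[of N])
  qed
  moreover have "norm (orbit \<psi> m (Y z) - u m z) \<le> B * \<tau> ^ m" if z: "z \<in> U" and m: "m \<ge> N" for z m
  proof (rule LIMSEQ_le_const2)
    have "isCont (orbit \<psi> m) (Y z)"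
      using holomorphic_map_on_continuous_on[OF automorphismD(2)[OF aut\<psi>]]
      by (simp add: continuous_on_eq_continuous_at)
    then have "(\<lambda>n. orbit \<psi> m (x n z)) \<longlonglongrightarrow> orbit \<psi> m (Y z)"
      by (rule isCont_tendsto_compose[OF _ lim[OF z]])
    then show "(\<lambda>n. norm (orbit \<psi> m (x n z) - u m z)) \<longlonglongrightarrow> norm (orbit \<psi> m (Y z) - u m z)"
      by (intro tendsto_intros)
    show "\<exists>n0. \<forall>n\<ge>n0. norm (orbit \<psi> m (x n z) - u m z) \<le> B * \<tau> ^ m"
      using shadow[OF z m] by blast
  qed
  ultimately show ?thesis unfolding x_def by blast
qed

lemma open_fast_basin: "tame \<phi> \<Longrightarrow> open (fast_basin \<phi>)" for \<phi> :: "nat \<Rightarrow> complex ^ 'n \<Rightarrow> complex ^ 'n"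
proof -
  assume "tame \<phi>"
  then have "continuous_on UNIV (orbit \<phi> n)" for n
    by (intro holomorphic_map_on_continuous_on automorphismD automorphism_orbit) (auto simp: tame_def)
  then have "open {z. norm (orbit \<phi> n z) < r * s ^ n}" for n
    by (intro open_Collect_less continuous_intros)
  moreover have "fast_basin \<phi> = (\<Union>n. {z. norm (orbit \<phi> n z) < r * s ^ n})"
    by (auto simp: fast_basin_def)
  ultimately show ?thesis by auto
qed

text \<open>For every entry time the local map is the pointwise limit of the same sequence
  \<open>x n\<close>, so the local maps glue. The constants \<open>B\<close> and \<open>N\<close>
  may now depend on the point.\<close>

lemma global_conjugacy:
  fixes h \<phi> \<psi> :: "nat \<Rightarrow> complex ^ 'n \<Rightarrow> complex ^ 'n"
  assumes "tame \<phi>" "tame \<psi>" "almost_conj h \<phi> \<psi> K" "0 \<le> K"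
  obtains \<Phi> where "holomorphic_map_on \<Phi> (fast_basin \<phi>)"
    "\<And>z. z \<in> fast_basin \<phi> \<Longrightarrow> \<exists>B N. \<forall>m\<ge>N. norm (orbit \<psi> m (\<Phi> z) - h m (orbit \<phi> m z)) \<le> B * \<tau> ^ m"
proof
  define x where "x n z = inv (orbit \<psi> n) (h n (orbit \<phi> n z))" for n z
  define \<Phi> where "\<Phi> z = lim (\<lambda>n. x n z)" for z
  have *: "holomorphic_map_on \<Phi> {z. norm (orbit \<phi> n z) < r * s ^ n} \<and>
    (\<exists>B N. \<forall>z\<in>{z. norm (orbit \<phi> n z) < r * s ^ n}. \<forall>m\<ge>N. norm (orbit \<psi> m (\<Phi> z) - h m (orbit \<phi> m z)) \<le> B * \<tau> ^ m)" for n
  proof -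
    let ?U = "{z. norm (orbit \<phi> n z) < r * s ^ n}"
    obtain y where y: "holomorphic_map_on y ?U" "\<And>z. z \<in> ?U \<Longrightarrow> (\<lambda>n. x n z) \<longlonglongrightarrow> y z"
      "\<exists>B N. \<forall>z\<in>?U. \<forall>m\<ge>N. norm (orbit \<psi> m (y z) - h m (orbit \<phi> m z)) \<le> B * \<tau> ^ m"
      using local_conjugacy[OF assms, of n] unfolding x_def by blast
    have eq: "\<Phi> z = y z" if "z \<in> ?U" for z using y(2)[OF that] by (simp add: \<Phi>_def limI)
    have "holomorphic_map_on \<Phi> ?U"
      unfolding holomorphic_map_on_def
    proof (intro conjI ballI)
      show opn: "open ?U" using y(1) by (simp add: holomorphic_map_on_def)
      fix z assume z: "z \<in> ?U"
      then obtain f' where f': "(y has_derivative f') (at z)" "\<forall>c v. f' (c *s v) = c *s f' v"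
        using y(1) unfolding holomorphic_map_on_def by blast
      have "(\<Phi> has_derivative f') (at z)"
        by (rule has_derivative_transform_within_open[OF f'(1) opn z]) (simp add: eq)
      with f' show "\<exists>f'. (\<Phi> has_derivative f') (at z) \<and> (\<forall>c v. f' (c *s v) = c *s f' v)" by blast
    qed
    moreover have "\<exists>B N. \<forall>z\<in>?U. \<forall>m\<ge>N. norm (orbit \<psi> m (\<Phi> z) - h m (orbit \<phi> m z)) \<le> B * \<tau> ^ m"
      using y(3) by (simp only: eq cong: ball_cong)
    ultimately show ?thesis by blast
  qed
  show "holomorphic_map_on \<Phi> (fast_basin \<phi>)"
    unfolding holomorphic_map_on_def
  proof (intro conjI ballI open_fast_basin[OF assms(1)])
    fix z assume "z \<in> fast_basin \<phi>"
    then obtain n where "z \<in> {z. norm (orbit \<phi> n z) < r * s ^ n}"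
      by (auto simp: fast_basin_def)
    with *[of n] show "\<exists>f'. (\<Phi> has_derivative f') (at z) \<and> (\<forall>c v. f' (c *s v) = c *s f' v)"
      unfolding holomorphic_map_on_def by blast
  qed
  show "\<exists>B N. \<forall>m\<ge>N. norm (orbit \<psi> m (\<Phi> z) - h m (orbit \<phi> m z)) \<le> B * \<tau> ^ m"
    if "z \<in> fast_basin \<phi>" for z
  proof -
    from that obtain n where "z \<in> {z. norm (orbit \<phi> n z) < r * s ^ n}"
      by (auto simp: fast_basin_def)
    with *[of n] show ?thesis by blast
  qed
qed

lemma fast_basin_orbit:
  assumes "tame \<phi>" "z \<in> fast_basin \<phi>"
  obtains A n where "0 \<le> A" "\<And>m. m \<ge> n \<Longrightarrow> norm (orbit \<phi> m z) \<le> A * D1 ^ m"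
    "\<And>m. m \<ge> n \<Longrightarrow> norm (orbit \<phi> m z) \<le> r * s ^ m"
proof -
  obtain n where n: "norm (orbit \<phi> n z) \<le> r * s ^ n"
    using assms(2) by (auto simp: fast_basin_def intro: less_imp_le)
  show ?thesis
    by (rule that[of "r / D1 ^ n" n]) (use tame_iter_geometric[OF assms(1) n] r D1 in auto)
qed

text \<open>The image of a fast orbit has size of order \<open>D1 ^ m\<close> and the error has
  order \<open>\<tau> ^ m\<close>; both fall below \<open>r * s ^ m\<close>.\<close>

lemma fast_basin_if_close:
  assumes \<phi>: "tame \<phi>" and \<psi>: "tame \<psi>" and w: "w \<in> fast_basin \<psi>" and k: "almost_conj k \<psi> \<phi> K"
    and close: "\<exists>B N. \<forall>m\<ge>N. norm (orbit \<phi> m z - k m (orbit \<psi> m w)) \<le> B * \<tau> ^ m"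
  shows "z \<in> fast_basin \<phi>"
proof -
  obtain B N where B: "\<And>m. m \<ge> N \<Longrightarrow> norm (orbit \<phi> m z - k m (orbit \<psi> m w)) \<le> B * \<tau> ^ m"
    using close by blast
  obtain A n where A: "0 \<le> A" "\<And>m. m \<ge> n \<Longrightarrow> norm (orbit \<psi> m w) \<le> A * D1 ^ m"
    "\<And>m. m \<ge> n \<Longrightarrow> norm (orbit \<psi> m w) \<le> r * s ^ m"
    using fast_basin_orbit[OF \<psi> w] by metis
  obtain N' where N': "\<And>m. m \<ge> N' \<Longrightarrow> 2 * A * D1 ^ m + \<bar>B\<bar> * \<tau> ^ m < r * s ^ m"
    using eventually_small[of "2 * A" "\<bar>B\<bar>"] A by auto
  define m where "m = max N (max n N')"
  have m: "m \<ge> N" "m \<ge> n" "m \<ge> N'" by (auto simp: m_def)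
  have "norm (k m (orbit \<psi> m w)) \<le> 2 * norm (orbit \<psi> m w)"
    using k A(3)[OF m(2)] by (simp add: almost_conj_def)
  then have "norm (k m (orbit \<psi> m w)) \<le> 2 * A * D1 ^ m" using A(2)[OF m(2)] by simp
  moreover have "B * \<tau> ^ m \<le> \<bar>B\<bar> * \<tau> ^ m" using tau by (intro mult_right_mono) auto
  moreover have "norm (orbit \<phi> m z) \<le> norm (orbit \<phi> m z - k m (orbit \<psi> m w))
      + norm (k m (orbit \<psi> m w))"
    using norm_triangle_ineq[of "orbit \<phi> m z - k m (orbit \<psi> m w)" "k m (orbit \<psi> m w)"] by simp
  ultimately have "norm (orbit \<phi> m z) < r * s ^ m" using B[OF m(1)] N'[OF m(3)] by linarith
  then show ?thesis by (auto simp: fast_basin_def)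
qed

text \<open>\<open>id - H\<close> inverts \<open>id + H\<close> only up to third order; together
  with a Lipschitz bound this is all that the round trip between the two systems needs.\<close>

definition almost_inverse :: "(nat \<Rightarrow> complex ^ 'n \<Rightarrow> complex ^ 'n) \<Rightarrow> (nat \<Rightarrow> complex ^ 'n \<Rightarrow> complex ^ 'n) \<Rightarrow>
    real \<Rightarrow> bool"
  where "almost_inverse k h K \<longleftrightarrow>
    (\<forall>n z. norm z \<le> r * s ^ n \<longrightarrow> norm (k n (h n z) - z) \<le> K * norm z ^ 3 / s ^ (2 * n)) \<and>
    (\<forall>n z w. norm z \<le> r * s ^ n \<longrightarrow> norm w \<le> r * s ^ n \<longrightarrow> norm (k n z - k n w) \<le> 2 * norm (z - w))"

text \<open>Going to the other system and back yields a point whose orbit stays within a multiple of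
  \<open>\<tau> ^ m\<close> of the original one, and \<open>tame_eq_if_close\<close> leaves only one
  such point.\<close>

lemma conjugacy_round_trip:
  assumes \<phi>: "tame \<phi>" and \<psi>: "tame \<psi>" and z: "z \<in> fast_basin \<phi>" and z': "z' \<in> fast_basin \<phi>"
    and w: "w \<in> fast_basin \<psi>" and h: "almost_conj h \<phi> \<psi> K'" and kh: "almost_inverse k h K" and K: "0 \<le> K"
    and close1: "\<exists>B N. \<forall>m\<ge>N. norm (orbit \<psi> m w - h m (orbit \<phi> m z)) \<le> B * \<tau> ^ m"
    and close2: "\<exists>B N. \<forall>m\<ge>N. norm (orbit \<phi> m z' - k m (orbit \<psi> m w)) \<le> B * \<tau> ^ m"
  shows "z = z'"
proof -
  obtain B1 N1 where B1: "\<And>m. m \<ge> N1 \<Longrightarrow> norm (orbit \<psi> m w - h m (orbit \<phi> m z)) \<le> B1 * \<tau> ^ m"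
    using close1 by blast
  obtain B2 N2 where B2: "\<And>m. m \<ge> N2 \<Longrightarrow> norm (orbit \<phi> m z' - k m (orbit \<psi> m w)) \<le> B2 * \<tau> ^ m"
    using close2 by blast
  obtain A n1 where A: "0 \<le> A" "\<And>m. m \<ge> n1 \<Longrightarrow> norm (orbit \<phi> m z) \<le> A * D1 ^ m"
    "\<And>m. m \<ge> n1 \<Longrightarrow> norm (orbit \<phi> m z) \<le> r * s ^ m"
    using fast_basin_orbit[OF \<phi> z] by metis
  obtain A' n2 where A': "0 \<le> A'" "\<And>m. m \<ge> n2 \<Longrightarrow> norm (orbit \<phi> m z') \<le> A' * D1 ^ m"
    "\<And>m. m \<ge> n2 \<Longrightarrow> norm (orbit \<phi> m z') \<le> r * s ^ m"
    using fast_basin_orbit[OF \<phi> z'] by metis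
  obtain A'' n3 where A'': "0 \<le> A''" "\<And>m. m \<ge> n3 \<Longrightarrow> norm (orbit \<psi> m w) \<le> A'' * D1 ^ m"
    "\<And>m. m \<ge> n3 \<Longrightarrow> norm (orbit \<psi> m w) \<le> r * s ^ m"
    using fast_basin_orbit[OF \<psi> w] by metis
  obtain N' where N': "\<And>m. m \<ge> N' \<Longrightarrow> 2 * A * D1 ^ m + 0 * \<tau> ^ m < r * s ^ m"
    using eventually_small[of "2 * A" 0] A by auto
  define N where "N = Max {N1, N2, n1, n2, n3, N'}"
  have N: "N1 \<le> N" "N2 \<le> N" "n1 \<le> N" "n2 \<le> N" "n3 \<le> N" "N' \<le> N" by (auto simp: N_def)
  show ?thesis
  proof (rule tame_eq_if_close[OF \<phi>, of N])
    show "norm (orbit \<phi> N z) \<le> r * s ^ N" "norm (orbit \<phi> N z') \<le> r * s ^ N"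
      using A A' N by auto
    fix m assume m: "N \<le> m"
    let ?F = "orbit \<phi> m z" and ?F' = "orbit \<phi> m z'" and ?G = "orbit \<psi> m w"
    have F: "norm ?F \<le> A * D1 ^ m" "norm ?F \<le> r * s ^ m" and G: "norm ?G \<le> r * s ^ m"
      using A A'' N m by auto
    have "norm (h m ?F) \<le> 2 * norm ?F" using h F by (simp add: almost_conj_def)
    then have hF: "norm (h m ?F) \<le> r * s ^ m" using F N'[of m] N m by simp
    have "norm (k m (h m ?F) - ?F) \<le> K * norm ?F ^ 3 / s ^ (2 * m)"
      using kh F by (simp add: almost_inverse_def)
    also have "\<dots> \<le> K * (A * D1 ^ m) ^ 3 / s ^ (2 * m)"
      using K s F by (intro divide_right_mono mult_left_mono power_mono) auto
    also have "\<dots> = K * A ^ 3 * (D1 ^ 3 / s ^ 2) ^ m"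
      by (simp add: power_mult_distrib power_divide power_mult[symmetric] mult.commute)
    also have "\<dots> \<le> K * A ^ 3 * \<tau> ^ m"
      using K A s tau D1 by (intro mult_mono power_mono) (auto simp: divide_le_eq)
    finally have 1: "norm (k m (h m ?F) - ?F) \<le> K * A ^ 3 * \<tau> ^ m" .
    have "norm (k m (h m ?F) - k m ?G) \<le> 2 * norm (h m ?F - ?G)"
      using kh hF G by (simp add: almost_inverse_def)
    then have 2: "norm (k m (h m ?F) - k m ?G) \<le> 2 * (B1 * \<tau> ^ m)"
      using B1[of m] N m by (simp add: norm_minus_commute)
    have 3: "norm (?F' - k m ?G) \<le> B2 * \<tau> ^ m" using B2 N m by auto
    have "norm (?F - ?F') \<le> norm (k m (h m ?F) - ?F) + norm (k m (h m ?F) - k m ?G) + norm (?F' - k m ?G)"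
      using norm_triangle_ineq[of "?F - k m (h m ?F)" "k m (h m ?F) - k m ?G + (k m ?G - ?F')"]
        norm_triangle_ineq[of "k m (h m ?F) - k m ?G" "k m ?G - ?F'"]
      by (simp add: norm_minus_commute)
    then show "norm (?F - ?F') \<le> (K * A ^ 3 + 2 * B1 + B2) * \<tau> ^ m"
      using 1 2 3 by (simp add: algebra_simps)
  qed
qed

lemma biholomorphic_fast_basin:
  fixes h k \<phi> \<psi> :: "nat \<Rightarrow> complex ^ 'n \<Rightarrow> complex ^ 'n"
  assumes \<phi>: "tame \<phi>" and \<psi>: "tame \<psi>" and K: "0 \<le> K"
    and h: "almost_conj h \<phi> \<psi> K" and k: "almost_conj k \<psi> \<phi> K"
    and kh: "almost_inverse k h K" and hk: "almost_inverse h k K"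
    and univ: "fast_basin \<psi> = UNIV"
  shows "biholomorphic (fast_basin \<phi>) (UNIV :: (complex ^ 'n) set)"
proof -
  obtain \<Phi> where \<Phi>: "holomorphic_map_on \<Phi> (fast_basin \<phi>)"
    "\<And>z. z \<in> fast_basin \<phi> \<Longrightarrow> \<exists>B N. \<forall>m\<ge>N. norm (orbit \<psi> m (\<Phi> z) - h m (orbit \<phi> m z)) \<le> B * \<tau> ^ m"
    using global_conjugacy[OF \<phi> \<psi> h K] by blast
  obtain \<Psi> where \<Psi>: "holomorphic_map_on \<Psi> UNIV"
    "\<And>w. \<exists>B N. \<forall>m\<ge>N. norm (orbit \<phi> m (\<Psi> w) - k m (orbit \<psi> m w)) \<le> B * \<tau> ^ m"
    using global_conjugacy[OF \<psi> \<phi> k K] univ by auto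
  have mem: "\<Psi> w \<in> fast_basin \<phi>" for w
    by (rule fast_basin_if_close[OF \<phi> \<psi> _ k \<Psi>(2)]) (simp add: univ)
  have \<Psi>\<Phi>: "\<Psi> (\<Phi> z) = z" if "z \<in> fast_basin \<phi>" for z
    by (rule conjugacy_round_trip[OF \<phi> \<psi> that mem _ h kh K \<Phi>(2)[OF that] \<Psi>(2), symmetric]) (simp add: univ)
  have \<Phi>\<Psi>: "\<Phi> (\<Psi> w) = w" for w
    by (rule conjugacy_round_trip[OF \<psi> \<phi> _ _ mem k hk K \<Psi>(2) \<Phi>(2)[OF mem], symmetric]) (simp_all add: univ)
  have bij: "bij_betw \<Phi> (fast_basin \<phi>) UNIV"
    by (rule bij_betw_byWitness[where f' = \<Psi>]) (use \<Psi>\<Phi> \<Phi>\<Psi> mem in auto)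
  have "inv_into (fast_basin \<phi>) \<Phi> = \<Psi>"
    using \<Phi>\<Psi> mem bij by (intro ext inv_into_f_eq) (auto simp: bij_betw_def)
  with bij \<Phi>(1) \<Psi>(1) have "biholomorphic_map (fast_basin \<phi>) UNIV \<Phi>"
    by (simp add: biholomorphic_map_def)
  then show ?thesis by (auto simp: biholomorphic_def)
qed

end

section \<open>Taylor expansion of second order\<close>

text \<open>Hadamard quotient with the removable singularity filled in. Iterating it gives Taylor
  coefficients and remainders that inherit explicit bounds by the maximum principle.\<close>

definition diff_quot :: "(complex \<Rightarrow> complex) \<Rightarrow> complex \<Rightarrow> complex"
  where "diff_quot g x = (if x = 0 then deriv g 0 else (g x - g 0) / x)"

lemma diff_quot_eq: "g x = g 0 + x * diff_quot g x"
  by (simp add: diff_quot_def)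

lemma diff_quot_holomorphic:
  assumes "g holomorphic_on ball 0 \<rho>"
  shows "diff_quot g holomorphic_on ball 0 \<rho>"
  using pole_lemma_open[OF assms open_ball, of 0] by (simp add: diff_quot_def[abs_def] cong: if_cong)

text \<open>The factor \<open>4\<close> (instead of the sharp \<open>2\<close>) avoids a limiting argument at the boundary.\<close>

lemma norm_diff_quot_le:
  assumes hol: "g holomorphic_on ball 0 \<rho>" and B: "\<And>x. x \<in> ball 0 \<rho> \<Longrightarrow> norm (g x) \<le> B"
    and x: "x \<in> ball 0 \<rho>"
  shows "norm (diff_quot g x) \<le> 4 * B / \<rho>"
proof -
  have \<rho>: "0 < \<rho>" using x norm_ge_zero le_less_trans by (auto simp del: norm_ge_zero)
  define e where "e = max (norm x) (\<rho> / 2)"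
  have e: "0 < e" "e < \<rho>" "\<rho> / 2 \<le> e" "norm x \<le> e" using \<rho> x by (auto simp: e_def)
  have B0: "0 \<le> B" using B[of 0] \<rho> norm_ge_zero[of "g 0"] by (auto simp del: norm_ge_zero)
  have sub: "cball 0 e \<subseteq> ball (0::complex) \<rho>" using e by auto
  have hd: "diff_quot g holomorphic_on ball 0 \<rho>" by (rule diff_quot_holomorphic[OF hol])
  show ?thesis
  proof (rule maximum_modulus_frontier[where S = "cball 0 e" and f = "diff_quot g" and \<xi> = x])
    show "diff_quot g holomorphic_on interior (cball 0 e)"
      by (rule holomorphic_on_subset[OF hd]) (use e in auto)
    have "continuous_on (cball 0 e) (diff_quot g)"
      using hd sub holomorphic_on_imp_continuous_on holomorphic_on_subset by blast
    then show "continuous_on (closure (cball 0 e)) (diff_quot g)" by simp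
    show "norm (diff_quot g z) \<le> 4 * B / \<rho>" if "z \<in> frontier (cball 0 e)" for z
    proof -
      have z: "norm z = e" using that e by (simp add: frontier_cball)
      then have "z \<noteq> 0" using e by auto
      have "norm (g z - g 0) \<le> 2 * B"
        using norm_triangle_ineq4[of "g z" "g 0"] B[of z] B[of 0] z e \<rho> by auto
      then have "norm (diff_quot g z) \<le> 2 * B / e"
        using \<open>z \<noteq> 0\<close> z e by (simp add: diff_quot_def norm_divide divide_right_mono)
      also have "\<dots> \<le> 2 * B / (\<rho> / 2)" using e \<rho> B0 by (intro divide_left_mono) auto
      finally show ?thesis by simp
    qed
  qed (use e in auto)
qed

text \<open>This weak form of two-variable holomorphy with a bound is preserved by difference
  quotients in \<open>x\<close>, which is what the iterated expansion uses.\<close>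

definition sep_holomorphic :: "real \<Rightarrow> real \<Rightarrow> (complex \<Rightarrow> complex \<Rightarrow> complex) \<Rightarrow> bool"
  where "sep_holomorphic \<rho> B \<phi> \<longleftrightarrow>
    (\<forall>y\<in>ball 0 \<rho>. (\<lambda>x. \<phi> x y) holomorphic_on ball 0 \<rho>) \<and>
    (\<forall>x\<in>ball 0 \<rho>. \<phi> x holomorphic_on ball 0 \<rho>) \<and>
    (\<forall>x\<in>ball 0 \<rho>. \<forall>y\<in>ball 0 \<rho>. norm (\<phi> x y) \<le> B)"

text \<open>The delicate point is holomorphy in \<open>y\<close> at \<open>x = 0\<close>, where the
  quotient is a derivative in the other variable. It is a locally uniform limit of the quotients at
  small \<open>x \<noteq> 0\<close>.\<close>

lemma sep_holomorphic_diff_quot: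
  assumes \<phi>: "sep_holomorphic \<rho> B \<phi>" and \<rho>: "0 < \<rho>"
  shows "sep_holomorphic \<rho> (4 * B / \<rho>) (\<lambda>x y. diff_quot (\<lambda>x. \<phi> x y) x)"
proof -
  let ?d = "\<lambda>x y. diff_quot (\<lambda>x. \<phi> x y) x"
  have hx: "(\<lambda>x. ?d x y) holomorphic_on ball 0 \<rho>" if "y \<in> ball 0 \<rho>" for y
    using diff_quot_holomorphic[of "\<lambda>x. \<phi> x y" \<rho>] \<phi> that by (auto simp: sep_holomorphic_def)
  have bd: "norm (?d x y) \<le> 4 * B / \<rho>" if "x \<in> ball 0 \<rho>" "y \<in> ball 0 \<rho>" for x y
    by (rule norm_diff_quot_le) (use \<phi> that in \<open>auto simp: sep_holomorphic_def\<close>)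
  have hy: "?d x holomorphic_on ball 0 \<rho>" if "x \<in> ball 0 \<rho>" "x \<noteq> 0" for x
    using \<phi> that \<rho> by (auto simp: diff_quot_def sep_holomorphic_def intro!: holomorphic_intros)
  define t where "t n = \<rho> / (real n + 2)" for n :: nat
  have t: "0 < t n" "t n < \<rho>" for n
    using \<rho> by (auto simp: t_def field_simps add_pos_nonneg)
  have pt: "of_real (t n) \<in> ball (0::complex) \<rho>" "(of_real (t n) :: complex) \<noteq> 0" for n
    using t[of n] by auto
  have hy0: "?d 0 holomorphic_on ball 0 \<rho>"
  proof (rule holomorphic_uniform_sequence[where f = "\<lambda>n. ?d (of_real (t n))"])
    show "?d (of_real (t n)) holomorphic_on ball 0 \<rho>" for n
      by (rule hy[OF pt])
    fix y :: complex assume y: "y \<in> ball 0 \<rho>"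
    then obtain d where d: "0 < d" "cball y d \<subseteq> ball 0 \<rho>"
      using open_contains_cball open_ball by blast
    \<comment> \<open>Bound for the second difference quotient; it makes the convergence as
      \<open>x\<close> tends to 0 uniform in \<open>y\<close>.\<close>
    define M where "M = 4 * (4 * B / \<rho>) / \<rho>"
    have close: "norm (?d (of_real (t n)) w - ?d 0 w) \<le> t n * M"
      if w: "w \<in> ball 0 \<rho>" for n w
    proof -
      have b: "norm (diff_quot (\<lambda>x. ?d x w) (of_real (t n))) \<le> M"
        unfolding M_def
      proof (rule norm_diff_quot_le)
        show "(\<lambda>x. ?d x w) holomorphic_on ball 0 \<rho>" by (rule hx[OF w])
        show "norm (?d x w) \<le> 4 * B / \<rho>" if "x \<in> ball 0 \<rho>" for x by (rule bd[OF that w])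
        show "of_real (t n) \<in> ball (0::complex) \<rho>" by (rule pt)
      qed
      have "?d (of_real (t n)) w = ?d 0 w + of_real (t n) * diff_quot (\<lambda>x. ?d x w) (of_real (t n))"
        by (rule diff_quot_eq[of "\<lambda>x. ?d x w"])
      then have "?d (of_real (t n)) w - ?d 0 w = of_real (t n) * diff_quot (\<lambda>x. ?d x w) (of_real (t n))"
        by (simp only: add_diff_cancel_left')
      then have "norm (?d (of_real (t n)) w - ?d 0 w) = t n * norm (diff_quot (\<lambda>x. ?d x w) (of_real (t n)))"
        using t(1)[of n] by (simp only: norm_mult norm_of_real abs_of_pos)
      also have "\<dots> \<le> t n * M" using b t(1)[of n] by (intro mult_left_mono) auto
      finally show ?thesis .
    qed
    have tlim: "(\<lambda>n. t n * M) \<longlonglongrightarrow> 0"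
      unfolding t_def by real_asymp
    have "uniform_limit (cball y d) (\<lambda>n. ?d (of_real (t n))) (?d 0) sequentially"
    proof (rule uniform_limitI)
      fix e :: real assume "0 < e"
      show "\<forall>\<^sub>F n in sequentially. \<forall>w\<in>cball y d. dist (?d (of_real (t n)) w) (?d 0 w) < e"
        using order_tendstoD(2)[OF tlim \<open>0 < e\<close>]
      proof (rule eventually_mono)
        fix n assume n: "t n * M < e"
        show "\<forall>w\<in>cball y d. dist (?d (of_real (t n)) w) (?d 0 w) < e"
        proof
          fix w assume "w \<in> cball y d"
          then have "w \<in> ball 0 \<rho>" using d by blast
          from close[OF this, of n] n
          show "dist (?d (of_real (t n)) w) (?d 0 w) < e" unfolding dist_norm by linarith
        qed
      qed
    qed
    with d show "\<exists>d>0. cball y d \<subseteq> ball 0 \<rho> \<and>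
        uniform_limit (cball y d) (\<lambda>n. ?d (of_real (t n))) (?d 0) sequentially"
      by blast
  qed simp
  have hy': "?d x holomorphic_on ball 0 \<rho>" if "x \<in> ball 0 \<rho>" for x
    using hy[OF that] hy0 by (cases "x = 0") auto
  show ?thesis unfolding sep_holomorphic_def using hx hy' bd by blast
qed

text \<open>Three quotients in \<open>x\<close>, and then quotients in \<open>y\<close> of what is
  left at \<open>x = 0\<close>. On the disc of radius 1/2 each quotient multiplies the bound by 8;
  this gives 64 for the second order and 512 for the third.\<close>

lemma sep_holomorphic_taylor:
  assumes \<phi>: "sep_holomorphic (1/2) 1 \<phi>" and zero: "\<phi> 0 0 = 0"
  shows "\<exists>q1 q2 q3. norm q1 \<le> 64 \<and> norm q2 \<le> 64 \<and> norm q3 \<le> 64 \<and>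
    (\<forall>x\<in>ball 0 (1/2). \<forall>y\<in>ball 0 (1/2).
      norm (\<phi> x y - (deriv (\<lambda>x. \<phi> x 0) 0 * x + deriv (\<phi> 0) 0 * y) - (q1 * y\<^sup>2 + q2 * (x * y) + q3 * x\<^sup>2))
        \<le> 512 * (norm y ^ 3 + norm x * norm y ^ 2 + norm x ^ 2 * norm y + norm x ^ 3))"
proof -
  define \<phi>1 where "\<phi>1 x y = diff_quot (\<lambda>x. \<phi> x y) x" for x y
  define \<phi>2 where "\<phi>2 x y = diff_quot (\<lambda>x. \<phi>1 x y) x" for x y
  define \<phi>3 where "\<phi>3 x y = diff_quot (\<lambda>x. \<phi>2 x y) x" for x y
  have s1: "sep_holomorphic (1/2) 8 \<phi>1"
    using sep_holomorphic_diff_quot[OF \<phi>] by (simp add: \<phi>1_def[abs_def])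
  have s2: "sep_holomorphic (1/2) 64 \<phi>2"
    using sep_holomorphic_diff_quot[OF s1] by (simp add: \<phi>2_def[abs_def])
  have s3: "sep_holomorphic (1/2) 512 \<phi>3"
    using sep_holomorphic_diff_quot[OF s2] by (simp add: \<phi>3_def[abs_def])
  have dq: "diff_quot g holomorphic_on ball 0 (1/2) \<and> (\<forall>x\<in>ball 0 (1/2). norm (diff_quot g x) \<le> 8 * B)"
    if "g holomorphic_on ball 0 (1/2)" "\<forall>x\<in>ball 0 (1/2). norm (g x) \<le> B" for g B
    using diff_quot_holomorphic[OF that(1)] norm_diff_quot_le[OF that(1), of B] that(2) by auto
  have f0: "\<phi> 0 holomorphic_on ball 0 (1/2) \<and> (\<forall>x\<in>ball 0 (1/2). norm (\<phi> 0 x) \<le> 1)"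
    "\<phi>1 0 holomorphic_on ball 0 (1/2) \<and> (\<forall>x\<in>ball 0 (1/2). norm (\<phi>1 0 x) \<le> 8)"
    "\<phi>2 0 holomorphic_on ball 0 (1/2) \<and> (\<forall>x\<in>ball 0 (1/2). norm (\<phi>2 0 x) \<le> 64)"
    using \<phi> s1 s2 by (auto simp: sep_holomorphic_def)
  define g1 where "g1 = diff_quot (\<phi> 0)"
  define g2 where "g2 = diff_quot g1"
  define g3 where "g3 = diff_quot g2"
  define k1 where "k1 = diff_quot (\<phi>1 0)"
  define k2 where "k2 = diff_quot k1"
  define l1 where "l1 = diff_quot (\<phi>2 0)"
  have g1: "g1 holomorphic_on ball 0 (1/2) \<and> (\<forall>x\<in>ball 0 (1/2). norm (g1 x) \<le> 8)"
    using dq[of "\<phi> 0" 1] f0 by (simp add: g1_def)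
  have g2: "g2 holomorphic_on ball 0 (1/2) \<and> (\<forall>x\<in>ball 0 (1/2). norm (g2 x) \<le> 64)"
    using dq[of g1 8] g1 by (simp add: g2_def)
  have g3: "g3 holomorphic_on ball 0 (1/2) \<and> (\<forall>x\<in>ball 0 (1/2). norm (g3 x) \<le> 512)"
    using dq[of g2 64] g2 by (simp add: g3_def)
  have k1: "k1 holomorphic_on ball 0 (1/2) \<and> (\<forall>x\<in>ball 0 (1/2). norm (k1 x) \<le> 64)"
    using dq[of "\<phi>1 0" 8] f0 by (simp add: k1_def)
  have k2: "k2 holomorphic_on ball 0 (1/2) \<and> (\<forall>x\<in>ball 0 (1/2). norm (k2 x) \<le> 512)"
    using dq[of k1 64] k1 by (simp add: k2_def)
  have l1: "l1 holomorphic_on ball 0 (1/2) \<and> (\<forall>x\<in>ball 0 (1/2). norm (l1 x) \<le> 512)"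
    using dq[of "\<phi>2 0" 64] f0 by (simp add: l1_def)
  have exp: "\<phi> x y - (deriv (\<lambda>x. \<phi> x 0) 0 * x + deriv (\<phi> 0) 0 * y) - (g2 0 * y\<^sup>2 + k1 0 * (x * y) + \<phi>2 0 0 * x\<^sup>2)
      = y ^ 3 * g3 y + x * y ^ 2 * k2 y + x ^ 2 * y * l1 y + x ^ 3 * \<phi>3 x y" for x y
  proof -
    have "\<phi> x y = \<phi> 0 y + x * \<phi>1 x y" "\<phi>1 x y = \<phi>1 0 y + x * \<phi>2 x y" "\<phi>2 x y = \<phi>2 0 y + x * \<phi>3 x y"
      using diff_quot_eq[of "\<lambda>x. \<phi> x y" x] diff_quot_eq[of "\<lambda>x. \<phi>1 x y" x] diff_quot_eq[of "\<lambda>x. \<phi>2 x y" x]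
      by (simp_all add: \<phi>1_def[symmetric] \<phi>2_def[symmetric] \<phi>3_def[symmetric])
    moreover have "\<phi> 0 y = \<phi> 0 0 + y * g1 y" "g1 y = g1 0 + y * g2 y" "g2 y = g2 0 + y * g3 y"
      "\<phi>1 0 y = \<phi>1 0 0 + y * k1 y" "k1 y = k1 0 + y * k2 y" "\<phi>2 0 y = \<phi>2 0 0 + y * l1 y"
      unfolding g1_def g2_def g3_def k1_def k2_def l1_def by (rule diff_quot_eq)+
    moreover have "deriv (\<lambda>x. \<phi> x 0) 0 = \<phi>1 0 0" "deriv (\<phi> 0) 0 = g1 0"
      by (simp_all add: \<phi>1_def g1_def diff_quot_def)
    ultimately show ?thesis using zero by (simp add: power2_eq_square power3_eq_cube algebra_simps)
  qed
  have "norm (\<phi> x y - (deriv (\<lambda>x. \<phi> x 0) 0 * x + deriv (\<phi> 0) 0 * y) - (g2 0 * y\<^sup>2 + k1 0 * (x * y) + \<phi>2 0 0 * x\<^sup>2))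
        \<le> 512 * (norm y ^ 3 + norm x * norm y ^ 2 + norm x ^ 2 * norm y + norm x ^ 3)"
    if x: "x \<in> ball 0 (1/2)" and y: "y \<in> ball 0 (1/2)" for x y
  proof -
    have b: "norm (g3 y) \<le> 512" "norm (k2 y) \<le> 512" "norm (l1 y) \<le> 512" "norm (\<phi>3 x y) \<le> 512"
      using g3 k2 l1 s3 x y by (auto simp: sep_holomorphic_def)
    have "norm (y ^ 3 * g3 y + x * y ^ 2 * k2 y + x ^ 2 * y * l1 y + x ^ 3 * \<phi>3 x y)
        \<le> norm (y ^ 3 * g3 y) + norm (x * y ^ 2 * k2 y) + norm (x ^ 2 * y * l1 y) + norm (x ^ 3 * \<phi>3 x y)"
      by (intro norm_triangle_mono order_refl)
    also have "\<dots> \<le> norm y ^ 3 * 512 + norm x * norm y ^ 2 * 512 + norm x ^ 2 * norm y * 512 + norm x ^ 3 * 512"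
      unfolding norm_mult norm_power by (intro add_mono mult_left_mono b) auto
    finally show ?thesis by (simp only: exp) simp
  qed
  moreover have "norm (g2 0) \<le> 64" "norm (k1 0) \<le> 64" "norm (\<phi>2 0 0) \<le> 64"
    using g2 k1 f0(3) by auto
  ultimately show ?thesis by blast
qed

section \<open>Second-order expansion of maps of the plane\<close>

lemma norm_vec2_le: "norm z \<le> norm (z $ 1) + norm (z $ 2)" for z :: "complex ^ 2"
  using norm_le_sum_norm_nth[of z] by (simp add: sum_2)

lemma vec2_decomp: "z = z $ 1 *s vector [1, 0] + z $ 2 *s vector [0, 1]" for z :: "complex ^ 2"
  by (simp add: vec_eq_iff forall_2)

text \<open>In each component the order is \<open>y^2\<close>, \<open>x y\<close>,
  \<open>x^2\<close>, so the first coefficient is the one that can be resonant.\<close>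

definition quad :: "complex \<Rightarrow> complex \<Rightarrow> complex \<Rightarrow> complex \<Rightarrow> complex \<Rightarrow> complex \<Rightarrow> complex ^ 2 \<Rightarrow> complex ^ 2"
  where "quad q1 q2 q3 q4 q5 q6 z =
    vector [q1 * (z $ 2)\<^sup>2 + q2 * (z $ 1 * z $ 2) + q3 * (z $ 1)\<^sup>2,
            q4 * (z $ 2)\<^sup>2 + q5 * (z $ 1 * z $ 2) + q6 * (z $ 1)\<^sup>2]"

lemma norm_quad_comp_le:
  fixes x y :: complex
  assumes "norm q1 \<le> M" "norm q2 \<le> M" "norm q3 \<le> M" "norm x \<le> N" "norm y \<le> N"
  shows "norm (q1 * y\<^sup>2 + q2 * (x * y) + q3 * x\<^sup>2) \<le> 3 * M * N\<^sup>2"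
proof -
  have M: "0 \<le> M" using assms(1) norm_ge_zero order_trans by blast
  have N: "0 \<le> N" using assms(4) norm_ge_zero order_trans by blast
  have "norm (q1 * y\<^sup>2 + q2 * (x * y) + q3 * x\<^sup>2) \<le> norm (q1 * y\<^sup>2) + norm (q2 * (x * y)) + norm (q3 * x\<^sup>2)"
    by (intro norm_triangle_mono order_refl)
  also have "\<dots> \<le> M * N\<^sup>2 + M * (N * N) + M * N\<^sup>2"
    unfolding norm_mult norm_power using assms M N by (intro add_mono mult_mono power_mono) auto
  finally show ?thesis by (simp add: power2_eq_square)
qed

lemma norm_quad_le:
  assumes "norm q1 \<le> M" "norm q2 \<le> M" "norm q3 \<le> M" "norm q4 \<le> M" "norm q5 \<le> M" "norm q6 \<le> M"
  shows "norm (quad q1 q2 q3 q4 q5 q6 z) \<le> 6 * M * norm z ^ 2"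
proof -
  have n: "norm (z $ 1) \<le> norm z" "norm (z $ 2) \<le> norm z"
    by (rule Finite_Cartesian_Product.norm_nth_le)+
  have "norm (quad q1 q2 q3 q4 q5 q6 z $ 1) \<le> 3 * M * (norm z)\<^sup>2"
    unfolding quad_def vector_2 by (rule norm_quad_comp_le[OF assms(1-3) n])
  moreover have "norm (quad q1 q2 q3 q4 q5 q6 z $ 2) \<le> 3 * M * (norm z)\<^sup>2"
    unfolding quad_def vector_2 by (rule norm_quad_comp_le[OF assms(4-6) n])
  ultimately show ?thesis using norm_vec2_le[of "quad q1 q2 q3 q4 q5 q6 z"] by simp
qed

text \<open>Points whose coordinates are both below 1/2 lie in the unit ball, where the bound is
  known. The constant is 4096 = 2 * 4 * 512, from two components with four cubic monomials
  each.\<close>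

lemma holomorphic_map_taylor:
  fixes f L :: "complex ^ 2 \<Rightarrow> complex ^ 2"
  assumes hol: "holomorphic_map_on f UNIV" and bd: "\<And>z. norm z < 1 \<Longrightarrow> norm (f z) \<le> 1" and zero: "f 0 = 0"
    and L: "(f has_derivative L) (at 0)" "\<And>c v. L (c *s v) = c *s L v"
  shows "\<exists>q1 q2 q3 q4 q5 q6. norm q1 \<le> 64 \<and> norm q2 \<le> 64 \<and> norm q3 \<le> 64 \<and>
    norm q4 \<le> 64 \<and> norm q5 \<le> 64 \<and> norm q6 \<le> 64 \<and>
    (\<forall>z. norm z < 1/2 \<longrightarrow> norm (f z - L z - quad q1 q2 q3 q4 q5 q6 z) \<le> 4096 * norm z ^ 3)"
proof -
  have v0: "vector [0, 0] = (0 :: complex ^ 2)" by (simp add: vec_eq_iff forall_2)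
  have lin: "L (u + v) = L u + L v" for u v
    using L(1) has_derivative_linear linear_add by blast
  define \<phi> where "\<phi> i x y = f (vector [x, y]) $ i" for i :: 2 and x y
  have sep: "sep_holomorphic (1/2) 1 (\<phi> i)" for i
    unfolding sep_holomorphic_def
  proof (intro conjI ballI)
    fix y :: complex
    have "(\<lambda>x. f (vector [0, y] + x *s vector [1, 0]) $ i) holomorphic_on {x. vector [0, y] + x *s (vector [1, 0] :: complex ^ 2) \<in> UNIV}"
      by (rule holomorphic_map_on_line(1)[OF hol])
    moreover have "vector [0, y] + x *s vector [1, 0] = (vector [x, y] :: complex ^ 2)" for x
      by (simp add: vec_eq_iff forall_2)
    ultimately have "(\<lambda>x. \<phi> i x y) holomorphic_on UNIV" by (simp add: \<phi>_def)
    then show "(\<lambda>x. \<phi> i x y) holomorphic_on ball 0 (1/2)" using holomorphic_on_subset by blast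
  next
    fix x :: complex
    have "(\<lambda>y. f (vector [x, 0] + y *s vector [0, 1]) $ i) holomorphic_on {y. vector [x, 0] + y *s (vector [0, 1] :: complex ^ 2) \<in> UNIV}"
      by (rule holomorphic_map_on_line(1)[OF hol])
    moreover have "vector [x, 0] + y *s vector [0, 1] = (vector [x, y] :: complex ^ 2)" for y
      by (simp add: vec_eq_iff forall_2)
    ultimately have "\<phi> i x holomorphic_on UNIV" by (simp add: \<phi>_def[abs_def])
    then show "\<phi> i x holomorphic_on ball 0 (1/2)" using holomorphic_on_subset by blast
  next
    fix x y :: complex assume "x \<in> ball 0 (1/2)" "y \<in> ball 0 (1/2)"
    then have "norm (vector [x, y] :: complex ^ 2) < 1" using norm_vec2_le[of "vector [x, y]"] by simp
    then show "norm (\<phi> i x y) \<le> 1"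
      using bd Finite_Cartesian_Product.norm_nth_le[of "f (vector [x, y])" i] unfolding \<phi>_def by (meson order_trans)
  qed
  have d1: "deriv (\<lambda>x. \<phi> i x 0) 0 = L (vector [1, 0]) $ i" for i
  proof -
    have "x *s (vector [1, 0] :: complex ^ 2) = vector [x, 0]" for x :: complex by (simp add: vec_eq_iff forall_2)
    then show ?thesis
      using DERIV_imp_deriv[OF holomorphic_map_on_line(2)[OF hol _ L(1), of "vector [1, 0]" i]] by (simp add: \<phi>_def)
  qed
  have d2: "deriv (\<phi> i 0) 0 = L (vector [0, 1]) $ i" for i
  proof -
    have "x *s (vector [0, 1] :: complex ^ 2) = vector [0, x]" for x :: complex by (simp add: vec_eq_iff forall_2)
    then show ?thesis
      using DERIV_imp_deriv[OF holomorphic_map_on_line(2)[OF hol _ L(1), of "vector [0, 1]" i]] by (simp add: \<phi>_def[abs_def])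
  qed
  have Lz: "L z $ i = L (vector [1, 0]) $ i * z $ 1 + L (vector [0, 1]) $ i * z $ 2" for z i
  proof -
    have "L z = z $ 1 *s L (vector [1, 0]) + z $ 2 *s L (vector [0, 1])"
      using arg_cong[OF vec2_decomp[of z], of L] by (simp only: lin L(2))
    then show ?thesis by simp
  qed
  have fz: "\<phi> i (z $ 1) (z $ 2) = f z $ i" for i z
  proof -
    have "vector [z $ 1, z $ 2] = z" by (simp add: vec_eq_iff forall_2)
    then show ?thesis by (simp add: \<phi>_def)
  qed
  have \<phi>0: "\<phi> i 0 0 = 0" for i by (simp add: \<phi>_def v0 zero)
  obtain q1 q2 q3 where q: "norm q1 \<le> 64" "norm q2 \<le> 64" "norm q3 \<le> 64"
    "\<And>x y. x \<in> ball 0 (1/2) \<Longrightarrow> y \<in> ball 0 (1/2) \<Longrightarrow>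
      norm (\<phi> 1 x y - (L (vector [1, 0]) $ 1 * x + L (vector [0, 1]) $ 1 * y) - (q1 * y\<^sup>2 + q2 * (x * y) + q3 * x\<^sup>2))
        \<le> 512 * (norm y ^ 3 + norm x * norm y ^ 2 + norm x ^ 2 * norm y + norm x ^ 3)"
    using sep_holomorphic_taylor[OF sep[of 1] \<phi>0] unfolding d1 d2 by blast
  obtain q4 q5 q6 where q': "norm q4 \<le> 64" "norm q5 \<le> 64" "norm q6 \<le> 64"
    "\<And>x y. x \<in> ball 0 (1/2) \<Longrightarrow> y \<in> ball 0 (1/2) \<Longrightarrow>
      norm (\<phi> 2 x y - (L (vector [1, 0]) $ 2 * x + L (vector [0, 1]) $ 2 * y) - (q4 * y\<^sup>2 + q5 * (x * y) + q6 * x\<^sup>2))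
        \<le> 512 * (norm y ^ 3 + norm x * norm y ^ 2 + norm x ^ 2 * norm y + norm x ^ 3)"
    using sep_holomorphic_taylor[OF sep[of 2] \<phi>0] unfolding d1 d2 by blast
  have "norm (f z - L z - quad q1 q2 q3 q4 q5 q6 z) \<le> 4096 * norm z ^ 3" if "norm z < 1/2" for z
  proof -
    have n: "norm (z $ 1) \<le> norm z" "norm (z $ 2) \<le> norm z"
      by (rule Finite_Cartesian_Product.norm_nth_le)+
    then have b: "z $ 1 \<in> ball 0 (1/2)" "z $ 2 \<in> ball 0 (1/2)" using that by auto
    have "norm (z $ 2) ^ 3 + norm (z $ 1) * norm (z $ 2) ^ 2 + norm (z $ 1) ^ 2 * norm (z $ 2) + norm (z $ 1) ^ 3
        \<le> norm z ^ 3 + norm z * norm z ^ 2 + norm z ^ 2 * norm z + norm z ^ 3"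
      by (intro add_mono mult_mono power_mono n) auto
    then have s: "512 * (norm (z $ 2) ^ 3 + norm (z $ 1) * norm (z $ 2) ^ 2 + norm (z $ 1) ^ 2 * norm (z $ 2) + norm (z $ 1) ^ 3)
        \<le> 2048 * norm z ^ 3" by (simp add: power2_eq_square power3_eq_cube)
    let ?w = "f z - L z - quad q1 q2 q3 q4 q5 q6 z"
    have "?w $ 1 = \<phi> 1 (z $ 1) (z $ 2) - (L (vector [1, 0]) $ 1 * z $ 1 + L (vector [0, 1]) $ 1 * z $ 2)
        - (q1 * (z $ 2)\<^sup>2 + q2 * (z $ 1 * z $ 2) + q3 * (z $ 1)\<^sup>2)"
      unfolding fz by (simp only: vector_minus_component Lz[of z 1] quad_def vector_2)
    then have w1: "norm (?w $ 1) \<le> 2048 * norm z ^ 3"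
      using order_trans[OF q(4)[OF b] s] by (simp only:)
    have "?w $ 2 = \<phi> 2 (z $ 1) (z $ 2) - (L (vector [1, 0]) $ 2 * z $ 1 + L (vector [0, 1]) $ 2 * z $ 2)
        - (q4 * (z $ 2)\<^sup>2 + q5 * (z $ 1 * z $ 2) + q6 * (z $ 1)\<^sup>2)"
      unfolding fz by (simp only: vector_minus_component Lz[of z 2] quad_def vector_2)
    then have w2: "norm (?w $ 2) \<le> 2048 * norm z ^ 3"
      using order_trans[OF q'(4)[OF b] s] by (simp only:)
    show ?thesis using norm_vec2_le[of ?w] w1 w2 by linarith
  qed
  with q q' show ?thesis by blast
qed

text \<open>The quotients \<open>f (t v) / t\<close> along a real ray inherit both bounds and tend
  to \<open>L v\<close>.\<close>

lemma derivative_norm_bounds: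
  fixes f L :: "complex ^ 2 \<Rightarrow> complex ^ 2"
  assumes L: "(f has_derivative L) (at 0)" and f0: "f 0 = 0"
    and bd: "\<And>z. norm z < 1 \<Longrightarrow> C * norm z \<le> norm (f z) \<and> norm (f z) \<le> D * norm z"
  shows "C * norm v \<le> norm (L v)" "norm (L v) \<le> D * norm v"
proof -
  have lim: "((\<lambda>t. norm (f (t *\<^sub>R v) /\<^sub>R t)) \<longlongrightarrow> norm (L v)) (at_right 0)"
  proof -
    have "((\<lambda>t. f (t *\<^sub>R v)) has_derivative (\<lambda>t. L (t *\<^sub>R v))) (at 0)"
      using L by (intro has_derivative_compose[where f = "\<lambda>t. t *\<^sub>R v" and g = f])
        (auto intro!: derivative_eq_intros)
    then have vd: "((\<lambda>t. f (t *\<^sub>R v)) has_vector_derivative L v) (at 0)"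
      using has_derivative_linear[OF L] by (simp add: has_vector_derivative_def linear_scale)
    have "((\<lambda>t. f (t *\<^sub>R v) /\<^sub>R t) \<longlongrightarrow> L v) (at 0)"
    proof (rule LIM_I)
      fix e :: real assume "0 < e"
      then obtain d where d: "0 < d" "\<And>t. t \<noteq> 0 \<Longrightarrow> \<bar>t\<bar> < d \<Longrightarrow> norm (f (t *\<^sub>R v) - t *\<^sub>R L v) / \<bar>t\<bar> < e"
        using vd f0 unfolding has_vector_derivative_def has_derivative_at' by (auto simp: has_derivative_at')
      have "f (t *\<^sub>R v) /\<^sub>R t - L v = (f (t *\<^sub>R v) - t *\<^sub>R L v) /\<^sub>R t" if "t \<noteq> 0" for t
        using that by (simp add: algebra_simps)
      then have "norm (f (t *\<^sub>R v) /\<^sub>R t - L v) < e" if "t \<noteq> 0" "\<bar>t\<bar> < d" for t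
        using d(2)[OF that] that(1) by (simp add: divide_inverse mult.commute)
      then show "\<exists>d>0. \<forall>t. t \<noteq> 0 \<and> norm (t - 0) < d \<longrightarrow> norm (f (t *\<^sub>R v) /\<^sub>R t - L v) < e"
        using d(1) by auto
    qed
    then show ?thesis by (intro tendsto_norm) (simp add: filterlim_at_split)
  qed
  have ev: "\<forall>\<^sub>F t in at_right 0. C * norm v \<le> norm (f (t *\<^sub>R v) /\<^sub>R t) \<and> norm (f (t *\<^sub>R v) /\<^sub>R t) \<le> D * norm v"
  proof -
    have "\<forall>\<^sub>F t::real in at_right 0. t < 1 / (norm v + 1) \<and> 0 < t"
      by (intro eventually_conj eventually_at_right_less)
        (auto simp: eventually_at_right[of 0 1] add_nonneg_pos intro!: exI[of _ "1 / (norm v + 1)"])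
    then show ?thesis
    proof eventually_elim
      case (elim t)
      then have "t * (norm v + 1) < 1" "0 < t" by (auto simp: pos_less_divide_eq add_nonneg_pos)
      then have "norm (t *\<^sub>R v) < 1" by (simp add: algebra_simps)
      from bd[OF this] elim show ?case by (simp add: field_simps)
    qed
  qed
  show "C * norm v \<le> norm (L v)"
    by (rule tendsto_lowerbound[OF lim]) (use ev in \<open>auto elim: eventually_mono\<close>)
  show "norm (L v) \<le> D * norm v"
    by (rule tendsto_upperbound[OF lim]) (use ev in \<open>auto elim: eventually_mono\<close>)
qed

text \<open>Cauchy's estimate on balls of radius \<rho>, which lie in the ball of radius 2 \<rho>,
  bounds the derivative of the remainder by 2 * 2500 * (2 \<rho>)^2 / \<rho> = 20000 \<rho>; the
  mean value inequality does the rest.\<close>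

lemma holomorphic_map_lipschitz_remainder:
  fixes f L :: "complex ^ 2 \<Rightarrow> complex ^ 2"
  assumes hol: "holomorphic_map_on f UNIV" and L: "(f has_derivative L) (at 0)" "\<And>c v. L (c *s v) = c *s L v"
    and rem: "\<And>z. norm z < 1/2 \<Longrightarrow> norm (f z - L z) \<le> 2500 * norm z ^ 2"
    and \<rho>: "\<rho> \<le> 1/4" and z: "norm z \<le> \<rho>" and w: "norm w \<le> \<rho>"
  shows "norm ((f z - L z) - (f w - L w)) \<le> 20000 * \<rho> * norm (z - w)"
proof (cases "\<rho> = 0")
  case True
  then show ?thesis using z w by auto
next
  case False
  then have \<rho>0: "0 < \<rho>" using z norm_ge_zero[of z] by linarith
  have bl: "bounded_linear L" using L(1) has_derivative_bounded_linear by blast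
  have holL: "holomorphic_map_on L UNIV"
    unfolding holomorphic_map_on_def using bl L(2) bounded_linear_imp_has_derivative by blast
  have hR: "holomorphic_map_on (\<lambda>z. f z - L z) UNIV"
    by (rule holomorphic_map_on_diff[OF hol holL])
  then have "\<forall>z. \<exists>R'. ((\<lambda>z. f z - L z) has_derivative R') (at z)"
    unfolding holomorphic_map_on_def by blast
  then obtain R' where R': "\<And>z. ((\<lambda>z. f z - L z) has_derivative R' z) (at z)" by metis
  show ?thesis
  proof (rule differentiable_bound[where S = "cball 0 \<rho>" and f' = R'])
    show "((\<lambda>z. f z - L z) has_derivative R' x) (at x within cball 0 \<rho>)" for x
      using R' has_derivative_at_withinI by blast
    show "onorm (R' x) \<le> 20000 * \<rho>" if x: "x \<in> cball 0 \<rho>" for x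
    proof (rule onorm_bound)
      fix v
      have "norm (R' x v) \<le> CARD(2) * (2500 * (2 * \<rho>)\<^sup>2 / \<rho>) * norm v"
      proof (rule holomorphic_map_derivative_bound[OF hR _ \<rho>0 _ R'])
        fix y assume "y \<in> ball x \<rho>"
        then have y: "norm y < 2 * \<rho>" using x norm_triangle_ineq[of x "y - x"] by (simp add: dist_norm norm_minus_commute)
        then have "norm (f y - L y) \<le> 2500 * norm y ^ 2" using \<rho> by (intro rem) auto
        also have "\<dots> \<le> 2500 * (2 * \<rho>)\<^sup>2" using y by (intro mult_left_mono power_mono) auto
        finally show "norm (f y - L y) \<le> 2500 * (2 * \<rho>)\<^sup>2" .
      qed simp
      also have "\<dots> = 20000 * \<rho> * norm v" using \<rho>0 by (simp add: power2_eq_square)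
      finally show "norm (R' x v) \<le> 20000 * \<rho> * norm v" .
    qed (use \<rho>0 in auto)
  qed (use z w in auto)
qed

section \<open>The homological equation\<close>

text \<open>Picard iteration for a recursion whose data come from the future. The maps
  \<open>\<Gamma> n\<close> themselves may expand: only the product of \<open>\<rho> n\<close> with
  the ratio of consecutive weights has to be at most \<open>q\<close>.\<close>

lemma backward_solution:
  fixes \<Gamma> :: "nat \<Rightarrow> 'a::banach \<Rightarrow> 'a" and N :: "'a \<Rightarrow> real"
  assumes tri: "\<And>x y. N (x + y) \<le> N x + N y" and N0: "N 0 = 0" and lo: "\<And>x. norm x \<le> \<kappa> * N x"
    and contN: "continuous_on UNIV N" and cont: "\<And>n. continuous_on UNIV (\<Gamma> n)"
    and lip: "\<And>n x y. N (\<Gamma> n x - \<Gamma> n y) \<le> \<rho> n * N (x - y)" and \<rho>0: "\<And>n. 0 \<le> \<rho> n"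
    and \<rho>: "\<And>n. \<rho> n * \<omega> (Suc n) \<le> q * \<omega> n" and force: "\<And>n. N (\<Gamma> n 0) \<le> P * \<omega> n"
    and q: "0 \<le> q" "q < 1" and P: "0 \<le> P" and \<kappa>: "0 \<le> \<kappa>"
  shows "\<exists>u. \<forall>n. u n = \<Gamma> n (u (Suc n)) \<and> N (u n) \<le> P / (1 - q) * \<omega> n"
proof -
  \<comment> \<open>\<open>X k n\<close> is the solution that looks \<open>k\<close> steps ahead and
    takes the value 0 there.\<close>
  define X where "X = rec_nat (\<lambda>n. 0) (\<lambda>k X n. \<Gamma> n (X (Suc n)))"
  have X: "X 0 n = 0" "X (Suc k) n = \<Gamma> n (X k (Suc n))" for k n by (simp_all add: X_def)
  have step: "N (X (Suc k) n - X k n) \<le> P * q ^ k * \<omega> n" for k n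
  proof (induction k arbitrary: n)
    case 0
    then show ?case using force by (simp add: X)
  next
    case (Suc k)
    have "N (X (Suc (Suc k)) n - X (Suc k) n) \<le> \<rho> n * N (X (Suc k) (Suc n) - X k (Suc n))"
      unfolding X(2)[of "Suc k" n] X(2)[of k n] by (rule lip)
    also have "\<dots> \<le> \<rho> n * (P * q ^ k * \<omega> (Suc n))" by (intro mult_left_mono Suc \<rho>0)
    also have "\<dots> = P * q ^ k * (\<rho> n * \<omega> (Suc n))" by simp
    also have "\<dots> \<le> P * q ^ k * (q * \<omega> n)" using P q by (intro mult_left_mono \<rho>) auto
    finally show ?case by (simp add: mult_ac)
  qed
  have bound: "N (X k n) \<le> P / (1 - q) * \<omega> n" for k n
  proof -
    have \<omega>: "0 \<le> P * \<omega> n"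
    proof -
      have "0 \<le> \<kappa> * N (\<Gamma> n 0)" using lo norm_ge_zero order_trans by blast
      then show ?thesis
      proof (cases "\<kappa> = 0")
        case True
        then have "\<Gamma> n 0 = 0" using lo[of "\<Gamma> n 0"] by simp
        then show ?thesis using force[of n] N0 by simp
      next
        case False
        then have "0 \<le> N (\<Gamma> n 0)" using \<open>0 \<le> \<kappa> * N (\<Gamma> n 0)\<close> \<kappa> by (simp add: zero_le_mult_iff)
        then show ?thesis using force[of n] by linarith
      qed
    qed
    have "N (X k n) \<le> (\<Sum>i<k. P * q ^ i * \<omega> n)"
    proof (induction k)
      case 0
      then show ?case by (simp add: X N0)
    next
      case (Suc k)
      then show ?case using tri[of "X (Suc k) n - X k n" "X k n"] step[of k n] by simp
    qed
    also have "\<dots> = P * \<omega> n * (\<Sum>i<k. q ^ i)" by (simp add: sum_distrib_left mult_ac)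
    also have "\<dots> \<le> P * \<omega> n * (1 / (1 - q))"
      using q \<omega> sum_le_suminf[OF summable_geometric[of q], of "{..<k}"] suminf_geometric[of q]
      by (intro mult_left_mono) auto
    finally show ?thesis by (simp add: mult_ac)
  qed
  have "convergent (\<lambda>k. X k n)" for n
  proof -
    have "summable (\<lambda>k. \<kappa> * (P * \<omega> n) * q ^ k)"
      using q by (intro summable_mult summable_geometric) auto
    moreover have "norm (X (Suc k) n - X k n) \<le> \<kappa> * (P * \<omega> n) * q ^ k" for k
      using lo[of "X (Suc k) n - X k n"] mult_left_mono[OF step[of k n] \<kappa>] by (simp add: mult_ac)
    ultimately have "summable (\<lambda>k. X (Suc k) n - X k n)"
      by (metis (no_types, lifting) summable_comparison_test)
    then have "convergent (\<lambda>k. X k n - X 0 n)"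
      by (simp only: summable_iff_convergent sum_lessThan_telescope[of "\<lambda>k. X k n"])
    then show ?thesis by (simp add: X)
  qed
  then have lim: "(\<lambda>k. X k n) \<longlonglongrightarrow> lim (\<lambda>k. X k n)" for n
    by (simp add: convergent_LIMSEQ_iff)
  define u where "u n = lim (\<lambda>k. X k n)" for n
  have "u n = \<Gamma> n (u (Suc n))" for n
  proof (rule LIMSEQ_unique)
    show "(\<lambda>k. X (Suc k) n) \<longlonglongrightarrow> u n" using LIMSEQ_Suc[OF lim] by (simp add: u_def)
    have "isCont (\<Gamma> n) (u (Suc n))" using cont[of n] by (simp add: continuous_on_eq_continuous_at)
    then have "(\<lambda>k. \<Gamma> n (X k (Suc n))) \<longlonglongrightarrow> \<Gamma> n (u (Suc n))"
      by (rule isCont_tendsto_compose) (simp add: u_def lim)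
    then show "(\<lambda>k. X (Suc k) n) \<longlonglongrightarrow> \<Gamma> n (u (Suc n))" by (simp only: X)
  qed
  moreover have "N (u n) \<le> P / (1 - q) * \<omega> n" for n
  proof (rule LIMSEQ_le_const2)
    have "isCont N (u n)" using contN by (simp add: continuous_on_eq_continuous_at)
    then show "(\<lambda>k. N (X k n)) \<longlonglongrightarrow> N (u n)"
      by (rule isCont_tendsto_compose) (simp add: u_def lim)
  qed (use bound in blast)
  ultimately show ?thesis by blast
qed

text \<open>\<open>2 ^ train_index n\<close> is the end of the train containing \<open>n\<close>.\<close>

primrec train_index :: "nat \<Rightarrow> nat"
  where
    "train_index 0 = 0"
  | "train_index (Suc n) = (if Suc n = 2 ^ train_index n then Suc (train_index n) else train_index n)"

text \<open>\<open>n\<close> is the last time of its train, so the swap takes place between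
  \<open>n\<close> and \<open>Suc n\<close>. Time 0 is a train of its own, and the swaps occur at n
  = 0, 1, 3, 7 and so on.\<close>

definition train_end :: "nat \<Rightarrow> bool"
  where "train_end n \<longleftrightarrow> Suc n = 2 ^ train_index n"

lemma train_index_bounds: "n < 2 ^ train_index n" "2 ^ train_index n \<le> 2 * n + 1"
  by (induction n) auto

lemma train_index_Suc:
  "train_index (Suc n) = (if train_end n then Suc (train_index n) else train_index n)"
  by (simp add: train_end_def)

declare train_index.simps(2) [simp del]

lemma train_index_eq: "2 ^ k \<le> n \<Longrightarrow> n < 2 ^ Suc k \<Longrightarrow> train_index n = Suc k"
proof -
  assume n: "2 ^ k \<le> n" "n < 2 ^ Suc k"
  have "(2::nat) ^ k < 2 ^ train_index n" by (rule le_less_trans[OF n(1) train_index_bounds(1)])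
  then have "k < train_index n" by (rule power_less_imp_less_exp[rotated]) simp
  moreover have "(2::nat) ^ train_index n < 2 ^ (k + 2)"
    using n(2) train_index_bounds(2)[of n] unfolding power_add by simp
  then have "train_index n < k + 2" by (rule power_less_imp_less_exp[rotated]) simp
  ultimately show ?thesis by simp
qed

lemma train_end_iff: "2 ^ k \<le> n \<Longrightarrow> n < 2 ^ Suc k \<Longrightarrow> train_end n \<longleftrightarrow> Suc n = 2 ^ Suc k"
  by (simp add: train_end_def train_index_eq)

text \<open>Pays for the swaps: a factor \<open>2 ^ j\<close> at each of the
  \<open>train_index n\<close> swaps before \<open>n\<close> amounts to at most
  \<open>(2 n + 1) ^ j\<close>.\<close>

lemma poly_exp_bounded:
  fixes t :: real assumes "0 < t" "t < 1"
  shows "\<exists>P. \<forall>n. (2 * real n + 1) ^ j * t ^ n \<le> P"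
proof -
  have "(\<lambda>n. (2 * real n + 1) ^ j * t ^ n) \<longlonglongrightarrow> 0"
    using assms by real_asymp
  then have "Bseq (\<lambda>n. (2 * real n + 1) ^ j * t ^ n)" by (intro convergent_imp_Bseq convergentI)
  then obtain P where "\<And>n. norm ((2 * real n + 1) ^ j * t ^ n) \<le> P" by (auto simp: Bseq_def)
  then show ?thesis by (metis abs_le_D1 real_norm_def)
qed

text \<open>With \<open>D = t ^ 20\<close> all rates in the argument become integer powers of \<open>t\<close>, and the
  hypothesis becomes \<open>t ^ 44 < C\<close>. The coefficients of the conjugacies may grow like \<open>w ^ (5 * n)\<close>.\<close>

locale triangular_jets =
  fixes t C :: real and a b c q1 q2 q3 q4 q5 q6 :: "nat \<Rightarrow> complex"
  assumes t: "0 < t" "t < 1" and C: "t ^ 44 < C"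
    and a: "\<And>n. C \<le> norm (a n)" "\<And>n. norm (a n) \<le> t ^ 20"
    and b: "\<And>n. C \<le> norm (b n)" "\<And>n. norm (b n) \<le> t ^ 20" and c: "\<And>n. norm (c n) \<le> t ^ 20"
    and Q: "\<And>n. norm (q1 n) \<le> 64" "\<And>n. norm (q2 n) \<le> 64" "\<And>n. norm (q3 n) \<le> 64"
      "\<And>n. norm (q4 n) \<le> 64" "\<And>n. norm (q5 n) \<le> 64" "\<And>n. norm (q6 n) \<le> 64"
begin

definition w where "w = 1 / t"

lemma w: "1 < w" "0 < w" "1 \<le> w ^ m" "0 < w ^ m" "t ^ m * w ^ m = 1"
  using t by (auto simp: w_def one_le_power power_mult_distrib[symmetric])

lemma w_mono: "m \<le> m' \<Longrightarrow> w ^ m \<le> w ^ m'"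
  using w(1) by (intro power_increasing) auto

lemma C0: "0 < C" using C t zero_less_power[of t 44] by linarith

lemma nz: "a n \<noteq> 0" "b n \<noteq> 0"
  using a(1)[of n] b(1)[of n] C0 by auto

lemma one: "norm (a n) \<le> 1" "norm (b n) \<le> 1" "norm (c n) \<le> 1"
proof -
  have "t ^ 20 \<le> 1" using t by (simp add: power_le_one)
  then show "norm (a n) \<le> 1" "norm (b n) \<le> 1" "norm (c n) \<le> 1"
    using a(2) b(2) c order_trans by blast+
qed

lemma norm_div_le: "norm (x / a n) \<le> norm x / C" "norm (x / b n) \<le> norm x / C"
  using a(1)[of n] b(1)[of n] C0 by (auto simp: norm_divide intro!: divide_left_mono mult_pos_pos)

text \<open>The weight \<open>w ^ (4 * (2 ^ train_index n - n))\<close> absorbs the factor \<open>t ^ 40 / C\<close>, which may exceed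
  \<open>1\<close>; a train is no longer than the time elapsed before it, so the weight is at most
  \<open>w ^ (4 * (n + 1))\<close>.\<close>

lemma resonant_coefficients:
  "\<exists>\<alpha> A. 0 \<le> A \<and> (\<forall>n. a n * \<alpha> n = (b n)\<^sup>2 * (if train_end n then 0 else \<alpha> (Suc n)) + q1 n \<and>
    norm (\<alpha> n) \<le> A * w ^ (4 * n) \<and> norm (\<alpha> (Suc n)) \<le> A * w ^ (4 * n))"
proof -
  define \<Gamma>\<alpha> where "\<Gamma>\<alpha> n x = (b n)\<^sup>2 / a n * (if train_end n then 0 else x) + q1 n / a n" for n and x :: complex
  define \<omega>\<alpha> where "\<omega>\<alpha> n = w ^ (4 * (2 ^ train_index n - n))" for n
  \<comment> \<open>\<open>q < 1\<close> is the hypothesis: a step inside a train multiplies by at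
    most \<open>t ^ 40 / C = q * w ^ 4\<close>, and the weight drops by exactly
    \<open>w ^ 4\<close>.\<close>
  define q where "q = t ^ 44 / C"
  have q: "0 \<le> q" "q < 1" using C C0 t by (auto simp: q_def)
  have "\<exists>\<alpha>. \<forall>n. \<alpha> n = \<Gamma>\<alpha> n (\<alpha> (Suc n)) \<and> norm (\<alpha> n) \<le> 64 / C / (1 - q) * \<omega>\<alpha> n"
  proof (rule backward_solution[where \<kappa> = 1 and \<rho> = "\<lambda>n. if train_end n then 0 else t ^ 40 / C"])
    show "continuous_on UNIV (\<Gamma>\<alpha> n)" for n
      unfolding \<Gamma>\<alpha>_def using nz by (cases "train_end n") (auto intro!: continuous_intros)
    show "norm (\<Gamma>\<alpha> n x - \<Gamma>\<alpha> n y) \<le> (if train_end n then 0 else t ^ 40 / C) * norm (x - y)" for n x y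
    proof -
      have "norm ((b n)\<^sup>2 / a n) \<le> (norm (b n))\<^sup>2 / C" using norm_div_le(1)[of "(b n)\<^sup>2" n] by (simp add: norm_power)
      also have "\<dots> \<le> (t ^ 20)\<^sup>2 / C" using b(2)[of n] C0 by (intro divide_right_mono power_mono) auto
      finally have 1: "norm ((b n)\<^sup>2 / a n) \<le> t ^ 40 / C" by (simp add: power_mult[symmetric])
      show ?thesis
      proof (cases "train_end n")
        case False
        then have "\<Gamma>\<alpha> n x - \<Gamma>\<alpha> n y = (b n)\<^sup>2 / a n * (x - y)"
          by (simp add: \<Gamma>\<alpha>_def right_diff_distrib)
        then show ?thesis using False mult_right_mono[OF 1, of "norm (x - y)"] by (simp only: norm_mult) simp
      qed (simp add: \<Gamma>\<alpha>_def)
    qed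
    show "(if train_end n then 0 else t ^ 40 / C) * \<omega>\<alpha> (Suc n) \<le> q * \<omega>\<alpha> n" for n
    proof (cases "train_end n")
      case False
      then have ne: "Suc n < 2 ^ train_index n"
        using train_index_bounds(1)[of n] by (simp add: train_end_def)
      then have "4 * (2 ^ train_index n - n) = 4 + 4 * (2 ^ train_index n - Suc n)" by simp
      then have 1: "\<omega>\<alpha> n = w ^ 4 * \<omega>\<alpha> (Suc n)"
        using False by (simp only: \<omega>\<alpha>_def train_index_Suc if_False power_add)
      have "t ^ 44 * w ^ 4 = t ^ 40 * (t ^ 4 * w ^ 4)" by (simp add: mult.assoc[symmetric] flip: power_add)
      then have 2: "t ^ 44 * w ^ 4 = t ^ 40" by (simp only: w(5) mult_1_right)
      have "q * \<omega>\<alpha> n = t ^ 44 * w ^ 4 / C * \<omega>\<alpha> (Suc n)" by (simp add: 1 q_def)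
      then show ?thesis using False 2 by simp
    next
      case True
      then show ?thesis using q w(4) by (simp add: \<omega>\<alpha>_def less_imp_le)
    qed
    show "norm (\<Gamma>\<alpha> n 0) \<le> 64 / C * \<omega>\<alpha> n" for n
    proof -
      have "norm (\<Gamma>\<alpha> n 0) \<le> 64 / C"
        using norm_div_le(1)[of "q1 n" n] Q(1)[of n] C0 divide_right_mono[OF Q(1)[of n], of C] by (simp add: \<Gamma>\<alpha>_def)
      also have "\<dots> \<le> 64 / C * \<omega>\<alpha> n" using C0 mult_left_mono[OF w(3), of "64 / C"] by (simp add: \<omega>\<alpha>_def)
      finally show ?thesis .
    qed
  qed (use q t C0 in \<open>auto intro: norm_triangle_ineq continuous_intros simp: less_imp_le\<close>)
  then obtain \<alpha> where \<alpha>: "\<And>n. \<alpha> n = \<Gamma>\<alpha> n (\<alpha> (Suc n))" "\<And>n. norm (\<alpha> n) \<le> 64 / C / (1 - q) * \<omega>\<alpha> n"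
    by blast
  \<comment> \<open>The factor \<open>w ^ 8\<close> makes the bound cover time \<open>Suc n\<close>
    too: for \<open>m \<le> Suc n\<close> the exponent of the weight is at most 4 (m + 1) \<le> 4 n
    + 8.\<close>
  define A where "A = 64 / C / (1 - q) * w ^ 8"
  have A0: "0 \<le> 64 / C / (1 - q)" using q C0 by auto
  have A: "0 \<le> A" unfolding A_def using A0 w by (intro mult_nonneg_nonneg) auto
  have \<alpha>b: "norm (\<alpha> n) \<le> A * w ^ (4 * n)" "norm (\<alpha> (Suc n)) \<le> A * w ^ (4 * n)" for n
  proof -
    have "norm (\<alpha> m) \<le> A * w ^ (4 * n)" if "m \<le> Suc n" for m
    proof -
      have "2 ^ train_index m \<le> 2 * m + 1" by (rule train_index_bounds)
      then have "4 * (2 ^ train_index m - m) \<le> 8 + 4 * n" using that by linarith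
      then have "\<omega>\<alpha> m \<le> w ^ (8 + 4 * n)" unfolding \<omega>\<alpha>_def by (rule w_mono)
      then have "64 / C / (1 - q) * \<omega>\<alpha> m \<le> 64 / C / (1 - q) * w ^ (8 + 4 * n)" by (rule mult_left_mono[OF _ A0])
      then show ?thesis using \<alpha>(2)[of m] unfolding A_def power_add mult.assoc by linarith
    qed
    from this[of n] this[of "Suc n"]
    show "norm (\<alpha> n) \<le> A * w ^ (4 * n)" "norm (\<alpha> (Suc n)) \<le> A * w ^ (4 * n)" by simp_all
  qed
  have "a n * \<alpha> n = (b n)\<^sup>2 * (if train_end n then 0 else \<alpha> (Suc n)) + q1 n" for n
    by (subst \<alpha>(1)) (use nz[of n] in \<open>simp add: \<Gamma>\<alpha>_def field_simps\<close>)
  with A \<alpha>b show ?thesis by blast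
qed

text \<open>Comparison of coefficients in the second-order part of the conjugation. A swap exchanges
  \<beta> with \<mu> and \<gamma> with \<nu>; the resonant \<alpha> and \<alpha>' enter as known
  terms.\<close>

definition nonresonant_equations
  where "nonresonant_equations \<alpha> \<alpha>' \<beta> \<gamma> \<nu> \<mu> n \<longleftrightarrow>
    (let \<beta>' = (if train_end n then \<mu> else \<beta>) (Suc n); \<gamma>' = (if train_end n then \<nu> else \<gamma>) (Suc n);
         \<nu>' = (if train_end n then \<gamma> else \<nu>) (Suc n); \<mu>' = (if train_end n then \<beta> else \<mu>) (Suc n) in
      a n * \<beta> n = a n * b n * \<beta>' + 2 * b n * c n * \<alpha>' n + q2 n \<and>
      a n * \<gamma> n = (a n)\<^sup>2 * \<gamma>' + a n * c n * \<beta>' + (c n)\<^sup>2 * \<alpha>' n + q3 n \<and>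
      b n * \<nu> n + c n * \<alpha> n = (b n)\<^sup>2 * \<nu>' + q4 n \<and>
      b n * \<mu> n + c n * \<beta> n = a n * b n * \<mu>' + 2 * b n * c n * \<nu>' + q5 n)"

text \<open>The last equation is solved for \<open>d\<close>, as \<open>H n\<close> has no term
  \<open>x^2\<close> in its second component. There \<sigma>' is the coefficient \<alpha> at the
  beginning of the next train, seen before the swap.\<close>

definition normal_form_equations
  where "normal_form_equations \<alpha> \<beta> \<gamma> \<nu> \<mu> d n \<longleftrightarrow>
    (let \<alpha>' = (if train_end n then 0 else \<alpha> (Suc n)); \<beta>' = (if train_end n then \<mu> else \<beta>) (Suc n);
         \<gamma>' = (if train_end n then \<nu> else \<gamma>) (Suc n); \<nu>' = (if train_end n then \<gamma> else \<nu>) (Suc n);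
         \<mu>' = (if train_end n then \<beta> else \<mu>) (Suc n); \<sigma>' = (if train_end n then \<alpha> (Suc n) else 0) in
      a n * \<alpha> n = (b n)\<^sup>2 * \<alpha>' + q1 n \<and>
      a n * \<beta> n = a n * b n * \<beta>' + 2 * b n * c n * \<alpha>' + q2 n \<and>
      a n * \<gamma> n = (a n)\<^sup>2 * \<gamma>' + a n * c n * \<beta>' + (c n)\<^sup>2 * \<alpha>' + q3 n \<and>
      b n * \<nu> n + c n * \<alpha> n = (b n)\<^sup>2 * \<nu>' + q4 n \<and>
      b n * \<mu> n + c n * \<beta> n = a n * b n * \<mu>' + 2 * b n * c n * \<nu>' + q5 n \<and>
      c n * \<gamma> n + d n = (a n)\<^sup>2 * \<sigma>' + (c n)\<^sup>2 * \<nu>' + a n * c n * \<mu>' + q6 n)"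

text \<open>Here the equations are contractions within a train, once \<open>\<gamma>\<close> and \<open>\<mu>\<close> are weighted by a
  small \<open>e\<close> that makes the couplings through \<open>c n\<close> harmless. The swap of coordinates at the end of a
  train costs a factor \<open>1 / e\<close>, which is affordable since there are only logarithmically many swaps.\<close>

lemma nonresonant_coefficients:
  assumes A: "0 \<le> A" and \<alpha>b: "\<And>n. norm (\<alpha> n) \<le> A * w ^ (4 * n)" and \<alpha>'b: "\<And>n. norm (\<alpha>' n) \<le> A * w ^ (4 * n)"
  shows "\<exists>\<beta> \<gamma> \<nu> \<mu> M. 0 \<le> M \<and> (\<forall>n.
    nonresonant_equations \<alpha> \<alpha>' \<beta> \<gamma> \<nu> \<mu> n \<and>
    norm (\<beta> n) \<le> M * w ^ (5 * n) \<and> norm (\<gamma> n) \<le> M * w ^ (5 * n) \<and>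
    norm (\<nu> n) \<le> M * w ^ (5 * n) \<and> norm (\<mu> n) \<le> M * w ^ (5 * n))"
proof -
  \<comment> \<open>Room between the rate \<open>t ^ 20\<close> of the diagonal terms and the rate
    \<open>t ^ 15\<close> aimed at; the weighted couplings have to fit into it.\<close>
  have gap: "0 < t ^ 15 - t ^ 20" using t power_strict_decreasing[of 15 20 t] by simp
  obtain j where j: "4 * (1 / 2 :: real) ^ j \<le> t ^ 15 - t ^ 20"
  proof -
    obtain j where "(1 / 2 :: real) ^ j < (t ^ 15 - t ^ 20) / 4"
      using real_arch_pow_inv[of "(t ^ 15 - t ^ 20) / 4" "1 / 2"] gap by auto
    then show ?thesis by (intro that[of j]) simp
  qed
  \<comment> \<open>A power of 1/2, so that the accumulated cost of the swaps is
    \<open>(2 ^ train_index n) ^ j\<close>, which is polynomial in \<open>n\<close>.\<close>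
  define e where "e = (1 / 2 :: real) ^ j"
  have e: "0 < e" "e \<le> 1" "t ^ 20 + 4 * e \<le> t ^ 15" using j by (auto simp: e_def power_le_one)
  obtain P1 where P1: "\<And>n. (2 * real n + 1) ^ j * t ^ n \<le> P1" using poly_exp_bounded[OF t] by blast
  define e2 where "e2 n = 2 * b n * c n / a n * \<alpha>' n + q2 n / a n" for n
  define e3 where "e3 n = (c n)\<^sup>2 / a n * \<alpha>' n + q3 n / a n" for n
  define e4 where "e4 n = (q4 n - c n * \<alpha> n) / b n" for n
  define e5 where "e5 n = q5 n / b n" for n
  define E where "E = (2 * A + 64) / C"
  have E: "0 \<le> E" using A C0 by (simp add: E_def)
  have mixed: "norm (x * y / z * p + v / z) \<le> E * w ^ (4 * n)"
    if "norm x \<le> 2" "norm y \<le> 1" "norm p \<le> A * w ^ (4 * n)" "norm v \<le> 64" "C \<le> norm z" for x y z p v :: complex and n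
  proof -
    have "norm (x * y / z * p + v / z) = norm (x * y * p + v) / norm z"
      by (simp add: norm_divide[symmetric] add_divide_distrib)
    also have "\<dots> \<le> norm (x * y * p + v) / C"
      using that(5) C0 less_le_trans[OF C0 that(5)] by (intro divide_left_mono mult_pos_pos) auto
    also have "norm (x * y * p + v) \<le> 2 * 1 * (A * w ^ (4 * n)) + 64 * w ^ (4 * n)"
    proof -
      have "norm (x * y * p) \<le> 2 * 1 * (A * w ^ (4 * n))"
        unfolding norm_mult using that by (intro mult_mono) auto
      moreover have "64 \<le> 64 * w ^ (4 * n)" using w(3)[of "4 * n"] by simp
      ultimately show ?thesis using norm_triangle_ineq[of "x * y * p" v] that(4) by linarith
    qed
    finally show ?thesis using C0 by (simp add: E_def divide_right_mono algebra_simps)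
  qed
  have eb: "norm (e2 n) \<le> E * w ^ (4 * n)" "norm (e3 n) \<le> E * w ^ (4 * n)"
    "norm (e4 n) \<le> E * w ^ (4 * n)" "norm (e5 n) \<le> E * w ^ (4 * n)" for n
  proof -
    show "norm (e2 n) \<le> E * w ^ (4 * n)"
      unfolding e2_def by (rule mixed) (use one[of n] \<alpha>'b Q a in \<open>auto simp: norm_mult\<close>)
    show "norm (e3 n) \<le> E * w ^ (4 * n)"
      unfolding e3_def power2_eq_square
      by (rule mixed) (use one[of n] \<alpha>'b Q a in \<open>auto intro: order_trans\<close>)
    have "norm (- 1 * c n / b n * \<alpha> n + q4 n / b n) \<le> E * w ^ (4 * n)"
      by (rule mixed) (use one[of n] \<alpha>b Q b in auto)
    then show "norm (e4 n) \<le> E * w ^ (4 * n)" by (simp add: e4_def diff_divide_distrib)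
    have "norm (0 * c n / b n * \<alpha> n + q5 n / b n) \<le> E * w ^ (4 * n)"
      by (rule mixed) (use one[of n] \<alpha>b Q b in auto)
    then show "norm (e5 n) \<le> E * w ^ (4 * n)" by (simp add: e5_def)
  qed
  define N :: "complex \<times> complex \<times> complex \<times> complex \<Rightarrow> real"
    where "N = (\<lambda>(\<beta>, \<gamma>, \<nu>, \<mu>). norm \<beta> + e * norm \<gamma> + norm \<nu> + e * norm \<mu>)"
  \<comment> \<open>The equation for \<mu> involves \<beta> at the same time \<open>n\<close>;
    inserting the equation for \<beta> leaves only data from time \<open>Suc n\<close>. In the
    linear part the quotient \<open>c n / b n\<close> then meets \<open>b n * \<beta>\<close> and
    cancels, so no factor 1 / C enters the contraction.\<close>
  define \<Gamma>0 :: "nat \<Rightarrow> complex \<times> complex \<times> complex \<times> complex \<Rightarrow> complex \<times> complex \<times> complex \<times> complex"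
    where "\<Gamma>0 n = (\<lambda>(\<beta>, \<gamma>, \<nu>, \<mu>). (b n * \<beta> + e2 n, a n * \<gamma> + c n * \<beta> + e3 n, b n * \<nu> + e4 n,
      a n * \<mu> + 2 * c n * \<nu> - c n / b n * (b n * \<beta> + e2 n) + e5 n))" for n
  define sw :: "complex \<times> complex \<times> complex \<times> complex \<Rightarrow> complex \<times> complex \<times> complex \<times> complex"
    where "sw = (\<lambda>(\<beta>, \<gamma>, \<nu>, \<mu>). (\<mu>, \<nu>, \<gamma>, \<beta>))"
  define \<Gamma> where "\<Gamma> n x = \<Gamma>0 n (if train_end n then sw x else x)" for n x
  \<comment> \<open>The denominator gains a factor \<open>2 ^ j\<close> exactly at the swaps and
    cancels their cost; in all cases the ratio is t^15 * w^5 = t^10.\<close>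
  define \<omega> where "\<omega> n = w ^ (5 * n) / (2 ^ j) ^ train_index n" for n
  define P where "P = (4 + 1 / C) * E * P1"
  have "P1 \<ge> 1" using P1[of 0] by simp
  then have P: "0 \<le> P" using E C0 by (simp add: P_def)
  have N_sw: "N (sw x) \<le> 1 / e * N x" for x
  proof -
    obtain \<beta> \<gamma> \<nu> \<mu> where x: "x = (\<beta>, \<gamma>, \<nu>, \<mu>)" by (metis prod_cases4)
    have 1: "e * (e * p) \<le> p" if "0 \<le> p" for p
    proof -
      have "e * e \<le> 1 * 1" using e by (intro mult_mono) auto
      then show ?thesis using mult_right_mono[OF _ that, of "e * e" 1] by (simp add: mult.assoc)
    qed
    have "e * N (sw x) \<le> N x"
      using 1[of "norm \<beta>"] 1[of "norm \<nu>"] by (simp add: N_def sw_def x algebra_simps)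
    then show ?thesis using e by (simp add: field_simps)
  qed
  have N_\<Gamma>0: "N (\<Gamma>0 n x - \<Gamma>0 n y) \<le> t ^ 15 * N (x - y)" for n x y
  proof -
    obtain \<beta>1 \<gamma>1 \<nu>1 \<mu>1 where x: "x = (\<beta>1, \<gamma>1, \<nu>1, \<mu>1)" by (metis prod_cases4)
    obtain \<beta>2 \<gamma>2 \<nu>2 \<mu>2 where y: "y = (\<beta>2, \<gamma>2, \<nu>2, \<mu>2)" by (metis prod_cases4)
    define \<beta> \<gamma> \<nu> \<mu> where diffs: "\<beta> = \<beta>1 - \<beta>2" "\<gamma> = \<gamma>1 - \<gamma>2" "\<nu> = \<nu>1 - \<nu>2" "\<mu> = \<mu>1 - \<mu>2"
    have \<Gamma>d: "\<Gamma>0 n x - \<Gamma>0 n y = (b n * \<beta>, a n * \<gamma> + c n * \<beta>, b n * \<nu>, a n * \<mu> + 2 * (c n * \<nu>) - c n * \<beta>)"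
      using nz[of n] by (simp add: \<Gamma>0_def x y diffs field_simps)
    have "norm (b n * \<beta>) \<le> t ^ 20 * norm \<beta>" "norm (b n * \<nu>) \<le> t ^ 20 * norm \<nu>"
      "norm (a n * \<gamma>) \<le> t ^ 20 * norm \<gamma>" "norm (a n * \<mu>) \<le> t ^ 20 * norm \<mu>"
      "norm (c n * \<beta>) \<le> norm \<beta>" "norm (c n * \<nu>) \<le> norm \<nu>"
      using a(2)[of n] b(2)[of n] one[of n] by (auto simp: norm_mult intro: mult_right_mono mult_left_le_one_le)
    note bnds = this
    have "norm (a n * \<gamma> + c n * \<beta>) \<le> t ^ 20 * norm \<gamma> + norm \<beta>"
      using norm_triangle_ineq[of "a n * \<gamma>" "c n * \<beta>"] bnds by linarith
    then have 1: "e * norm (a n * \<gamma> + c n * \<beta>) \<le> e * (t ^ 20 * norm \<gamma> + norm \<beta>)"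
      using e by (intro mult_left_mono) auto
    have "norm (a n * \<mu> + 2 * (c n * \<nu>) - c n * \<beta>) \<le> norm (a n * \<mu>) + norm (2 * (c n * \<nu>)) + norm (c n * \<beta>)"
      using norm_triangle_ineq[of "a n * \<mu>" "2 * (c n * \<nu>)"]
        norm_triangle_ineq4[of "a n * \<mu> + 2 * (c n * \<nu>)" "c n * \<beta>"] by linarith
    then have "norm (a n * \<mu> + 2 * (c n * \<nu>) - c n * \<beta>) \<le> t ^ 20 * norm \<mu> + 2 * norm \<nu> + norm \<beta>"
      using bnds norm_mult[of 2 "c n * \<nu>"] by simp
    then have 2: "e * norm (a n * \<mu> + 2 * (c n * \<nu>) - c n * \<beta>) \<le> e * (t ^ 20 * norm \<mu> + 2 * norm \<nu> + norm \<beta>)"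
      using e by (intro mult_left_mono) auto
    have "N (\<Gamma>0 n x - \<Gamma>0 n y) \<le> t ^ 20 * N (x - y) + 2 * (e * norm \<beta>) + 2 * (e * norm \<nu>)"
      unfolding \<Gamma>d using 1 2 bnds(1,2) by (simp add: N_def x y diffs[symmetric] algebra_simps)
    also have "\<dots> \<le> t ^ 20 * N (x - y) + 4 * e * N (x - y)"
    proof -
      have "2 * (e * norm \<beta>) + 2 * (e * norm \<nu>) \<le> 4 * e * (norm \<beta> + norm \<nu>)"
        using e by (simp add: algebra_simps)
      also have "\<dots> \<le> 4 * e * N (x - y)"
        using e by (intro mult_left_mono) (auto simp: N_def x y diffs[symmetric])
      finally show ?thesis by simp
    qed
    also have "\<dots> = (t ^ 20 + 4 * e) * N (x - y)" by (simp add: algebra_simps)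
    also have "\<dots> \<le> t ^ 15 * N (x - y)"
      using e by (intro mult_right_mono) (auto simp: N_def split: prod.split)
    finally show ?thesis .
  qed
  have "\<exists>u. \<forall>n. u n = \<Gamma> n (u (Suc n)) \<and> N (u n) \<le> P / (1 - t ^ 10) * \<omega> n"
  proof (rule backward_solution[where \<kappa> = "1 / e" and \<rho> = "\<lambda>n. t ^ 15 * (if train_end n then 2 ^ j else 1)"])
    show "N (x + y) \<le> N x + N y" for x y
    proof -
      obtain \<beta>1 \<gamma>1 \<nu>1 \<mu>1 where x: "x = (\<beta>1, \<gamma>1, \<nu>1, \<mu>1)" by (metis prod_cases4)
      obtain \<beta>2 \<gamma>2 \<nu>2 \<mu>2 where y: "y = (\<beta>2, \<gamma>2, \<nu>2, \<mu>2)" by (metis prod_cases4)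
      have "e * norm (\<gamma>1 + \<gamma>2) \<le> e * (norm \<gamma>1 + norm \<gamma>2)" "e * norm (\<mu>1 + \<mu>2) \<le> e * (norm \<mu>1 + norm \<mu>2)"
        using e by (auto intro!: mult_left_mono norm_triangle_ineq)
      then show ?thesis
        using norm_triangle_ineq[of \<beta>1 \<beta>2] norm_triangle_ineq[of \<nu>1 \<nu>2]
        by (simp add: N_def x y algebra_simps)
    qed
    show "N 0 = 0" by (simp add: N_def zero_prod_def)
    show "norm x \<le> 1 / e * N x" for x
    proof -
      obtain \<beta> \<gamma> \<nu> \<mu> where x: "x = (\<beta>, \<gamma>, \<nu>, \<mu>)" by (metis prod_cases4)
      have 1: "norm x \<le> norm \<beta> + (norm \<gamma> + (norm \<nu> + norm \<mu>))"
        unfolding x using norm_Pair_le[of \<beta> "(\<gamma>, \<nu>, \<mu>)"] norm_Pair_le[of \<gamma> "(\<nu>, \<mu>)"] norm_Pair_le[of \<nu> \<mu>] by linarith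
      have "e * norm \<beta> \<le> norm \<beta>" "e * norm \<nu> \<le> norm \<nu>"
        using e by (auto intro: mult_left_le_one_le)
      then have "e * norm x \<le> N x"
        using mult_left_mono[OF 1, of e] e by (simp add: N_def x algebra_simps)
      then show ?thesis using e by (simp add: field_simps)
    qed
    show "continuous_on UNIV N"
      unfolding N_def case_prod_unfold by (intro continuous_intros)
    show "continuous_on UNIV (\<Gamma> n)" for n
      unfolding \<Gamma>_def \<Gamma>0_def sw_def case_prod_unfold
      using nz by (cases "train_end n") (auto intro!: continuous_intros)
    show "N (\<Gamma> n x - \<Gamma> n y) \<le> t ^ 15 * (if train_end n then 2 ^ j else 1) * N (x - y)" for n x y
    proof (cases "train_end n")
      case True
      have "N (\<Gamma> n x - \<Gamma> n y) \<le> t ^ 15 * N (sw x - sw y)" using True N_\<Gamma>0 by (simp add: \<Gamma>_def)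
      also have "sw x - sw y = sw (x - y)" by (auto simp: sw_def split: prod.split)
      also have "t ^ 15 * N (sw (x - y)) \<le> t ^ 15 * (1 / e * N (x - y))"
        using t by (intro mult_left_mono N_sw) auto
      finally show ?thesis using True by (simp add: e_def power_one_over)
    next
      case False
      then show ?thesis using N_\<Gamma>0 by (simp add: \<Gamma>_def)
    qed
    show "t ^ 15 * (if train_end n then 2 ^ j else 1) * \<omega> (Suc n) \<le> t ^ 10 * \<omega> n" for n
    proof -
      have "t ^ 15 * w ^ 5 = t ^ 10 * (t ^ 5 * w ^ 5)" by (simp add: mult.assoc[symmetric] flip: power_add)
      then have 1: "t ^ 15 * w ^ 5 = t ^ 10" by (simp only: w(5) mult_1_right)
      have "w ^ (5 * Suc n) = w ^ 5 * w ^ (5 * n)" by (simp add: power_add[symmetric])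
      then have 2: "t ^ 15 * w ^ (5 * Suc n) = t ^ 10 * w ^ (5 * n)" by (simp only: mult.assoc[symmetric] 1)
      show ?thesis
      proof (cases "train_end n")
        case True
        have "t ^ 15 * 2 ^ j * \<omega> (Suc n) = t ^ 15 * w ^ (5 * Suc n) / (2 ^ j) ^ train_index n"
          using True by (simp only: \<omega>_def train_index_Suc if_True power_Suc) simp
        then show ?thesis using True by (simp only: 2 if_True) (simp add: \<omega>_def)
      next
        case False
        then show ?thesis
          using 2 by (simp only: \<omega>_def train_index_Suc if_False mult_1_right times_divide_eq_right order_refl)
      qed
    qed
    show "N (\<Gamma> n 0) \<le> P * \<omega> n" for n
    proof -
      have "N (\<Gamma> n 0) = N (e2 n, e3 n, e4 n, e5 n - c n / b n * e2 n)"
        by (simp add: \<Gamma>_def \<Gamma>0_def sw_def zero_prod_def)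
      also have "\<dots> \<le> norm (e2 n) + norm (e3 n) + norm (e4 n) + norm (e5 n - c n / b n * e2 n)"
        using e by (simp add: N_def mult_left_le_one_le add_mono)
      also have "norm (e5 n - c n / b n * e2 n) \<le> norm (e5 n) + norm (c n / b n * e2 n)"
        by (rule norm_triangle_ineq4)
      also have "norm (c n / b n * e2 n) \<le> 1 / C * norm (e2 n)"
      proof -
        have "norm (c n / b n) \<le> 1 / C"
          using norm_div_le(2)[of "c n" n] one(3)[of n] C0 by (meson divide_right_mono less_imp_le order_trans)
        then show ?thesis unfolding norm_mult by (rule mult_right_mono) simp
      qed
      also have "1 / C * norm (e2 n) \<le> 1 / C * (E * w ^ (4 * n))"
        using eb(1) C0 by (intro mult_left_mono) auto
      finally have "N (\<Gamma> n 0) \<le> (4 + 1 / C) * E * w ^ (4 * n)"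
        using eb[of n] by (simp add: algebra_simps)
      \<comment> \<open>The forcing grows only like \<open>w ^ (4 * n)\<close>; the missing factor
        \<open>w ^ n\<close> absorbs the polynomial denominator of \<omega>. This is why the final
        rate is \<open>w ^ 5\<close> and not \<open>w ^ 4\<close>.\<close>
      also have "\<dots> \<le> P * \<omega> n"
      proof -
        have "(2 ^ train_index n) ^ j \<le> (2 * real n + 1) ^ j"
        proof (rule power_mono)
          show "2 ^ train_index n \<le> 2 * real n + 1"
            using of_nat_mono[OF train_index_bounds(2)[of n], where ?'a = real] by simp
        qed simp
        then have "(2 ^ j) ^ train_index n * t ^ n \<le> P1"
        proof -
          have 1: "(2 ^ j) ^ train_index n = ((2 :: real) ^ train_index n) ^ j"
            by (simp add: power_mult[symmetric] mult.commute)
          have 2: "(2 ^ train_index n) ^ j * t ^ n \<le> (2 * real n + 1) ^ j * t ^ n"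
            using \<open>(2 ^ train_index n) ^ j \<le> (2 * real n + 1) ^ j\<close> t by (intro mult_right_mono) auto
          show ?thesis unfolding 1 by (rule order_trans[OF 2 P1])
        qed
        then have "(2 ^ j) ^ train_index n * t ^ n * w ^ (5 * n) \<le> P1 * w ^ (5 * n)"
          by (rule mult_right_mono) (simp add: w less_imp_le)
        moreover have "t ^ n * w ^ (5 * n) = w ^ (4 * n)"
        proof -
          have "w ^ (5 * n) = w ^ n * w ^ (4 * n)" by (simp flip: power_add)
          then show ?thesis by (simp only: mult.assoc[symmetric] w(5) mult_1_left)
        qed
        ultimately have "(2 ^ j) ^ train_index n * w ^ (4 * n) \<le> P1 * w ^ (5 * n)"
          by (simp only: mult.assoc)
        then have "w ^ (4 * n) \<le> P1 * w ^ (5 * n) / (2 ^ j) ^ train_index n"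
          by (simp only: pos_le_divide_eq zero_less_power zero_less_numeral mult.commute[of "w ^ _" "(2 ^ j) ^ _"])
        then have "w ^ (4 * n) \<le> P1 * \<omega> n"
          by (simp add: \<omega>_def)
        then have "(4 + 1 / C) * E * w ^ (4 * n) \<le> (4 + 1 / C) * E * (P1 * \<omega> n)"
          using E C0 by (intro mult_left_mono) auto
        then show ?thesis by (simp add: P_def mult_ac)
      qed
      finally show ?thesis .
    qed
  qed (use t P e power_strict_decreasing[of 0 10 t] in auto)
  then obtain u where u: "\<And>n. u n = \<Gamma> n (u (Suc n))" "\<And>n. N (u n) \<le> P / (1 - t ^ 10) * \<omega> n" by blast
  define \<beta> where "\<beta> n = fst (u n)" for n
  define \<gamma> where "\<gamma> n = fst (snd (u n))" for n
  define \<nu> where "\<nu> n = fst (snd (snd (u n)))" for n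
  define \<mu> where "\<mu> n = snd (snd (snd (u n)))" for n
  have un: "u n = (\<beta> n, \<gamma> n, \<nu> n, \<mu> n)" for n by (simp add: \<beta>_def \<gamma>_def \<nu>_def \<mu>_def)
  define \<beta>' where "\<beta>' n = (if train_end n then \<mu> else \<beta>) (Suc n)" for n
  define \<gamma>' where "\<gamma>' n = (if train_end n then \<nu> else \<gamma>) (Suc n)" for n
  define \<nu>' where "\<nu>' n = (if train_end n then \<gamma> else \<nu>) (Suc n)" for n
  define \<mu>' where "\<mu>' n = (if train_end n then \<beta> else \<mu>) (Suc n)" for n
  have eqs: "\<beta> n = b n * \<beta>' n + e2 n" "\<gamma> n = a n * \<gamma>' n + c n * \<beta>' n + e3 n" "\<nu> n = b n * \<nu>' n + e4 n"
    "\<mu> n = a n * \<mu>' n + 2 * c n * \<nu>' n - c n / b n * \<beta> n + e5 n" for n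
    using u(1)[of n] by (auto simp: un \<Gamma>_def \<Gamma>0_def sw_def \<beta>'_def \<gamma>'_def \<nu>'_def \<mu>'_def split: if_splits)
  define M1 where "M1 = P / (1 - t ^ 10) / e"
  have M1: "0 \<le> M1" using P e t by (auto simp: M1_def power_le_one)
  have ub: "norm (\<beta> n) \<le> M1 * w ^ (5 * n)" "norm (\<gamma> n) \<le> M1 * w ^ (5 * n)"
    "norm (\<nu> n) \<le> M1 * w ^ (5 * n)" "norm (\<mu> n) \<le> M1 * w ^ (5 * n)" for n
  proof -
    have P0: "0 \<le> P / (1 - t ^ 10)" using P t by (auto simp: power_le_one)
    have "\<omega> n \<le> w ^ (5 * n) / 1"
      unfolding \<omega>_def using w by (intro divide_left_mono) (auto simp: one_le_power less_imp_le)
    then have "\<omega> n \<le> w ^ (5 * n)" by simp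
    then have Nu: "N (u n) \<le> P / (1 - t ^ 10) * w ^ (5 * n)"
      using u(2)[of n] mult_left_mono[OF _ P0, of "\<omega> n" "w ^ (5 * n)"] by linarith
    have le: "p \<le> M1 * w ^ (5 * n)" if "e * p \<le> N (u n)" for p
    proof -
      have "p * e \<le> P / (1 - t ^ 10) * w ^ (5 * n)" using order_trans[OF that Nu] by (simp only: mult.commute[of p])
      then have "p \<le> P / (1 - t ^ 10) * w ^ (5 * n) / e" using e(1) by (simp only: pos_le_divide_eq)
      then show ?thesis by (simp add: M1_def)
    qed
    have ee: "e * p \<le> p" "0 \<le> e * p" if "0 \<le> p" for p using e that by (auto intro: mult_left_le_one_le)
    show "norm (\<beta> n) \<le> M1 * w ^ (5 * n)" "norm (\<gamma> n) \<le> M1 * w ^ (5 * n)"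
      "norm (\<nu> n) \<le> M1 * w ^ (5 * n)" "norm (\<mu> n) \<le> M1 * w ^ (5 * n)"
      using ee[of "norm (\<beta> n)"] ee[of "norm (\<gamma> n)"] ee[of "norm (\<nu> n)"] ee[of "norm (\<mu> n)"]
      by (auto intro!: le simp: un N_def)
  qed
  have "a n * \<beta> n = a n * b n * \<beta>' n + 2 * b n * c n * \<alpha>' n + q2 n \<and>
      a n * \<gamma> n = (a n)\<^sup>2 * \<gamma>' n + a n * c n * \<beta>' n + (c n)\<^sup>2 * \<alpha>' n + q3 n \<and>
      b n * \<nu> n + c n * \<alpha> n = (b n)\<^sup>2 * \<nu>' n + q4 n \<and>
      b n * \<mu> n + c n * \<beta> n = a n * b n * \<mu>' n + 2 * b n * c n * \<nu>' n + q5 n" for n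
  proof (intro conjI)
    have "a n * e2 n = 2 * b n * c n * \<alpha>' n + q2 n" "a n * e3 n = (c n)\<^sup>2 * \<alpha>' n + q3 n"
      "b n * e4 n = q4 n - c n * \<alpha> n" "b n * e5 n = q5 n" "b n * (c n / b n * \<beta> n) = c n * \<beta> n"
      using nz[of n] by (simp_all add: e2_def e3_def e4_def e5_def distrib_left)
    note e = this
    show "a n * \<beta> n = a n * b n * \<beta>' n + 2 * b n * c n * \<alpha>' n + q2 n"
      using e(1) by (subst eqs(1)) (simp add: distrib_left)
    show "a n * \<gamma> n = (a n)\<^sup>2 * \<gamma>' n + a n * c n * \<beta>' n + (c n)\<^sup>2 * \<alpha>' n + q3 n"
      using e(2) by (subst eqs(2)) (simp add: distrib_left power2_eq_square)
    show "b n * \<nu> n + c n * \<alpha> n = (b n)\<^sup>2 * \<nu>' n + q4 n"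
      using e(3) by (subst eqs(3)) (simp add: distrib_left power2_eq_square)
    show "b n * \<mu> n + c n * \<beta> n = a n * b n * \<mu>' n + 2 * b n * c n * \<nu>' n + q5 n"
      using e(4,5) by (subst eqs(4)) (simp add: distrib_left right_diff_distrib)
  qed
  with M1 ub show ?thesis
    unfolding nonresonant_equations_def \<beta>'_def \<gamma>'_def \<nu>'_def \<mu>'_def Let_def by blast
qed

lemma normal_form_coefficients:
  "\<exists>\<alpha> \<beta> \<gamma> \<nu> \<mu> d M. M \<ge> 1 \<and> (\<forall>n.
    normal_form_equations \<alpha> \<beta> \<gamma> \<nu> \<mu> d n \<and>
    (\<forall>\<xi>\<in>{\<alpha>, \<beta>, \<gamma>, \<nu>, \<mu>}. norm (\<xi> n) \<le> M * w ^ (5 * n) \<and> norm (\<xi> (Suc n)) \<le> M * w ^ (5 * n)) \<and>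
    norm (d n) \<le> M * w ^ (5 * n))"
proof -
  obtain \<alpha> A where A: "0 \<le> A"
    and \<alpha>: "\<And>n. a n * \<alpha> n = (b n)\<^sup>2 * (if train_end n then 0 else \<alpha> (Suc n)) + q1 n"
    and \<alpha>b: "\<And>n. norm (\<alpha> n) \<le> A * w ^ (4 * n)" "\<And>n. norm (\<alpha> (Suc n)) \<le> A * w ^ (4 * n)"
    using resonant_coefficients by metis
  define \<alpha>' where "\<alpha>' n = (if train_end n then 0 else \<alpha> (Suc n))" for n
  have \<alpha>'b: "norm (\<alpha>' n) \<le> A * w ^ (4 * n)" for n
    using \<alpha>b(2)[of n] A w(3)[of "4 * n"] unfolding \<alpha>'_def by (cases "train_end n") simp_all
  obtain \<beta> \<gamma> \<nu> \<mu> M where M: "0 \<le> M" and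
    eqs: "\<And>n. nonresonant_equations \<alpha> \<alpha>' \<beta> \<gamma> \<nu> \<mu> n"
    and bnd: "\<And>n. norm (\<beta> n) \<le> M * w ^ (5 * n)" "\<And>n. norm (\<gamma> n) \<le> M * w ^ (5 * n)"
      "\<And>n. norm (\<nu> n) \<le> M * w ^ (5 * n)" "\<And>n. norm (\<mu> n) \<le> M * w ^ (5 * n)"
    using nonresonant_coefficients[OF A \<alpha>b(1) \<alpha>'b] by metis
  \<comment> \<open>The factor \<open>w ^ 5\<close> covers the coefficients at time
    \<open>Suc n\<close>, from which the primed coefficients are taken.\<close>
  define M2 where "M2 = A + M * w ^ 5"
  have M2: "0 \<le> M2" "A \<le> M2" "M \<le> M2" "M * w ^ 5 \<le> M2"
    using A M w(3)[of 5] mult_left_mono[OF w(3)[of 5] M] by (auto simp: M2_def)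
  have coef: "norm (\<xi> n) \<le> M2 * w ^ (5 * n) \<and> norm (\<xi> (Suc n)) \<le> M2 * w ^ (5 * n)"
    if "\<xi> \<in> {\<alpha>, \<beta>, \<gamma>, \<nu>, \<mu>}" for \<xi> n
  proof (cases "\<xi> = \<alpha>")
    case True
    have "A * w ^ (4 * n) \<le> M2 * w ^ (5 * n)"
      using A M2 w by (intro mult_mono w_mono) (auto simp: less_imp_le)
    then show ?thesis using True \<alpha>b[of n] by auto
  next
    case False
    then have 1: "norm (\<xi> m) \<le> M * w ^ (5 * m)" for m using that bnd by auto
    have "M * w ^ (5 * n) \<le> M2 * w ^ (5 * n)"
      using M2 w by (intro mult_right_mono) (auto simp: less_imp_le)
    moreover have "M * w ^ (5 * Suc n) \<le> M2 * w ^ (5 * n)"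
      using mult_right_mono[OF M2(4), of "w ^ (5 * n)"] w(4)[of "5 * n"]
      by (simp add: power_add mult.assoc)
    ultimately show ?thesis using 1[of n] 1[of "Suc n"] by linarith
  qed
  define \<nu>' where "\<nu>' n = (if train_end n then \<gamma> else \<nu>) (Suc n)" for n
  define \<mu>' where "\<mu>' n = (if train_end n then \<beta> else \<mu>) (Suc n)" for n
  define \<sigma>' where "\<sigma>' n = (if train_end n then \<alpha> (Suc n) else 0)" for n
  define d where "d n = (a n)\<^sup>2 * \<sigma>' n + (c n)\<^sup>2 * \<nu>' n + a n * c n * \<mu>' n + q6 n - c n * \<gamma> n" for n
  have db: "norm (d n) \<le> (4 * M2 + 64) * w ^ (5 * n)" for n
  proof -
    have W: "0 \<le> M2 * w ^ (5 * n)" using M2 w(4)[of "5 * n"] by (simp add: less_imp_le)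
    have "norm (\<sigma>' n) \<le> M2 * w ^ (5 * n)" "norm (\<nu>' n) \<le> M2 * w ^ (5 * n)" "norm (\<mu>' n) \<le> M2 * w ^ (5 * n)"
      "norm (\<gamma> n) \<le> M2 * w ^ (5 * n)"
      using coef[of _ n] W by (auto simp: \<sigma>'_def \<nu>'_def \<mu>'_def)
    note co = this
    have pr: "norm (x * y * z) \<le> M2 * w ^ (5 * n)"
      if "norm x \<le> 1" "norm y \<le> 1" "norm z \<le> M2 * w ^ (5 * n)" for x y z :: complex
    proof -
      have "norm (x * y * z) \<le> 1 * 1 * (M2 * w ^ (5 * n))"
        unfolding norm_mult using that by (intro mult_mono) auto
      then show ?thesis by simp
    qed
    have "norm ((a n)\<^sup>2 * \<sigma>' n) \<le> M2 * w ^ (5 * n)" "norm ((c n)\<^sup>2 * \<nu>' n) \<le> M2 * w ^ (5 * n)"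
      "norm (a n * c n * \<mu>' n) \<le> M2 * w ^ (5 * n)"
      unfolding power2_eq_square using one[of n] co by (auto intro!: pr)
    moreover have "norm (1 * c n * \<gamma> n) \<le> M2 * w ^ (5 * n)"
      by (rule pr) (use one co in auto)
    moreover have "norm (q6 n) \<le> 64 * w ^ (5 * n)" using Q(6)[of n] w(3)[of "5 * n"] by linarith
    ultimately have "norm ((a n)\<^sup>2 * \<sigma>' n) + norm ((c n)\<^sup>2 * \<nu>' n) + norm (a n * c n * \<mu>' n) + norm (q6 n)
      + norm (c n * \<gamma> n) \<le> (4 * M2 + 64) * w ^ (5 * n)" by (simp add: algebra_simps)
    moreover have "norm (d n) \<le> norm ((a n)\<^sup>2 * \<sigma>' n) + norm ((c n)\<^sup>2 * \<nu>' n) + norm (a n * c n * \<mu>' n)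
      + norm (q6 n) + norm (c n * \<gamma> n)"
      unfolding d_def by (intro norm_triangle_le_diff norm_triangle_mono add_right_mono order_refl)
    ultimately show ?thesis by linarith
  qed
  define K where "K = 4 * M2 + 64"
  have K: "K \<ge> 1" "M2 * w ^ m \<le> K * w ^ m" for m
    using M2 w(4)[of m] by (auto simp: K_def intro!: mult_right_mono)
  have coefK: "\<forall>\<xi>\<in>{\<alpha>, \<beta>, \<gamma>, \<nu>, \<mu>}. norm (\<xi> n) \<le> K * w ^ (5 * n) \<and> norm (\<xi> (Suc n)) \<le> K * w ^ (5 * n)" for n
    using coef K(2) order_trans by blast
  have d: "c n * \<gamma> n + d n = (a n)\<^sup>2 * \<sigma>' n + (c n)\<^sup>2 * \<nu>' n + a n * c n * \<mu>' n + q6 n" for n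
    by (simp add: d_def)
  show ?thesis
  proof (intro exI conjI allI)
    show "1 \<le> K" by (rule K)
    fix n
    show "norm (d n) \<le> K * w ^ (5 * n)" using db[of n] by (simp add: K_def)
    show "\<forall>\<xi>\<in>{\<alpha>, \<beta>, \<gamma>, \<nu>, \<mu>}. norm (\<xi> n) \<le> K * w ^ (5 * n) \<and> norm (\<xi> (Suc n)) \<le> K * w ^ (5 * n)"
      by (rule coefK)
  qed (use \<alpha> eqs d in \<open>auto simp: normal_form_equations_def nonresonant_equations_def Let_def \<alpha>'_def \<sigma>'_def \<nu>'_def \<mu>'_def\<close>)
qed

end

section \<open>The normal form and its basin\<close>

text \<open>A train squares the size of a large point but also contracts by a factor exponential in its
  length \<open>2 ^ k\<close>, so that \<open>ln (R k) / 2 ^ k\<close> decreases by a fixed amount at each train.\<close>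

lemma eventually_below_exponential:
  fixes R :: "nat \<Rightarrow> real"
  assumes t: "0 < t" "t < 1" and r: "0 < r" and K: "0 \<le> K" and R: "\<And>k. 0 \<le> R k"
    and step: "\<And>k. R (Suc k) \<le> t ^ (20 * 2 ^ k) * R k + K * t ^ (15 * 2 ^ k) * (R k)\<^sup>2"
  shows "\<exists>k. R k < r * t ^ (5 * 2 ^ k)"
proof (rule ccontr)
  assume "\<not> ?thesis"
  then have big: "r * t ^ (5 * 2 ^ k) \<le> R k" for k by (auto simp: not_less)
  obtain k0 where k0: "(1 + K) * t ^ k0 \<le> 1" "t ^ k0 \<le> r"
  proof -
    obtain k where "t ^ k < min r (1 / (1 + K))"
      using real_arch_pow_inv[of "min r (1 / (1 + K))" t] t r K by auto
    then show ?thesis using K by (intro that[of k]) (auto simp: field_simps add_pos_nonneg)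
  qed
  define w where "w = 1 / t"
  have w: "0 < w ^ m" "t ^ m * w ^ m = 1" for m
    using t by (auto simp: w_def power_mult_distrib[symmetric])
  have pow_le: "t ^ m \<le> t ^ k0" if "k0 \<le> m" for m
    using t that by (intro power_decreasing) auto
  have two: "m \<le> 2 ^ m" for m :: nat by (simp add: less_imp_le)
  \<comment> \<open>Under the negated goal this quantity is at least 1 as soon as
    \<open>t ^ (2 ^ k) \<le> r\<close>; then X \<le> X^2 lets the linear term be merged into the
    quadratic one.\<close>
  define X where "X k = R k * w ^ (6 * 2 ^ k)" for k
  have RX: "R k = X k * t ^ (6 * 2 ^ k)" for k
    using w(2)[of "6 * 2 ^ k"] by (simp add: X_def mult.assoc mult.commute[of "w ^ _"])
  have X1: "1 \<le> X k" if "k0 \<le> k" for k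
  proof -
    let ?n = "2 ^ k :: nat"
    have "t ^ ?n \<le> r" using pow_le[of ?n] k0(2) two[of k] that by linarith
    then have "t ^ (6 * ?n) \<le> r * t ^ (5 * ?n)"
      using mult_right_mono[of "t ^ ?n" r "t ^ (5 * ?n)"] t by (simp flip: power_add)
    also have "\<dots> \<le> R k" by (rule big)
    finally have "t ^ (6 * ?n) * 1 \<le> t ^ (6 * ?n) * X k" by (simp add: RX mult.commute)
    then show ?thesis using t by (simp only: mult_le_cancel_left_pos zero_less_power)
  qed
  have Xstep: "X (Suc k) \<le> t ^ (4 * 2 ^ k) * (X k)\<^sup>2" if k: "k0 \<le> k" for k
  proof -
    let ?n = "2 ^ k :: nat"
    have x: "1 \<le> X k" by (rule X1[OF k])
    have "X (Suc k) * t ^ (12 * ?n) = R (Suc k)" using RX[of "Suc k"] by simp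
    also have "\<dots> \<le> t ^ (20 * ?n) * R k + K * t ^ (15 * ?n) * (R k)\<^sup>2" by (rule step)
    also have "\<dots> = t ^ (26 * ?n) * X k + K * t ^ (27 * ?n) * (X k)\<^sup>2"
      by (simp add: RX power_mult_distrib mult_ac flip: power_add power_mult)
    also have "\<dots> \<le> t ^ (26 * ?n) * (X k)\<^sup>2 + K * t ^ (26 * ?n) * (X k)\<^sup>2"
    proof (intro add_mono mult_left_mono mult_right_mono)
      show "X k \<le> (X k)\<^sup>2" using x by (simp add: power2_eq_square)
      show "t ^ (27 * ?n) \<le> t ^ (26 * ?n)" using t by (intro power_decreasing) auto
    qed (use t K in auto)
    \<comment> \<open>The exponent splits as 26 = 10 + 4 + 12: the first part swallows
      \<open>1 + K\<close>, the last is the normalization of \<open>X (Suc k)\<close>, and 4 remains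
      as gain.\<close>
    also have "\<dots> = (1 + K) * t ^ (10 * ?n) * (t ^ (16 * ?n) * (X k)\<^sup>2)"
      by (simp add: algebra_simps flip: power_add)
    also have "\<dots> \<le> 1 * (t ^ (16 * ?n) * (X k)\<^sup>2)"
    proof (rule mult_right_mono)
      have "k0 \<le> 10 * ?n" using two[of k] k by linarith
      then have "(1 + K) * t ^ (10 * ?n) \<le> (1 + K) * t ^ k0"
        using K by (intro mult_left_mono pow_le) auto
      with k0(1) show "(1 + K) * t ^ (10 * ?n) \<le> 1" by linarith
    qed (use t in auto)
    also have "\<dots> = t ^ (4 * ?n) * (X k)\<^sup>2 * t ^ (12 * ?n)" by (simp flip: power_add)
    finally show ?thesis using t by (simp only: mult_le_cancel_right_pos zero_less_power)
  qed
  \<comment> \<open>The root of \<open>X k\<close> of order \<open>2 ^ k\<close> loses a factor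
    \<open>t ^ 2\<close> at each train and so drops below 1 in the end.\<close>
  have XA: "X (k0 + j) \<le> (X k0 * t ^ (2 * j)) ^ (2 ^ (k0 + j))" for j
  proof (induction j)
    case 0
    have "X k0 ^ 1 \<le> X k0 ^ (2 ^ k0)" using X1[of k0] by (intro power_increasing) auto
    then show ?case by simp
  next
    case (Suc j)
    let ?n = "2 ^ (k0 + j) :: nat" and ?A = "X k0 * t ^ (2 * j)"
    have "X (k0 + Suc j) \<le> t ^ (4 * ?n) * (X (k0 + j))\<^sup>2" using Xstep[of "k0 + j"] by simp
    also have "\<dots> \<le> t ^ (4 * ?n) * (?A ^ ?n)\<^sup>2"
      using t Suc X1[of "k0 + j"] by (intro mult_left_mono power_mono) auto
    also have "\<dots> = (t ^ 2) ^ (2 * ?n) * ?A ^ (2 * ?n)"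
      by (simp flip: power_mult add: mult.commute[of _ 2])
    also have "\<dots> = (X k0 * t ^ (2 * Suc j)) ^ (2 ^ (k0 + Suc j))"
      by (simp add: power_mult_distrib[symmetric] power_add power2_eq_square mult_ac)
    finally show ?case .
  qed
  obtain j where "(t ^ 2) ^ j < 1 / X k0"
    using real_arch_pow_inv[of "1 / X k0" "t ^ 2"] X1[of k0] t by (auto simp: power_less_one_iff)
  then have "t ^ (2 * j) < 1 / X k0" by (simp only: power_mult)
  then have "X k0 * t ^ (2 * j) < 1" using X1[of k0] by (simp add: pos_less_divide_eq mult.commute)
  then have "(X k0 * t ^ (2 * j)) ^ (2 ^ (k0 + j)) < 1"
    using X1[of k0] t by (simp add: power_less_one_iff)
  then show False using XA[of j] X1[of "k0 + j"] by linarith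
qed

section \<open>Lipschitz bounds for quadratic maps\<close>

lemma quad_comp_lipschitz:
  fixes u v :: "complex ^ 2"
  assumes "norm q1 \<le> M" "norm q2 \<le> M" "norm q3 \<le> M"
  shows "norm ((q1 * (u $ 2)\<^sup>2 + q2 * (u $ 1 * u $ 2) + q3 * (u $ 1)\<^sup>2) - (q1 * (v $ 2)\<^sup>2 + q2 * (v $ 1 * v $ 2) + q3 * (v $ 1)\<^sup>2))
    \<le> 3 * M * (norm u + norm v) * norm (u - v)"
proof -
  define S where "S = (norm u + norm v) * norm (u - v)"
  have M: "0 \<le> M" using assms(1) norm_ge_zero order_trans by blast
  have n: "norm (u $ i) \<le> norm u" "norm (v $ i) \<le> norm v" "norm (u $ i - v $ i) \<le> norm (u - v)" for i
    using Finite_Cartesian_Product.norm_nth_le[of u i] Finite_Cartesian_Product.norm_nth_le[of v i]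
      Finite_Cartesian_Product.norm_nth_le[of "u - v" i] by auto
  have p: "norm (u $ i * u $ k - v $ i * v $ k) \<le> S" for i k
  proof -
    have "u $ i * u $ k - v $ i * v $ k = u $ i * (u $ k - v $ k) + (u $ i - v $ i) * v $ k"
      by (simp add: algebra_simps)
    also have "norm \<dots> \<le> norm (u $ i * (u $ k - v $ k)) + norm ((u $ i - v $ i) * v $ k)"
      by (rule norm_triangle_ineq)
    also have "\<dots> \<le> norm u * norm (u - v) + norm (u - v) * norm v"
      unfolding norm_mult by (intro add_mono mult_mono n) auto
    finally show ?thesis by (simp add: S_def algebra_simps)
  qed
  have "(q1 * (u $ 2)\<^sup>2 + q2 * (u $ 1 * u $ 2) + q3 * (u $ 1)\<^sup>2) - (q1 * (v $ 2)\<^sup>2 + q2 * (v $ 1 * v $ 2) + q3 * (v $ 1)\<^sup>2)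
    = q1 * (u $ 2 * u $ 2 - v $ 2 * v $ 2) + q2 * (u $ 1 * u $ 2 - v $ 1 * v $ 2) + q3 * (u $ 1 * u $ 1 - v $ 1 * v $ 1)"
    by (simp add: algebra_simps power2_eq_square)
  also have "norm \<dots> \<le> norm (q1 * (u $ 2 * u $ 2 - v $ 2 * v $ 2)) + norm (q2 * (u $ 1 * u $ 2 - v $ 1 * v $ 2))
      + norm (q3 * (u $ 1 * u $ 1 - v $ 1 * v $ 1))"
    by (intro norm_triangle_mono order_refl)
  also have "\<dots> \<le> M * S + M * S + M * S"
    unfolding norm_mult[of q1] norm_mult[of q2] norm_mult[of q3] by (intro add_mono mult_mono p assms M) auto
  also have "\<dots> = 3 * M * (norm u + norm v) * norm (u - v)" by (simp add: S_def algebra_simps)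
  finally show ?thesis .
qed

lemma quad_lipschitz:
  assumes "norm q1 \<le> M" "norm q2 \<le> M" "norm q3 \<le> M" "norm q4 \<le> M" "norm q5 \<le> M" "norm q6 \<le> M"
  shows "norm (quad q1 q2 q3 q4 q5 q6 u - quad q1 q2 q3 q4 q5 q6 v) \<le> 6 * M * (norm u + norm v) * norm (u - v)"
proof -
  let ?w = "quad q1 q2 q3 q4 q5 q6 u - quad q1 q2 q3 q4 q5 q6 v"
  have "norm (?w $ 1) \<le> 3 * M * (norm u + norm v) * norm (u - v)"
    unfolding quad_def vector_minus_component vector_2 by (rule quad_comp_lipschitz[OF assms(1-3)])
  moreover have "norm (?w $ 2) \<le> 3 * M * (norm u + norm v) * norm (u - v)"
    unfolding quad_def vector_minus_component vector_2 by (rule quad_comp_lipschitz[OF assms(4-6)])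
  ultimately show ?thesis using norm_vec2_le[of ?w] by simp
qed

section \<open>Coordinate swaps and the triangularized system\<close>

lemma norm_vec2: "norm z = sqrt ((norm (z $ 1))\<^sup>2 + (norm (z $ 2))\<^sup>2)" for z :: "complex ^ 2"
  by (simp add: norm_vec_def L2_set_def sum_2)

definition swap_vec :: "complex ^ 2 \<Rightarrow> complex ^ 2"
  where "swap_vec z = vector [z $ 2, z $ 1]"

definition flip :: "nat \<Rightarrow> complex ^ 2 \<Rightarrow> complex ^ 2"
  where "flip n z = (if train_end n then swap_vec z else z)"

lemma flip_props:
  "norm (flip n z) = norm z" "flip n (flip n z) = z" "flip n (u - v) = flip n u - flip n v"
  "flip n (u + v) = flip n u + flip n v" "flip n (k *s v) = k *s flip n v"
  by (auto simp: flip_def swap_vec_def norm_vec2 vec_eq_iff forall_2 add.commute)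

lemma holomorphic_map_onI_2:
  fixes f :: "complex ^ 'n \<Rightarrow> complex ^ 2"
  assumes "open U" "\<And>z. z \<in> U \<Longrightarrow> complex_differentiable_at (\<lambda>z. f z $ 1) z"
    "\<And>z. z \<in> U \<Longrightarrow> complex_differentiable_at (\<lambda>z. f z $ 2) z"
  shows "holomorphic_map_on f U"
proof (rule holomorphic_map_onI_componentwise[OF assms(1)])
  fix z i assume "z \<in> U"
  then show "complex_differentiable_at (\<lambda>z. f z $ i) z" using assms(2,3) exhaust_2[of i] by auto
qed

lemma holomorphic_flip: "holomorphic_map_on (flip n) UNIV"
  by (rule holomorphic_map_onI_2; cases "train_end n")
    (auto simp: flip_def swap_vec_def intro!: complex_diff_intros)

lemma automorphism_flip: "automorphism (flip n)"
  by (rule automorphismI(1)[OF holomorphic_flip[of n] holomorphic_flip[of n]]) (simp_all add: flip_props)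

locale triangular_system = triangular_jets t C a b c q1 q2 q3 q4 q5 q6
  for t C :: real and a b c q1 q2 q3 q4 q5 q6 :: "nat \<Rightarrow> complex" +
  fixes F :: "nat \<Rightarrow> complex ^ 2 \<Rightarrow> complex ^ 2" and lin :: "nat \<Rightarrow> complex ^ 2 \<Rightarrow> complex ^ 2"
  defines "lin \<equiv> \<lambda>n z. vector [a n * z $ 1, b n * z $ 2 + c n * z $ 1]"
  assumes aut: "\<And>n. automorphism (F n)"
    and F_le: "\<And>n z. norm z < 1 \<Longrightarrow> norm (F n z) \<le> t ^ 20 * norm z"
    and lin_ge: "\<And>n z. C * norm z \<le> norm (lin n z)" and lin_le: "\<And>n z. norm (lin n z) \<le> t ^ 20 * norm z"
    and taylor: "\<And>n z. norm z < 1/2 \<Longrightarrow>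
      norm (F n z - lin n z - quad (q1 n) (q2 n) (q3 n) (q4 n) (q5 n) (q6 n) z) \<le> 4096 * norm z ^ 3"
    and lip: "\<And>n \<rho> z w. \<rho> \<le> 1/4 \<Longrightarrow> norm z \<le> \<rho> \<Longrightarrow> norm w \<le> \<rho> \<Longrightarrow>
      norm ((F n z - lin n z) - (F n w - lin n w)) \<le> 20000 * \<rho> * norm (z - w)"

text \<open>Primed coefficients are those at time \<open>Suc n\<close>, read in the coordinates used before the swap at
  the end of a train. The monomial \<open>x\<^sup>2\<close> of the second component is not removed but put into \<open>d\<close>;
  the swap turns the jump of \<open>\<alpha>\<close> at the end of a train into such a monomial, \<open>\<sigma>'\<close>.\<close>

locale normal_form = triangular_system +
  fixes \<alpha> \<beta> \<gamma> \<nu> \<mu> d \<alpha>' \<beta>' \<gamma>' \<nu>' \<mu>' \<sigma>' :: "nat \<Rightarrow> complex" and M r :: real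
  defines "\<alpha>' \<equiv> \<lambda>n. if train_end n then 0 else \<alpha> (Suc n)"
    and "\<beta>' \<equiv> \<lambda>n. (if train_end n then \<mu> else \<beta>) (Suc n)"
    and "\<gamma>' \<equiv> \<lambda>n. (if train_end n then \<nu> else \<gamma>) (Suc n)"
    and "\<nu>' \<equiv> \<lambda>n. (if train_end n then \<gamma> else \<nu>) (Suc n)"
    and "\<mu>' \<equiv> \<lambda>n. (if train_end n then \<beta> else \<mu>) (Suc n)"
    and "\<sigma>' \<equiv> \<lambda>n. if train_end n then \<alpha> (Suc n) else 0"
  assumes M: "1 \<le> M" and eqs: "\<And>n. a n * \<alpha> n = (b n)\<^sup>2 * \<alpha>' n + q1 n"
      "\<And>n. a n * \<beta> n = a n * b n * \<beta>' n + 2 * b n * c n * \<alpha>' n + q2 n"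
      "\<And>n. a n * \<gamma> n = (a n)\<^sup>2 * \<gamma>' n + a n * c n * \<beta>' n + (c n)\<^sup>2 * \<alpha>' n + q3 n"
      "\<And>n. b n * \<nu> n + c n * \<alpha> n = (b n)\<^sup>2 * \<nu>' n + q4 n"
      "\<And>n. b n * \<mu> n + c n * \<beta> n = a n * b n * \<mu>' n + 2 * b n * c n * \<nu>' n + q5 n"
      "\<And>n. c n * \<gamma> n + d n = (a n)\<^sup>2 * \<sigma>' n + (c n)\<^sup>2 * \<nu>' n + a n * c n * \<mu>' n + q6 n"
    and coef: "\<And>\<xi> n. \<xi> \<in> {\<alpha>, \<beta>, \<gamma>, \<nu>, \<mu>} \<Longrightarrow> norm (\<xi> n) \<le> M * w ^ (5 * n) \<and> norm (\<xi> (Suc n)) \<le> M * w ^ (5 * n)"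
    and d_le: "\<And>n. norm (d n) \<le> M * w ^ (5 * n)"
    and r: "0 < r" "100 * M * r \<le> 1" "M * r \<le> t ^ 19 - t ^ 20" "20000 * (M * r) \<le> C - t ^ 45"
begin

definition H where "H n = quad (\<alpha> n) (\<beta> n) (\<gamma> n) (\<nu> n) (\<mu> n) 0"
definition H' where "H' n = quad (\<alpha>' n) (\<beta>' n) (\<gamma>' n) (\<nu>' n) (\<mu>' n) (\<sigma>' n)"
definition Q' where "Q' n = quad (q1 n) (q2 n) (q3 n) (q4 n) (q5 n) (q6 n)"
definition g :: "nat \<Rightarrow> complex ^ 2 \<Rightarrow> complex ^ 2"
  where "g n z = vector [a n * z $ 1, b n * z $ 2 + c n * z $ 1 + d n * (z $ 1)\<^sup>2]"
definition m where "m n = M * w ^ (5 * n)"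

text \<open>The swap sends \<alpha> at time \<open>Suc n\<close> to the harmless monomial
  \<open>x^2\<close> of the second component and brings the zero coefficient from there into the
  resonant place, which is why the resonant equation restarts from 0.\<close>

lemma H_flip: "H (Suc n) (flip n z) = flip n (H' n z)"
  by (auto simp: H_def H'_def quad_def flip_def swap_vec_def vec_eq_iff forall_2
      \<alpha>'_def \<beta>'_def \<gamma>'_def \<nu>'_def \<mu>'_def \<sigma>'_def algebra_simps)

text \<open>The quadratic part of the conjugation: the derivatives agree, and this identity removes
  all terms of order two.\<close>

lemma homological_equation: "lin n (H n z) + vector [0, d n * (z $ 1)\<^sup>2] = H' n (lin n z) + Q' n z"
proof -
  let ?x = "z $ 1" and ?y = "z $ 2"
  have "a n * (\<alpha> n * ?y\<^sup>2 + \<beta> n * (?x * ?y) + \<gamma> n * ?x\<^sup>2)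
      = (a n * \<alpha> n) * ?y\<^sup>2 + (a n * \<beta> n) * (?x * ?y) + (a n * \<gamma> n) * ?x\<^sup>2" by (simp add: algebra_simps)
  also have "\<dots> = \<alpha>' n * (b n * ?y + c n * ?x)\<^sup>2 + \<beta>' n * (a n * ?x * (b n * ?y + c n * ?x)) + \<gamma>' n * (a n * ?x)\<^sup>2
      + (q1 n * ?y\<^sup>2 + q2 n * (?x * ?y) + q3 n * ?x\<^sup>2)"
    unfolding eqs by (simp add: algebra_simps power2_eq_square)
  finally have 1: "a n * (\<alpha> n * ?y\<^sup>2 + \<beta> n * (?x * ?y) + \<gamma> n * ?x\<^sup>2)
    = \<alpha>' n * (b n * ?y + c n * ?x)\<^sup>2 + \<beta>' n * (a n * ?x * (b n * ?y + c n * ?x)) + \<gamma>' n * (a n * ?x)\<^sup>2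
      + (q1 n * ?y\<^sup>2 + q2 n * (?x * ?y) + q3 n * ?x\<^sup>2)" .
  have "b n * (\<nu> n * ?y\<^sup>2 + \<mu> n * (?x * ?y)) + c n * (\<alpha> n * ?y\<^sup>2 + \<beta> n * (?x * ?y) + \<gamma> n * ?x\<^sup>2) + d n * ?x\<^sup>2
      = (b n * \<nu> n + c n * \<alpha> n) * ?y\<^sup>2 + (b n * \<mu> n + c n * \<beta> n) * (?x * ?y) + (c n * \<gamma> n + d n) * ?x\<^sup>2"
    by (simp add: algebra_simps)
  also have "\<dots> = \<nu>' n * (b n * ?y + c n * ?x)\<^sup>2 + \<mu>' n * (a n * ?x * (b n * ?y + c n * ?x)) + \<sigma>' n * (a n * ?x)\<^sup>2
      + (q4 n * ?y\<^sup>2 + q5 n * (?x * ?y) + q6 n * ?x\<^sup>2)"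
    unfolding eqs by (simp add: algebra_simps power2_eq_square)
  finally have 2: "b n * (\<nu> n * ?y\<^sup>2 + \<mu> n * (?x * ?y)) + c n * (\<alpha> n * ?y\<^sup>2 + \<beta> n * (?x * ?y) + \<gamma> n * ?x\<^sup>2) + d n * ?x\<^sup>2
    = \<nu>' n * (b n * ?y + c n * ?x)\<^sup>2 + \<mu>' n * (a n * ?x * (b n * ?y + c n * ?x)) + \<sigma>' n * (a n * ?x)\<^sup>2
      + (q4 n * ?y\<^sup>2 + q5 n * (?x * ?y) + q6 n * ?x\<^sup>2)" .
  show ?thesis
    using 1 2 by (simp add: vec_eq_iff forall_2 lin_def H_def H'_def Q'_def quad_def)
qed

lemma lin_add: "lin n (u + v) = lin n u + lin n v" and lin_diff: "lin n (u - v) = lin n u - lin n v"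
  by (simp_all add: lin_def vec_eq_iff forall_2 algebra_simps)

lemma m: "1 \<le> m n" "(m n)\<^sup>2 = M\<^sup>2 / (t ^ 5) ^ (2 * n)"
proof -
  show "1 \<le> m n" using M w(3)[of "5 * n"] mult_mono[of 1 M 1 "w ^ (5 * n)"] by (simp add: m_def)
  have "w ^ (5 * n * 2) = 1 / (t ^ 5) ^ (2 * n)"
    by (simp add: w_def power_one_over mult_ac flip: power_mult)
  then show "(m n)\<^sup>2 = M\<^sup>2 / (t ^ 5) ^ (2 * n)"
    by (simp add: m_def power_mult_distrib flip: power_mult)
qed

lemma r_small: "r \<le> 1 / 100" "M * r \<le> 1 / 100"
proof -
  show "M * r \<le> 1 / 100" using r by simp
  moreover have "1 * r \<le> M * r" using M r(1) by (intro mult_right_mono) auto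
  ultimately show "r \<le> 1 / 100" by linarith
qed

text \<open>On the ball of radius \<open>r * t ^ (5 n)\<close> the growth of the coefficients is
  cancelled exactly, \<open>m n * t ^ (5 n) = M\<close>, so quadratic terms are relatively as small
  as \<open>M * r\<close>.\<close>

lemma small:
  assumes "norm z \<le> r * (t ^ 5) ^ n"
  shows "m n * norm z \<le> M * r" "norm z \<le> r" "norm z \<le> 1 / 100" "m n * norm z \<le> 1 / 100"
proof -
  have mm: "m n * (t ^ 5) ^ n = M"
    using w(5)[of "5 * n"] by (simp add: m_def power_mult[symmetric] mult.assoc mult.commute[of "w ^ _"])
  have "m n * norm z \<le> m n * (r * (t ^ 5) ^ n)" using assms m(1)[of n] by (intro mult_left_mono) auto
  also have "\<dots> = M * r" using mm by (simp add: mult_ac)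
  finally show "m n * norm z \<le> M * r" .
  then show "m n * norm z \<le> 1 / 100" using r_small by linarith
  have "r * (t ^ 5) ^ n \<le> r * 1" using r t by (intro mult_left_mono power_le_one) auto
  then show "norm z \<le> r" using assms by simp
  then show "norm z \<le> 1 / 100" using r_small by linarith
qed

lemma coefs_le:
  "norm (\<alpha> n) \<le> m n" "norm (\<beta> n) \<le> m n" "norm (\<gamma> n) \<le> m n" "norm (\<nu> n) \<le> m n" "norm (\<mu> n) \<le> m n"
  "norm (\<alpha>' n) \<le> m n" "norm (\<beta>' n) \<le> m n" "norm (\<gamma>' n) \<le> m n" "norm (\<nu>' n) \<le> m n" "norm (\<mu>' n) \<le> m n"
  "norm (\<sigma>' n) \<le> m n" "norm (d n) \<le> m n" "norm (0 :: complex) \<le> m n"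
  using coef[of \<alpha> n] coef[of \<beta> n] coef[of \<gamma> n] coef[of \<nu> n] coef[of \<mu> n] d_le[of n] m(1)[of n]
  by (auto simp: m_def \<alpha>'_def \<beta>'_def \<gamma>'_def \<nu>'_def \<mu>'_def \<sigma>'_def)

lemma H_le: "norm (H n z) \<le> 6 * m n * norm z ^ 2"
  and H_lip: "norm (H n z - H n v) \<le> 6 * m n * (norm z + norm v) * norm (z - v)"
  and H'_lip: "norm (H' n z - H' n v) \<le> 6 * m n * (norm z + norm v) * norm (z - v)"
  and Q'_le: "norm (Q' n z) \<le> 6 * 64 * norm z ^ 2"
  and Q'_lip: "norm (Q' n z - Q' n v) \<le> 6 * 64 * (norm z + norm v) * norm (z - v)"
  unfolding H_def H'_def Q'_def by (intro norm_quad_le quad_lipschitz coefs_le Q)+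

lemma t20: "t ^ 20 \<le> 1" using t by (simp add: power_le_one)

lemma lin_le1: "norm (lin n z) \<le> norm z"
  using lin_le[of n z] mult_right_mono[OF t20, of "norm z"] by simp

lemma F_le1: "norm z < 1 \<Longrightarrow> norm (F n z) \<le> norm z"
  using F_le[of z n] mult_right_mono[OF t20, of "norm z"] by simp

lemma F_lin: "norm z \<le> 1/4 \<Longrightarrow> norm (F n z - lin n z) \<le> 2500 * norm z ^ 2"
proof -
  assume z: "norm z \<le> 1/4"
  have "norm (F n z - lin n z) \<le> norm (F n z - lin n z - Q' n z) + norm (Q' n z)"
    using norm_triangle_ineq[of "F n z - lin n z - Q' n z" "Q' n z"] by simp
  moreover have "norm (F n z - lin n z - Q' n z) \<le> 4096 * norm z ^ 3" unfolding Q'_def by (rule taylor) (use z in simp)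
  moreover have "norm z ^ 3 \<le> 1/4 * norm z ^ 2"
    using mult_right_mono[OF z, of "norm z ^ 2"] by (simp add: power3_eq_cube power2_eq_square)
  moreover have "0 \<le> norm z ^ 2" by simp
  ultimately show ?thesis using Q'_le[of n z] by linarith
qed

lemma g_eq: "g n z = lin n z + vector [0, d n * (z $ 1)\<^sup>2]"
  by (simp add: g_def lin_def vec_eq_iff forall_2)

lemma norm_vector_0: "norm (vector [0, x] :: complex ^ 2) = norm x"
  by (simp add: norm_vec2)

lemma g_lin: "norm (g n z - lin n z) \<le> m n * norm z ^ 2"
proof -
  have "norm (d n * (z $ 1)\<^sup>2) \<le> m n * norm z ^ 2"
    unfolding norm_mult norm_power
    by (intro mult_mono power_mono coefs_le Finite_Cartesian_Product.norm_nth_le) (use m(1)[of n] in auto)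
  then show ?thesis by (simp add: g_eq norm_vector_0)
qed

lemma g_lip: "norm ((g n z - lin n z) - (g n v - lin n v)) \<le> m n * (norm z + norm v) * norm (z - v)"
proof -
  have "(g n z - lin n z) - (g n v - lin n v) = vector [0, d n * ((z $ 1 + v $ 1) * (z $ 1 - v $ 1))]"
    by (simp add: g_eq vec_eq_iff forall_2 power2_eq_square algebra_simps)
  moreover have "norm (d n * ((z $ 1 + v $ 1) * (z $ 1 - v $ 1))) \<le> m n * ((norm z + norm v) * norm (z - v))"
    unfolding norm_mult
  proof (intro mult_mono coefs_le)
    show "norm (z $ 1 + v $ 1) \<le> norm z + norm v"
      using norm_triangle_ineq[of "z $ 1" "v $ 1"] Finite_Cartesian_Product.norm_nth_le[of z 1]
        Finite_Cartesian_Product.norm_nth_le[of v 1] by linarith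
    show "norm (z $ 1 - v $ 1) \<le> norm (z - v)"
      using Finite_Cartesian_Product.norm_nth_le[of "z - v" 1] by simp
  qed (use m(1)[of n] in auto)
  ultimately show ?thesis by (simp add: norm_vector_0 mult.assoc)
qed

text \<open>\<open>t ^ 19\<close> leaves room above the contraction \<open>t ^ 20\<close> for the
  term with \<open>d n\<close>, and \<open>t ^ 45\<close> lies below \<open>C\<close> to leave room
  for nonlinear terms. The decisive comparison is 3 * 19 = 57 \<ge> 56 = 46 + 2 * 5.\<close>

sublocale tc: tame_constants "t ^ 5" r "t ^ 19" "t ^ 45" "t ^ 46"
proof
  show "t ^ 5 \<le> 1" using t by (simp add: power_le_one)
  show "t ^ 19 < t ^ 5" "t ^ 46 < t ^ 45" "t ^ 46 < t ^ 5" using t by (auto intro!: power_strict_decreasing)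
  have "t ^ 57 \<le> t ^ 56" using t by (intro power_decreasing) auto
  then show "(t ^ 19) ^ 3 \<le> t ^ 46 * (t ^ 5)\<^sup>2" by (simp flip: power_mult power_add)
qed (use t r in auto)

section \<open>Tameness and almost conjugacy of the two systems\<close>

definition \<phi> where "\<phi> n z = flip n (F n z)"
definition \<psi> where "\<psi> n z = flip n (g n z)"
definition h where "h n z = z + H n z"
definition k where "k n z = z - H n z"

text \<open>\<open>lin n\<close> stretches by at least \<open>C\<close>, and the remainder has
  Lipschitz constant at most \<open>C - t ^ 45\<close>.\<close>

lemma perturbation_lower_bound:
  assumes "\<And>n z v. norm z \<le> r * (t ^ 5) ^ n \<Longrightarrow> norm v \<le> r * (t ^ 5) ^ n \<Longrightarrow>
      norm ((f n z - lin n z) - (f n v - lin n v)) \<le> 20000 * (M * r) * norm (z - v)"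
    and "norm z \<le> r * (t ^ 5) ^ n" "norm v \<le> r * (t ^ 5) ^ n"
  shows "t ^ 45 * norm (z - v) \<le> norm (flip n (f n z) - flip n (f n v))"
proof -
  have "norm (lin n (z - v)) \<le> norm (f n z - f n v) + norm ((f n z - lin n z) - (f n v - lin n v))"
    using norm_triangle_ineq4[of "f n z - f n v" "(f n z - lin n z) - (f n v - lin n v)"]
    by (simp add: lin_diff algebra_simps)
  moreover have "C * norm (z - v) \<le> norm (lin n (z - v))" by (rule lin_ge)
  moreover have "20000 * (M * r) * norm (z - v) \<le> (C - t ^ 45) * norm (z - v)"
    using r(4) by (intro mult_right_mono) auto
  ultimately have "t ^ 45 * norm (z - v) \<le> norm (f n z - f n v)"
    using assms(1)[OF assms(2,3)] by (simp add: algebra_simps)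
  then show ?thesis by (simp add: flip_props(1) flip: flip_props(3))
qed

lemma tame_\<phi>: "tc.tame \<phi>"
  unfolding tc.tame_def
proof (intro conjI allI impI)
  fix n and z v :: "complex ^ 2"
  have "automorphism (flip n \<circ> F n)" by (intro automorphism_compose aut automorphism_flip)
  then show "automorphism (\<phi> n)" by (simp add: \<phi>_def[abs_def] o_def)
  assume z: "norm z \<le> r * (t ^ 5) ^ n"
  have "norm (F n z) \<le> t ^ 20 * norm z" by (rule F_le) (use small(3)[OF z] in simp)
  also have "\<dots> \<le> t ^ 19 * norm z" using t by (intro mult_right_mono power_decreasing) auto
  finally show "norm (\<phi> n z) \<le> t ^ 19 * norm z" by (simp add: \<phi>_def flip_props)
  assume v: "norm v \<le> r * (t ^ 5) ^ n"
  show "t ^ 45 * norm (z - v) \<le> norm (\<phi> n z - \<phi> n v)"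
    unfolding \<phi>_def
  proof (rule perturbation_lower_bound[OF _ z v])
    fix n and z v :: "complex ^ 2"
    assume z: "norm z \<le> r * (t ^ 5) ^ n" and v: "norm v \<le> r * (t ^ 5) ^ n"
    have "norm ((F n z - lin n z) - (F n v - lin n v)) \<le> 20000 * r * norm (z - v)"
      by (rule lip) (use small[OF z] small[OF v] r_small in auto)
    also have "\<dots> \<le> 20000 * (M * r) * norm (z - v)"
      using M r by (intro mult_right_mono mult_left_mono) auto
    finally show "norm ((F n z - lin n z) - (F n v - lin n v)) \<le> 20000 * (M * r) * norm (z - v)" .
  qed
qed

lemma automorphism_g: "automorphism (g n)"
proof (rule automorphismI(1))
  \<comment> \<open>The inverse of a shear over an invertible diagonal map, written with constant
    factors \<open>inverse (a n)\<close> so that it is visibly polynomial.\<close>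
  define gi :: "complex ^ 2 \<Rightarrow> complex ^ 2" where "gi z = vector [z $ 1 * inverse (a n),
    (z $ 2 - c n * (z $ 1 * inverse (a n)) - d n * (z $ 1 * inverse (a n))\<^sup>2) * inverse (b n)]" for z
  show "holomorphic_map_on (g n) UNIV"
    by (rule holomorphic_map_onI_2) (auto simp: g_def intro!: complex_diff_intros)
  show "holomorphic_map_on gi UNIV"
    by (rule holomorphic_map_onI_2) (auto simp: gi_def intro!: complex_diff_intros)
  show "gi (g n z) = z" "g n (gi z) = z" for z
    using nz[of n] by (simp_all add: gi_def g_def vec_eq_iff forall_2 field_simps)
qed

lemma tame_\<psi>: "tc.tame \<psi>"
  unfolding tc.tame_def
proof (intro conjI allI impI)
  fix n and z v :: "complex ^ 2"
  have "automorphism (flip n \<circ> g n)" by (intro automorphism_compose automorphism_g automorphism_flip)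
  then show "automorphism (\<psi> n)" by (simp add: \<psi>_def[abs_def] o_def)
  assume z: "norm z \<le> r * (t ^ 5) ^ n"
  have "m n * norm z ^ 2 \<le> (t ^ 19 - t ^ 20) * norm z"
    using small(1)[OF z] r(3) mult_right_mono[of "m n * norm z" "t ^ 19 - t ^ 20" "norm z"]
    by (simp add: power2_eq_square mult.assoc)
  moreover have "norm (g n z) \<le> norm (lin n z) + norm (g n z - lin n z)"
    using norm_triangle_ineq[of "lin n z" "g n z - lin n z"] by simp
  ultimately have "norm (g n z) \<le> t ^ 19 * norm z"
    using lin_le[of n z] g_lin[of n z] by (simp add: algebra_simps)
  then show "norm (\<psi> n z) \<le> t ^ 19 * norm z" by (simp add: \<psi>_def flip_props)
  assume v: "norm v \<le> r * (t ^ 5) ^ n"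
  show "t ^ 45 * norm (z - v) \<le> norm (\<psi> n z - \<psi> n v)"
    unfolding \<psi>_def
  proof (rule perturbation_lower_bound[OF _ z v])
    fix n and z v :: "complex ^ 2"
    assume z: "norm z \<le> r * (t ^ 5) ^ n" and v: "norm v \<le> r * (t ^ 5) ^ n"
    have "0 \<le> M * r" using M r by simp
    then have "m n * (norm z + norm v) \<le> 20000 * (M * r)"
      using small(1)[OF z] small(1)[OF v] unfolding distrib_left by linarith
    then have "m n * (norm z + norm v) * norm (z - v) \<le> 20000 * (M * r) * norm (z - v)"
      by (rule mult_right_mono) simp
    then show "norm ((g n z - lin n z) - (g n v - lin n v)) \<le> 20000 * (M * r) * norm (z - v)"
      using g_lip order_trans by blast
  qed
qed

lemma H_small:
  assumes "norm z \<le> r * (t ^ 5) ^ n"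
  shows "norm (H n z) \<le> norm z"
proof -
  have "6 * (m n * norm z) * norm z \<le> 1 * norm z"
    using small(4)[OF assms] by (intro mult_right_mono) auto
  then show ?thesis using H_le[of n z] by (simp add: power2_eq_square mult.assoc)
qed

text \<open>40000 dominates all the constants collected below; the largest sum is 18 + 6912 + 32768
  = 39698.\<close>

lemma error_bound:
  assumes "e \<le> 40000 * (m n)\<^sup>2 * norm z ^ 3"
  shows "e \<le> 40000 * M\<^sup>2 * norm z ^ 3 / (t ^ 5) ^ (2 * n)"
  using assms by (simp add: m(2))

lemma m_square: "m n \<le> (m n)\<^sup>2" "1 \<le> (m n)\<^sup>2"
  using m(1)[of n] by (auto simp: power2_eq_square mult_mono[of 1 "m n" 1 "m n", simplified])

lemma lipschitz_hk:
  assumes z: "norm z \<le> r * (t ^ 5) ^ n" and v: "norm v \<le> r * (t ^ 5) ^ n"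
  shows "norm (h n z - h n v) \<le> 2 * norm (z - v)" "norm (k n z - k n v) \<le> 2 * norm (z - v)"
proof -
  have "6 * (m n * norm z + m n * norm v) * norm (z - v) \<le> 1 * norm (z - v)"
    using small(4)[OF z] small(4)[OF v] by (intro mult_right_mono) auto
  then have 1: "norm (H n z - H n v) \<le> norm (z - v)"
    using H_lip[of n z v] by (simp add: algebra_simps)
  have "h n z - h n v = (z - v) + (H n z - H n v)" "k n z - k n v = (z - v) - (H n z - H n v)"
    by (simp_all add: h_def k_def)
  then show "norm (h n z - h n v) \<le> 2 * norm (z - v)" "norm (k n z - k n v) \<le> 2 * norm (z - v)"
    using 1 norm_triangle_ineq[of "z - v" "H n z - H n v"] norm_triangle_ineq4[of "z - v" "H n z - H n v"]
    by simp_all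
qed

lemma almost_inverse_hk: "tc.almost_inverse k h (40000 * M\<^sup>2)" "tc.almost_inverse h k (40000 * M\<^sup>2)"
proof -
  \<comment> \<open>Both compositions leave the defect \<open>H n z - H n v\<close> up to sign,
    where \<open>v\<close> is \<open>h n z\<close> or \<open>k n z\<close> and lies at distance
    \<open>norm (H n z)\<close> from \<open>z\<close>. A displacement of order two times a Lipschitz
    constant of order one gives order three.\<close>
  have key: "norm (H n z - H n v) \<le> 40000 * M\<^sup>2 * norm z ^ 3 / (t ^ 5) ^ (2 * n)"
    if z: "norm z \<le> r * (t ^ 5) ^ n" and v: "norm (z - v) = norm (H n z)" for n z v
  proof (rule error_bound)
    have "norm v \<le> 2 * norm z"
      using norm_triangle_ineq4[of z "z - v"] v H_small[OF z] by simp
    then have "6 * m n * (norm z + norm v) * norm (z - v) \<le> 6 * m n * (3 * norm z) * (6 * m n * norm z ^ 2)"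
      using v H_le[of n z] m(1)[of n] by (intro mult_mono) auto
    also have "\<dots> = 108 * ((m n)\<^sup>2 * norm z ^ 3)" by (simp add: power2_eq_square power3_eq_cube)
    also have "\<dots> \<le> 40000 * ((m n)\<^sup>2 * norm z ^ 3)" by (intro mult_right_mono) auto
    finally have "6 * m n * (norm z + norm v) * norm (z - v) \<le> 40000 * ((m n)\<^sup>2 * norm z ^ 3)" .
    from order_trans[OF H_lip this]
    show "norm (H n z - H n v) \<le> 40000 * (m n)\<^sup>2 * norm z ^ 3" by (simp only: mult.assoc)
  qed
  show "tc.almost_inverse k h (40000 * M\<^sup>2)"
    unfolding tc.almost_inverse_def
  proof (intro conjI allI impI)
    fix n and z :: "complex ^ 2" assume z: "norm z \<le> r * (t ^ 5) ^ n"
    show "norm (k n (h n z) - z) \<le> 40000 * M\<^sup>2 * norm z ^ 3 / (t ^ 5) ^ (2 * n)"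
      using key[OF z, of "h n z"] by (simp add: h_def k_def)
  qed (rule lipschitz_hk)
  show "tc.almost_inverse h k (40000 * M\<^sup>2)"
    unfolding tc.almost_inverse_def
  proof (intro conjI allI impI)
    fix n and z :: "complex ^ 2" assume z: "norm z \<le> r * (t ^ 5) ^ n"
    show "norm (h n (k n z) - z) \<le> 40000 * M\<^sup>2 * norm z ^ 3 / (t ^ 5) ^ (2 * n)"
      using key[OF z, of "k n z"] by (simp add: h_def k_def norm_minus_commute)
  qed (rule lipschitz_hk)
qed

lemma norm_hk:
  assumes "norm z \<le> r * (t ^ 5) ^ n"
  shows "norm (h n z) \<le> 2 * norm z" "norm (k n z) \<le> 2 * norm z"
  using H_small[OF assms] norm_triangle_ineq[of z "H n z"] norm_triangle_ineq4[of z "H n z"]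
  by (auto simp: h_def k_def)

lemma holomorphic_hk: "holomorphic_map_on (h n) UNIV" "holomorphic_map_on (k n) UNIV"
  by (rule holomorphic_map_onI_2; simp add: h_def k_def H_def quad_def; intro complex_diff_intros; simp)+

text \<open>After the homological equation the defect consists of the Taylor remainder of
  \<open>F n\<close>, the change of \<open>H' n\<close> between \<open>F n z\<close> and
  \<open>lin n z\<close>, and the change of the quadratic part of \<open>g n\<close> between
  \<open>h n z\<close> and \<open>z\<close>; each of them is cubic.\<close>

lemma almost_conj_h: "tc.almost_conj h \<phi> \<psi> (40000 * M\<^sup>2)"
  unfolding tc.almost_conj_def
proof (intro conjI allI impI)
  fix n and z :: "complex ^ 2" assume z: "norm z \<le> r * (t ^ 5) ^ n"
  let ?N = "norm z" and ?m = "m n"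
  have z4: "norm z \<le> 1/4" using small(3)[OF z] by simp
  define R where "R = F n z - lin n z - Q' n z"
  define D where "D = (g n (h n z) - lin n (h n z)) - (g n z - lin n z)"
  have "H' n (F n z) + F n z - g n (h n z) = R + (H' n (F n z) - H' n (lin n z)) - D"
    using homological_equation[of n z] by (simp add: R_def D_def h_def lin_add g_eq algebra_simps)
  moreover have "h (Suc n) (\<phi> n z) - \<psi> n (h n z) = flip n (H' n (F n z) + F n z - g n (h n z))"
    by (simp add: h_def \<phi>_def \<psi>_def H_flip flip_props algebra_simps)
  ultimately have "norm (h (Suc n) (\<phi> n z) - \<psi> n (h n z)) = norm (R + (H' n (F n z) - H' n (lin n z)) - D)"
    by (simp only: flip_props(1))
  also have "\<dots> \<le> norm R + norm (H' n (F n z) - H' n (lin n z)) + norm D"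
    by (intro norm_triangle_le_diff add_right_mono norm_triangle_ineq)
  also have "norm R \<le> 4096 * ?N ^ 3" unfolding R_def Q'_def by (rule taylor) (use z4 in simp)
  also have "norm (H' n (F n z) - H' n (lin n z)) \<le> 30000 * ?m * ?N ^ 3"
  proof -
    have "norm (H' n (F n z) - H' n (lin n z)) \<le> 6 * ?m * (norm (F n z) + norm (lin n z)) * norm (F n z - lin n z)"
      by (rule H'_lip)
    also have "\<dots> \<le> 6 * ?m * (?N + ?N) * (2500 * ?N ^ 2)"
      using F_le1[of z n] lin_le1[of n z] F_lin[OF z4, of n] m(1)[of n] z4 by (intro mult_mono add_mono) auto
    finally show ?thesis by (simp add: power2_eq_square power3_eq_cube mult_ac)
  qed
  also have "norm D \<le> 18 * ?m ^ 2 * ?N ^ 3"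
  proof -
    have "norm D \<le> ?m * (norm (h n z) + norm z) * norm (h n z - z)" unfolding D_def by (rule g_lip)
    also have "\<dots> \<le> ?m * (2 * ?N + ?N) * (6 * ?m * ?N ^ 2)"
      using norm_hk(1)[OF z] H_le[of n z] m(1)[of n] by (intro mult_mono add_mono) (auto simp: h_def)
    finally show ?thesis by (simp add: power2_eq_square power3_eq_cube mult_ac)
  qed
  finally have "norm (h (Suc n) (\<phi> n z) - \<psi> n (h n z)) \<le> 4096 * ?N ^ 3 + 30000 * ?m * ?N ^ 3 + 18 * ?m ^ 2 * ?N ^ 3" by simp
  also have "\<dots> \<le> 4096 * (?m ^ 2 * ?N ^ 3) + 30000 * (?m ^ 2 * ?N ^ 3) + 18 * (?m ^ 2 * ?N ^ 3)"
    using mult_right_mono[OF m_square(1)[of n] zero_le_power[OF norm_ge_zero[of z], of 3]] mult_right_mono[OF m_square(2)[of n] zero_le_power[OF norm_ge_zero[of z], of 3]]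
    unfolding mult.assoc by linarith
  also have "\<dots> \<le> 40000 * ?m ^ 2 * ?N ^ 3" by simp
  finally show "norm (h (Suc n) (\<phi> n z) - \<psi> n (h n z)) \<le> 40000 * M\<^sup>2 * norm z ^ 3 / (t ^ 5) ^ (2 * n)"
    by (rule error_bound)
qed (auto intro: holomorphic_hk norm_hk)

text \<open>In this direction the homological equation leaves the changes of \<open>H' n\<close>
  between \<open>lin n z\<close> and \<open>g n z\<close> and of \<open>Q' n\<close> between
  \<open>z\<close> and \<open>k n z\<close>, besides the remainder at \<open>k n z\<close>.\<close>

lemma almost_conj_k: "tc.almost_conj k \<psi> \<phi> (40000 * M\<^sup>2)"
  unfolding tc.almost_conj_def
proof (intro conjI allI impI)
  fix n and z :: "complex ^ 2" assume z: "norm z \<le> r * (t ^ 5) ^ n"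
  let ?N = "norm z" and ?m = "m n" and ?v = "k n z"
  have z4: "?N \<le> 1/100" using small(3)[OF z] by simp
  have v: "norm ?v \<le> 2 * ?N" "norm (z - ?v) \<le> 6 * ?m * ?N ^ 2"
    using norm_hk(2)[OF z] H_le[of n z] by (auto simp: k_def)
  define R where "R = F n ?v - lin n ?v - Q' n ?v"
  have "g n z - H' n (g n z) - F n ?v = (H' n (lin n z) - H' n (g n z)) + (Q' n z - Q' n ?v) - R"
    using homological_equation[of n z] by (simp add: R_def g_eq k_def lin_diff algebra_simps)
  moreover have "k (Suc n) (\<psi> n z) - \<phi> n ?v = flip n (g n z - H' n (g n z) - F n ?v)"
    by (simp add: k_def \<phi>_def \<psi>_def H_flip flip_props)
  ultimately have "norm (k (Suc n) (\<psi> n z) - \<phi> n ?v) = norm ((H' n (lin n z) - H' n (g n z)) + (Q' n z - Q' n ?v) - R)"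
    by (simp only: flip_props(1))
  also have "\<dots> \<le> norm (H' n (lin n z) - H' n (g n z)) + norm (Q' n z - Q' n ?v) + norm R"
    by (intro norm_triangle_le_diff add_right_mono norm_triangle_ineq)
  also have "norm R \<le> 32768 * ?N ^ 3"
  proof -
    have "norm R \<le> 4096 * norm ?v ^ 3" unfolding R_def Q'_def by (rule taylor) (use z4 v in simp)
    also have "\<dots> \<le> 4096 * (2 * ?N) ^ 3" using v by (intro mult_left_mono power_mono) auto
    finally show ?thesis by (simp add: power_mult_distrib)
  qed
  also have "norm (H' n (lin n z) - H' n (g n z)) \<le> 18 * ?m ^ 2 * ?N ^ 3"
  proof -
    have "(?m * ?N) * ?N \<le> 1 * ?N" by (rule mult_right_mono) (use small(4)[OF z] in auto)
    then have "?m * ?N ^ 2 \<le> ?N" by (simp add: power2_eq_square mult.assoc)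
    then have gz: "norm (g n z) \<le> 2 * ?N"
      using norm_triangle_ineq[of "lin n z" "g n z - lin n z"] lin_le1[of n z] g_lin[of n z] by simp
    have "norm (H' n (lin n z) - H' n (g n z)) \<le> 6 * ?m * (norm (lin n z) + norm (g n z)) * norm (lin n z - g n z)"
      by (rule H'_lip)
    also have "\<dots> \<le> 6 * ?m * (?N + 2 * ?N) * (?m * ?N ^ 2)"
      using gz lin_le1[of n z] g_lin[of n z] m(1)[of n]
      by (intro mult_mono add_mono) (auto simp: norm_minus_commute)
    finally show ?thesis by (simp add: power2_eq_square power3_eq_cube mult_ac)
  qed
  also have "norm (Q' n z - Q' n ?v) \<le> 6912 * ?m * ?N ^ 3"
  proof -
    have "norm (Q' n z - Q' n ?v) \<le> 6 * 64 * (?N + norm ?v) * norm (z - ?v)" by (rule Q'_lip)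
    also have "\<dots> \<le> 6 * 64 * (?N + 2 * ?N) * (6 * ?m * ?N ^ 2)"
      using v m(1)[of n] by (intro mult_mono add_mono) auto
    finally show ?thesis by (simp add: power2_eq_square power3_eq_cube mult_ac)
  qed
  finally have "norm (k (Suc n) (\<psi> n z) - \<phi> n ?v) \<le> 18 * ?m ^ 2 * ?N ^ 3 + 6912 * ?m * ?N ^ 3 + 32768 * ?N ^ 3" by simp
  also have "\<dots> \<le> 18 * (?m ^ 2 * ?N ^ 3) + 6912 * (?m ^ 2 * ?N ^ 3) + 32768 * (?m ^ 2 * ?N ^ 3)"
    using mult_right_mono[OF m_square(1)[of n] zero_le_power[OF norm_ge_zero[of z], of 3]] mult_right_mono[OF m_square(2)[of n] zero_le_power[OF norm_ge_zero[of z], of 3]]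
    unfolding mult.assoc by linarith
  also have "\<dots> \<le> 40000 * ?m ^ 2 * ?N ^ 3" by simp
  finally show "norm (k (Suc n) (\<psi> n z) - \<phi> n (k n z)) \<le> 40000 * M\<^sup>2 * norm z ^ 3 / (t ^ 5) ^ (2 * n)"
    by (rule error_bound)
qed (auto intro: holomorphic_hk norm_hk)

text \<open>Inside a train the first coordinate evolves linearly, so each new term
  \<open>d x^2\<close> is quadratic in the size \<open>R\<close> at the start of the train and never
  squared again. The bound on the first coordinate stops before the last step, which swaps.\<close>

lemma orbit_in_train:
  fixes z :: "complex ^ 2" and i :: nat
  defines "u \<equiv> \<lambda>j. orbit \<psi> (2 ^ i + j) z"
  defines "R \<equiv> norm (u 0)"
  defines "K \<equiv> M / t ^ 20 * w ^ (5 * 2 ^ i) * R\<^sup>2"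
  shows "j \<le> 2 ^ i \<Longrightarrow> norm (u j) \<le> t ^ (20 * j) * (R + K * (\<Sum>l<j. (t ^ 15) ^ l))
    \<and> (j < 2 ^ i \<longrightarrow> norm (u j $ 1) \<le> t ^ (20 * j) * R)"
proof (induction j)
  case 0
  then show ?case by (simp add: R_def Finite_Cartesian_Product.norm_nth_le)
next
  case (Suc j)
  let ?N = "2 ^ i :: nat" and ?S = "\<Sum>l<j. (t ^ 15) ^ l"
  have j: "j < ?N" and IH: "norm (u j) \<le> t ^ (20 * j) * (R + K * ?S)" "norm (u j $ 1) \<le> t ^ (20 * j) * R"
    using Suc by auto
  have uS: "u (Suc j) = flip (?N + j) (g (?N + j) (u j))" by (simp add: u_def \<psi>_def)
  have dx: "norm (d (?N + j) * (u j $ 1)\<^sup>2) \<le> t ^ 20 * t ^ (20 * j) * (K * (t ^ 15) ^ j)"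
  proof -
    have "norm (d (?N + j) * (u j $ 1)\<^sup>2) \<le> (M * w ^ (5 * (?N + j))) * (t ^ (20 * j) * R)\<^sup>2"
      unfolding norm_mult norm_power using M w by (intro mult_mono power_mono d_le IH) (auto simp: less_imp_le)
    also have "\<dots> = M * w ^ (5 * ?N) * R\<^sup>2 * (t ^ (20 * j) * (t ^ (15 * j) * (t ^ (5 * j) * w ^ (5 * j))))"
    proof -
      have "(t ^ (20 * j))\<^sup>2 = t ^ (20 * j) * (t ^ (15 * j) * t ^ (5 * j))"
        by (simp add: power2_eq_square flip: power_add)
      then show ?thesis by (simp add: power_mult_distrib power_add distrib_left mult_ac)
    qed
    also have "\<dots> = t ^ 20 * t ^ (20 * j) * (K * (t ^ 15) ^ j)"
      unfolding w(5) using t by (simp add: K_def power_mult)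
    finally show ?thesis .
  qed
  have "norm (u (Suc j)) \<le> norm (lin (?N + j) (u j)) + norm (d (?N + j) * (u j $ 1)\<^sup>2)"
    unfolding uS flip_props(1) g_eq using norm_triangle_ineq norm_vector_0 by metis
  also have "\<dots> \<le> t ^ 20 * (t ^ (20 * j) * (R + K * ?S)) + t ^ 20 * t ^ (20 * j) * (K * (t ^ 15) ^ j)"
  proof (rule add_mono[OF _ dx])
    show "norm (lin (?N + j) (u j)) \<le> t ^ 20 * (t ^ (20 * j) * (R + K * ?S))"
      by (rule order_trans[OF lin_le mult_left_mono[OF IH(1)]]) (use t in simp)
  qed
  also have "\<dots> = t ^ (20 * Suc j) * (R + K * (\<Sum>l<Suc j. (t ^ 15) ^ l))"
    by (simp add: power_add algebra_simps)
  finally have 1: "norm (u (Suc j)) \<le> t ^ (20 * Suc j) * (R + K * (\<Sum>l<Suc j. (t ^ 15) ^ l))" .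
  have 2: "norm (u (Suc j) $ 1) \<le> t ^ (20 * Suc j) * R" if "Suc j < ?N"
  proof -
    have "\<not> train_end (?N + j)" using train_end_iff[of i "?N + j"] that j by simp
    then have "norm (u (Suc j) $ 1) = norm (a (?N + j)) * norm (u j $ 1)"
      by (simp add: uS flip_def g_def norm_mult)
    also have "\<dots> \<le> t ^ 20 * (t ^ (20 * j) * R)"
      using t by (intro mult_mono a IH) auto
    finally show ?thesis by (simp add: power_add)
  qed
  show ?case using 1 2 by blast
qed

text \<open>Sampling at times \<open>2 ^ k\<close> gives the recursion of
  \<open>eventually_below_exponential\<close>; its exponent 15 = 20 - 5 is the contraction over a
  train diminished by the growth of the coefficients \<open>d\<close>.\<close>

lemma fast_basin_\<psi>: "tc.fast_basin \<psi> = UNIV"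
proof (rule set_eqI)
  fix z
  define R where "R k = norm (orbit \<psi> (2 ^ k) z)" for k
  define K where "K = M / t ^ 20 * (1 / (1 - t ^ 15))"
  have t15: "0 < t ^ 15" "t ^ 15 < 1" using t power_strict_decreasing[of 0 15 t] by auto
  have "\<exists>k. R k < r * t ^ (5 * 2 ^ k)"
  proof (rule eventually_below_exponential[OF t r(1)])
    show "0 \<le> K" using M t t15 by (simp add: K_def)
    fix k
    let ?n = "2 ^ k :: nat"
    have "R (Suc k) \<le> t ^ (20 * ?n) * (R k + M / t ^ 20 * w ^ (5 * ?n) * (R k)\<^sup>2 * (\<Sum>l<?n. (t ^ 15) ^ l))"
      using orbit_in_train[of ?n k z] by (simp add: R_def mult_2)
    also have "\<dots> \<le> t ^ (20 * ?n) * (R k + M / t ^ 20 * w ^ (5 * ?n) * (R k)\<^sup>2 * (1 / (1 - t ^ 15)))"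
    proof (intro mult_left_mono add_left_mono)
      show "(\<Sum>l<?n. (t ^ 15) ^ l) \<le> 1 / (1 - t ^ 15)"
        using t15 sum_le_suminf[OF summable_geometric[of "t ^ 15"], of "{..<?n}"] suminf_geometric[of "t ^ 15"] by auto
    qed (use M t w in \<open>auto simp: less_imp_le\<close>)
    also have "\<dots> = t ^ (20 * ?n) * R k + K * (t ^ (20 * ?n) * w ^ (5 * ?n)) * (R k)\<^sup>2"
      by (simp add: K_def algebra_simps)
    also have "t ^ (20 * ?n) * w ^ (5 * ?n) = t ^ (15 * ?n)"
    proof -
      have "t ^ (20 * ?n) = t ^ (15 * ?n) * t ^ (5 * ?n)" by (simp flip: power_add)
      then show ?thesis by (simp only: mult.assoc w(5) mult_1_right)
    qed
    finally show "R (Suc k) \<le> t ^ (20 * 2 ^ k) * R k + K * t ^ (15 * 2 ^ k) * (R k)\<^sup>2" .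
  qed (simp add: R_def)
  then show "z \<in> tc.fast_basin \<psi> \<longleftrightarrow> z \<in> UNIV"
    unfolding tc.fast_basin_def R_def by (auto simp: power_mult[symmetric])
qed

lemma biholomorphic_fast_basin_\<phi>: "biholomorphic (tc.fast_basin \<phi>) (UNIV :: (complex ^ 2) set)"
  by (rule tc.biholomorphic_fast_basin[OF tame_\<phi> tame_\<psi> _ almost_conj_h almost_conj_k
        almost_inverse_hk fast_basin_\<psi>]) simp

end

context triangular_system
begin

lemma basin_biholomorphic:
  "\<exists>r>0. r \<le> 1/100 \<and> biholomorphic
    {z. \<exists>n. norm (orbit (\<lambda>n z. flip n (F n z)) n z) < r * (t ^ 5) ^ n} (UNIV :: (complex ^ 2) set)"
proof -
  obtain \<alpha> \<beta> \<gamma> \<nu> \<mu> d M where M: "1 \<le> M" and eqs: "\<And>n.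
    normal_form_equations \<alpha> \<beta> \<gamma> \<nu> \<mu> d n \<and>
    (\<forall>\<xi>\<in>{\<alpha>, \<beta>, \<gamma>, \<nu>, \<mu>}. norm (\<xi> n) \<le> M * w ^ (5 * n) \<and> norm (\<xi> (Suc n)) \<le> M * w ^ (5 * n)) \<and>
    norm (d n) \<le> M * w ^ (5 * n)"
    using normal_form_coefficients by blast
  have t45: "t ^ 45 < C" 
  proof -
    have "t ^ 45 < t ^ 44" using t by (intro power_strict_decreasing) auto
    with C show ?thesis by linarith
  qed
  have t19: "t ^ 20 < t ^ 19" using t by (intro power_strict_decreasing) auto
  \<comment> \<open>Only \<open>M * r\<close> matters, hence the division by \<open>M\<close>. The
    terms of the minimum make in turn \<open>H n\<close> a small perturbation, the contraction of
    \<open>g n\<close> as good as \<open>t ^ 19\<close>, and the lower Lipschitz bound at least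
    \<open>t ^ 45\<close>.\<close>
  define r where "r = min (1 / 100) (min (t ^ 19 - t ^ 20) ((C - t ^ 45) / 20000)) / M"
  have Mr: "M * r = min (1 / 100) (min (t ^ 19 - t ^ 20) ((C - t ^ 45) / 20000))"
    using M by (simp add: r_def)
  have r: "0 < r" "100 * M * r \<le> 1" "M * r \<le> t ^ 19 - t ^ 20" "20000 * (M * r) \<le> C - t ^ 45"
  proof -
    show "0 < r" using M t45 t19 by (simp add: r_def)
    have "M * r \<le> 1 / 100" using Mr by linarith
    then show "100 * M * r \<le> 1" by (simp add: mult.assoc)
    show "M * r \<le> t ^ 19 - t ^ 20" unfolding Mr by simp
    have "M * r \<le> (C - t ^ 45) / 20000" unfolding Mr by (intro min.coboundedI2 order_refl)
    then have "(M * r) * 20000 \<le> C - t ^ 45" by (simp only: pos_le_divide_eq zero_less_numeral)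
    then show "20000 * (M * r) \<le> C - t ^ 45" by (simp only: mult.commute)
  qed
  interpret nf: normal_form t C a b c q1 q2 q3 q4 q5 q6 F lin \<alpha> \<beta> \<gamma> \<nu> \<mu> d
    "\<lambda>n. if train_end n then 0 else \<alpha> (Suc n)" "\<lambda>n. (if train_end n then \<mu> else \<beta>) (Suc n)"
    "\<lambda>n. (if train_end n then \<nu> else \<gamma>) (Suc n)" "\<lambda>n. (if train_end n then \<gamma> else \<nu>) (Suc n)"
    "\<lambda>n. (if train_end n then \<beta> else \<mu>) (Suc n)" "\<lambda>n. if train_end n then \<alpha> (Suc n) else 0" M r
    using M eqs r unfolding lin_def normal_form_equations_def Let_def by unfold_locales blast+
  have "nf.\<phi> = (\<lambda>n z. flip n (F n z))" by (simp add: nf.\<phi>_def fun_eq_iff)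
  then have "biholomorphic {z. \<exists>n. norm (orbit (\<lambda>n z. flip n (F n z)) n z) < r * (t ^ 5) ^ n}
      (UNIV :: (complex ^ 2) set)"
    using nf.biholomorphic_fast_basin_\<phi> by (simp add: nf.tc.fast_basin_def)
  with r(1) nf.r_small(1) show ?thesis by blast
qed

end

section \<open>Triangularization by unitary frames\<close>

text \<open>A unitary coordinate change whose second basis vector is the unit vector \<open>v\<close>.\<close>

definition frame :: "complex ^ 2 \<Rightarrow> complex ^ 2 \<Rightarrow> complex ^ 2"
  where "frame v z = vector [z $ 1 * cnj (v $ 2) + z $ 2 * v $ 1, z $ 2 * v $ 2 - z $ 1 * cnj (v $ 1)]"

definition frame_inv :: "complex ^ 2 \<Rightarrow> complex ^ 2 \<Rightarrow> complex ^ 2"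
  where "frame_inv v z = vector [z $ 1 * v $ 2 - z $ 2 * v $ 1, z $ 1 * cnj (v $ 1) + z $ 2 * cnj (v $ 2)]"

lemma frame_norm:
  assumes "norm v = 1"
  shows "norm (frame v z) = norm z"
proof -
  have v: "(Re (v $ 1))\<^sup>2 + (Im (v $ 1))\<^sup>2 + ((Re (v $ 2))\<^sup>2 + (Im (v $ 2))\<^sup>2) = 1"
    using assms by (simp add: norm_vec2 cmod_power2)
  have "(norm (frame v z $ 1))\<^sup>2 + (norm (frame v z $ 2))\<^sup>2 =
      ((Re (v $ 1))\<^sup>2 + (Im (v $ 1))\<^sup>2 + ((Re (v $ 2))\<^sup>2 + (Im (v $ 2))\<^sup>2)) * ((norm (z $ 1))\<^sup>2 + (norm (z $ 2))\<^sup>2)"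
    unfolding cmod_power2 frame_def by (simp add: power2_eq_square algebra_simps)
  then have "(norm (frame v z $ 1))\<^sup>2 + (norm (frame v z $ 2))\<^sup>2 = (norm (z $ 1))\<^sup>2 + (norm (z $ 2))\<^sup>2"
    by (simp only: v mult_1_left)
  then show ?thesis by (simp only: norm_vec2[of "frame v z"] norm_vec2[of z])
qed

lemma frame_inverse:
  assumes "norm v = 1"
  shows "frame v (frame_inv v z) = z" "frame_inv v (frame v z) = z"
proof -
  have "(norm (v $ 1))\<^sup>2 + (norm (v $ 2))\<^sup>2 = 1" using assms by (simp add: norm_vec2)
  then have "complex_of_real ((norm (v $ 1))\<^sup>2 + (norm (v $ 2))\<^sup>2) = 1" by simp
  then have v: "v $ 1 * cnj (v $ 1) + v $ 2 * cnj (v $ 2) = 1"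
    by (simp only: of_real_add complex_norm_square)
  have "frame v (frame_inv v z) = (v $ 1 * cnj (v $ 1) + v $ 2 * cnj (v $ 2)) *s z"
    "frame_inv v (frame v z) = (v $ 1 * cnj (v $ 1) + v $ 2 * cnj (v $ 2)) *s z"
    by (simp_all add: frame_def frame_inv_def vec_eq_iff forall_2 algebra_simps)
  then show "frame v (frame_inv v z) = z" "frame_inv v (frame v z) = z" by (simp_all add: v)
qed

lemma frame_inv_norm: "norm v = 1 \<Longrightarrow> norm (frame_inv v z) = norm z"
  using frame_norm[of v "frame_inv v z"] frame_inverse(1)[of v z] by simp

lemma holomorphic_frame: "holomorphic_map_on (frame v) UNIV" "holomorphic_map_on (frame_inv v) UNIV"
  by (rule holomorphic_map_onI_2; simp add: frame_def frame_inv_def; intro complex_diff_intros)+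

lemma automorphism_frame:
  assumes "norm v = 1"
  shows "automorphism (frame v)" "automorphism (frame_inv v)"
  by (rule automorphismI(1)[of _ "frame_inv v"] automorphismI(1)[of _ "frame v"];
      simp add: holomorphic_frame frame_inverse[OF assms])+

lemma frame_inv_scaleC: "frame_inv v (k *s z) = k *s frame_inv v z"
  by (simp add: frame_inv_def vec_eq_iff forall_2 algebra_simps)

lemma frame_scaleC: "frame v (k *s z) = k *s frame v z"
  by (simp add: frame_def vec_eq_iff forall_2 algebra_simps)

lemma bounded_linear_frame: "bounded_linear (frame v)" "bounded_linear (frame_inv v)"
  unfolding linear_conv_bounded_linear[symmetric]
  by (auto intro!: linearI simp: frame_def frame_inv_def vec_eq_iff forall_2 scaleR_conv_of_real[where 'a = complex] algebra_simps)

lemma bounded_linear_flip: "bounded_linear (flip n)"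
  unfolding linear_conv_bounded_linear[symmetric]
  by (auto intro!: linearI simp: flip_def swap_vec_def vec_eq_iff forall_2)

lemma frame_inv_self:
  assumes "norm v = 1"
  shows "frame_inv v v = vector [0, 1]"
proof -
  have "frame v (vector [0, 1]) = v" by (simp add: frame_def vec_eq_iff forall_2)
  then show ?thesis using frame_inverse(2)[OF assms, of "vector [0, 1]"] by simp
qed

abbreviation "axis2 \<equiv> vector [0, 1] :: complex ^ 2"

text \<open>A QR decomposition along the derivatives: in the new frame the second axis is the image
  direction of the old second axis, so each derivative becomes lower triangular. At the end of a
  train \<open>flip\<close> makes the orthogonal direction the second axis of the next
  train.\<close>

primrec frames :: "(nat \<Rightarrow> complex ^ 2 \<Rightarrow> complex ^ 2) \<Rightarrow> nat \<Rightarrow> complex ^ 2 \<Rightarrow> complex ^ 2"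
  where
    "frames A 0 = (\<lambda>z. z)"
  | "frames A (Suc n) = (\<lambda>z. frame (sgn (A n (frames A n axis2))) (flip n z))"

definition next_axis :: "(nat \<Rightarrow> complex ^ 2 \<Rightarrow> complex ^ 2) \<Rightarrow> nat \<Rightarrow> complex ^ 2"
  where "next_axis A n = sgn (A n (frames A n axis2))"

primrec frames_inv :: "(nat \<Rightarrow> complex ^ 2 \<Rightarrow> complex ^ 2) \<Rightarrow> nat \<Rightarrow> complex ^ 2 \<Rightarrow> complex ^ 2"
  where
    "frames_inv A 0 = (\<lambda>z. z)"
  | "frames_inv A (Suc n) = (\<lambda>z. flip n (frame_inv (next_axis A n) z))"

lemma norm_scale_sgn: "of_real (norm x) *s sgn x = x" for x :: "complex ^ 2"
  by (cases "x = 0") (simp_all add: vec_eq_iff sgn_div_norm scaleR_conv_of_real[where 'a = complex])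

lemma iterated_comp_eq: "iterated_comp f n z = orbit f (Suc n) z"
  by (induction n) auto

text \<open>Once in the unit ball, an orbit shrinks like \<open>t ^ (20 n)\<close>, faster than the
  balls, so every attracted point is caught by some ball of radius
  \<open>r * (t ^ 5) ^ n\<close>.\<close>

lemma basin_eq:
  fixes f :: "nat \<Rightarrow> complex ^ 2 \<Rightarrow> complex ^ 2"
  assumes t: "0 < t" "t < 1" and r: "0 < r" "r \<le> 1"
    and f: "\<And>n z. norm z < 1 \<Longrightarrow> norm (f n z) \<le> t ^ 20 * norm z"
  shows "basin_of_attraction f = {z. \<exists>n. norm (orbit f n z) < r * (t ^ 5) ^ n}"
proof -
  have t20: "0 < t ^ 20" "t ^ 20 < 1" using t power_strict_decreasing[of 0 20 t] by auto
  have decay: "norm (orbit f (n + k) z) \<le> (t ^ 20) ^ k \<and> norm (orbit f (n + k) z) < 1"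
    if "norm (orbit f n z) < 1" for n k z
  proof (induction k)
    case (Suc k)
    let ?z = "orbit f (n + k) z"
    have "norm (f (n + k) ?z) \<le> t ^ 20 * norm ?z" using f Suc by blast
    also have "\<dots> \<le> t ^ 20 * (t ^ 20) ^ k" using Suc t20 by (intro mult_left_mono) auto
    finally have 1: "norm (f (n + k) ?z) \<le> (t ^ 20) ^ Suc k" by simp
    have "(t ^ 20) ^ Suc k < 1" using t20 by (intro power_Suc_less_one) auto
    with 1 show ?case by simp
  qed (use that in auto)
  have "(\<lambda>n. iterated_comp f n z) \<longlonglongrightarrow> 0 \<longleftrightarrow> (\<exists>n. norm (orbit f n z) < r * (t ^ 5) ^ n)" for z
  proof
    assume "(\<lambda>n. iterated_comp f n z) \<longlonglongrightarrow> 0"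
    then have "(\<lambda>n. norm (orbit f (Suc n) z)) \<longlonglongrightarrow> 0"
      by (simp only: iterated_comp_eq tendsto_norm_zero_iff)
    then have "\<forall>\<^sub>F n in sequentially. norm (orbit f (Suc n) z) < 1"
      by (rule order_tendstoD) simp
    then obtain n where "norm (orbit f (Suc n) z) < 1" by (auto simp: eventually_sequentially)
    then obtain m where m: "norm (orbit f m z) < 1" by blast
    have "0 < r * t ^ (5 * m)" using r t by simp
    moreover have "t ^ 15 < 1" using t power_strict_decreasing[of 0 15 t] by auto
    \<comment> \<open>The contraction gains on the radius by a factor t^20 / t^5 = t^15 per
      step.\<close>
    ultimately obtain k where k: "(t ^ 15) ^ k < r * t ^ (5 * m)" using real_arch_pow_inv by blast
    have "(t ^ 20) ^ k = (t ^ 15) ^ k * t ^ (5 * k)" by (simp flip: power_mult power_add)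
    also have "\<dots> < r * t ^ (5 * m) * t ^ (5 * k)" using k t by (intro mult_strict_right_mono) auto
    also have "\<dots> = r * (t ^ 5) ^ (m + k)" by (simp add: power_add flip: power_mult)
    finally have "norm (orbit f (m + k) z) < r * (t ^ 5) ^ (m + k)" using decay[OF m, of k] by linarith
    then show "\<exists>n. norm (orbit f n z) < r * (t ^ 5) ^ n" by blast
  next
    assume "\<exists>n. norm (orbit f n z) < r * (t ^ 5) ^ n"
    then obtain n where n: "norm (orbit f n z) < r * (t ^ 5) ^ n" by blast
    have "r * (t ^ 5) ^ n \<le> 1 * 1" using r t by (intro mult_mono power_le_one) auto
    with n have n1: "norm (orbit f n z) < 1" by linarith
    have lim: "(\<lambda>k. (t ^ 20) ^ k) \<longlonglongrightarrow> 0" using t20 by (intro LIMSEQ_realpow_zero) auto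
    have "(\<lambda>k. orbit f (n + k) z) \<longlonglongrightarrow> 0"
      by (rule Lim_null_comparison[OF _ lim]) (use decay[OF n1] in auto)
    then have "(\<lambda>k. orbit f k z) \<longlonglongrightarrow> 0"
      using LIMSEQ_offset[of "\<lambda>k. orbit f k z" n] by (simp add: add.commute[of n])
    from LIMSEQ_Suc[OF this] show "(\<lambda>n. iterated_comp f n z) \<longlonglongrightarrow> 0"
      by (simp only: iterated_comp_eq)
  qed
  then show ?thesis by (auto simp: basin_of_attraction_def)
qed

text \<open>Bundles all estimates for a single map, so that the nine coefficient sequences can be
  chosen simultaneously.\<close>

definition triangular_jet :: "real \<Rightarrow> real \<Rightarrow> (complex ^ 2 \<Rightarrow> complex ^ 2) \<Rightarrow> complex \<Rightarrow> complex \<Rightarrow> complex \<Rightarrow>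
    complex \<Rightarrow> complex \<Rightarrow> complex \<Rightarrow> complex \<Rightarrow> complex \<Rightarrow> complex \<Rightarrow> bool"
  where "triangular_jet C D f a b c q1 q2 q3 q4 q5 q6 \<longleftrightarrow> C \<le> norm a \<and> norm a \<le> D \<and> C \<le> norm b \<and> norm b \<le> D \<and> norm c \<le> D \<and>
    norm q1 \<le> 64 \<and> norm q2 \<le> 64 \<and> norm q3 \<le> 64 \<and> norm q4 \<le> 64 \<and> norm q5 \<le> 64 \<and> norm q6 \<le> 64 \<and>
    (\<forall>z :: complex ^ 2. C * norm z \<le> norm (vector [a * z $ 1, b * z $ 2 + c * z $ 1] :: complex ^ 2)) \<and>
    (\<forall>z :: complex ^ 2. norm (vector [a * z $ 1, b * z $ 2 + c * z $ 1] :: complex ^ 2) \<le> D * norm z) \<and>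
    (\<forall>z. norm z < 1/2 \<longrightarrow>
      norm (f z - vector [a * z $ 1, b * z $ 2 + c * z $ 1] - quad q1 q2 q3 q4 q5 q6 z) \<le> 4096 * norm z ^ 3) \<and>
    (\<forall>\<rho> z w. \<rho> \<le> 1/4 \<longrightarrow> norm z \<le> \<rho> \<longrightarrow> norm w \<le> \<rho> \<longrightarrow>
      norm ((f z - vector [a * z $ 1, b * z $ 2 + c * z $ 1]) - (f w - vector [a * w $ 1, b * w $ 2 + c * w $ 1]))
        \<le> 20000 * \<rho> * norm (z - w))"

lemma triangular_taylor:
  fixes f L :: "complex ^ 2 \<Rightarrow> complex ^ 2"
  assumes aut: "automorphism f" and C: "0 < C" and D: "D < 1"
    and bd: "\<And>z. norm z < 1 \<Longrightarrow> C * norm z \<le> norm (f z) \<and> norm (f z) \<le> D * norm z"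
    and L: "(f has_derivative L) (at 0)" "\<And>k v. L (k *s v) = k *s L v"
    and triangular: "L axis2 $ 1 = 0"
  shows "\<exists>a b c q1 q2 q3 q4 q5 q6. triangular_jet C D f a b c q1 q2 q3 q4 q5 q6"
proof -
  have hol: "holomorphic_map_on f UNIV" using aut automorphismD by blast
  have f0: "f 0 = 0" using bd[of 0] by simp
  have lin: "L (u + v) = L u + L v" for u v
    using L(1) has_derivative_linear linear_add by blast
  note Lb = derivative_norm_bounds[OF L(1) f0 bd]
  define a where "a = L (vector [1, 0]) $ 1"
  define b where "b = L axis2 $ 2"
  define c where "c = L (vector [1, 0]) $ 2"
  have Lz: "L z = vector [a * z $ 1, b * z $ 2 + c * z $ 1]" for z
  proof -
    have "L z = z $ 1 *s L (vector [1, 0]) + z $ 2 *s L axis2"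
      using arg_cong[OF vec2_decomp[of z], of L] by (simp only: lin L(2))
    then show ?thesis using triangular by (simp add: a_def b_def c_def vec_eq_iff forall_2 algebra_simps)
  qed
  have n1: "norm (vector [1, 0] :: complex ^ 2) = 1" "norm axis2 = 1" by (simp_all add: norm_vec2)
  have b_norm: "norm (L axis2) = norm b" using triangular by (simp add: norm_vec2 b_def)
  have b: "C \<le> norm b" "norm b \<le> D" using Lb[of axis2] n1 b_norm by auto
  have "norm (L (vector [1, 0])) \<le> D" using Lb(2)[of "vector [1, 0]"] n1 by simp
  then have a: "norm a \<le> D" and c: "norm c \<le> D"
    using Finite_Cartesian_Product.norm_nth_le[of "L (vector [1, 0])"] unfolding a_def c_def
    by (meson order_trans)+
  have a': "C \<le> norm a"
  proof -
    \<comment> \<open>The preimage of \<open>(a, 0)\<close>: its first coordinate is 1, so its norm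
      is at least 1 and the lower bound for \<open>L\<close> passes to \<open>a\<close>.\<close>
    let ?v = "vector [1, - c / b] :: complex ^ 2"
    have "b \<noteq> 0" using b C by auto
    then have "L ?v = vector [a, 0]" by (simp add: Lz)
    then have "norm (L ?v) = norm a" by (simp add: norm_vec2)
    moreover have "1 \<le> norm ?v" using Finite_Cartesian_Product.norm_nth_le[of ?v 1] by simp
    then have "C * 1 \<le> C * norm ?v" using C by (intro mult_left_mono) auto
    ultimately show ?thesis using Lb(1)[of ?v] by simp
  qed
  have le1: "norm (f z) \<le> 1" if "norm z < 1" for z
  proof -
    have "D * norm z \<le> 1 * 1" using that D b(2) C b(1) by (intro mult_mono) auto
    then show ?thesis using bd[OF that] by simp
  qed
  obtain q1 q2 q3 q4 q5 q6 where q: "norm q1 \<le> 64" "norm q2 \<le> 64" "norm q3 \<le> 64"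
    "norm q4 \<le> 64" "norm q5 \<le> 64" "norm q6 \<le> 64"
    and tay: "\<And>z. norm z < 1/2 \<Longrightarrow> norm (f z - L z - quad q1 q2 q3 q4 q5 q6 z) \<le> 4096 * norm z ^ 3"
    using holomorphic_map_taylor[OF hol le1 f0 L] by blast
  have rem: "norm (f z - L z) \<le> 2500 * norm z ^ 2" if z: "norm z < 1/2" for z
  proof -
    have "norm (f z - L z) \<le> norm (f z - L z - quad q1 q2 q3 q4 q5 q6 z) + norm (quad q1 q2 q3 q4 q5 q6 z)"
      using norm_triangle_ineq[of "f z - L z - quad q1 q2 q3 q4 q5 q6 z" "quad q1 q2 q3 q4 q5 q6 z"] by simp
    moreover have "norm z ^ 3 \<le> 1/2 * norm z ^ 2"
      using z mult_right_mono[of "norm z" "1/2" "norm z ^ 2"] by (simp add: power3_eq_cube power2_eq_square)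
    moreover have "0 \<le> norm z ^ 2" by simp
    ultimately show ?thesis using tay[OF z] norm_quad_le[OF q, of z] by linarith
  qed
  have lips: "norm ((f z - L z) - (f w - L w)) \<le> 20000 * \<rho> * norm (z - w)"
    if "\<rho> \<le> 1/4" "norm z \<le> \<rho>" "norm w \<le> \<rho>" for \<rho> z w
    using holomorphic_map_lipschitz_remainder[OF hol L rem that] .
  have "triangular_jet C D f a b c q1 q2 q3 q4 q5 q6"
    unfolding triangular_jet_def
    unfolding Lz[symmetric] using a' a b c q Lb tay lips by blast
  then show ?thesis by blast
qed

theorem theorem4:
  fixes f :: "nat \<Rightarrow> complex ^ 2 \<Rightarrow> complex ^ 2" and C D :: real
  assumes "\<And>n. automorphism (f n)"
    and "uniformly_attracting_with C D f"
    and "D powr (11 / 5) < C"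
  shows "biholomorphic (basin_of_attraction f) (UNIV :: (complex ^ 2) set)"
proof -
  have CD: "D < 1" "C < D" "0 < C" and
    bd: "\<And>n z. norm z < 1 \<Longrightarrow> C * norm z \<le> norm (f n z) \<and> norm (f n z) \<le> D * norm z"
    using assms(2) by (auto simp: uniformly_attracting_with_def)
  then have D0: "0 < D" by linarith
  define t where "t = D powr (1 / 20)"
  have t: "0 < t" "t < 1" using CD D0 powr_less_mono2[of "1 / 20" D 1] by (auto simp: t_def)
  have tn: "t ^ n = D powr (real n / 20)" for n
    using t by (simp add: powr_realpow[symmetric] powr_powr t_def)
  have t20: "t ^ 20 = D" using tn[of 20] D0 by simp
  have t44: "t ^ 44 < C" using tn[of 44] assms(3) by simp
  have hol: "holomorphic_map_on (f n) UNIV" for n using assms(1) automorphismD by blast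
  have f0: "f n 0 = 0" for n using bd[of 0 n] by simp
  have "\<forall>n. \<exists>g. (f n has_derivative g) (at 0) \<and> (\<forall>k v. g (k *s v) = k *s g v)"
    using hol unfolding holomorphic_map_on_def by blast
  from choice[OF this] obtain A where A: "\<And>n. (f n has_derivative A n) (at 0)" "\<And>n k v. A n (k *s v) = k *s A n v"
    by blast
  note Ab = derivative_norm_bounds[OF A(1) f0 bd]
  have n2: "norm axis2 = 1" by (simp add: norm_vec2)
  define U where "U = frames A"
  define V where "V = frames_inv A"
  define v where "v = next_axis A"
  have U: "U 0 = (\<lambda>z. z)" "U (Suc n) = (\<lambda>z. frame (v n) (flip n z))" for n
    by (simp_all add: U_def v_def next_axis_def)
  have V: "V 0 = (\<lambda>z. z)" "V (Suc n) = (\<lambda>z. flip n (frame_inv (v n) z))" for n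
    by (simp_all add: V_def v_def)
  have A_ne: "A n z \<noteq> 0" if "norm z = 1" for n z
    using Ab(1)[of z n] that CD by auto
  have frames: "norm (v n) = 1 \<and> (\<forall>z. norm (U n z) = norm z) \<and> (\<forall>k z. U n (k *s z) = k *s U n z) \<and>
      bounded_linear (U n) \<and> automorphism (U n) \<and> (\<forall>z. U n (V n z) = z) \<and> (\<forall>z. norm (V n z) = norm z)" for n
  proof (induction n)
    case 0
    have "v 0 = sgn (A 0 axis2)" by (simp add: v_def next_axis_def)
    then show ?case using A_ne[OF n2, of 0] by (simp add: U V norm_sgn automorphism_id bounded_linear_ident)
  next
    case (Suc n)
    then have vn: "norm (v n) = 1" by blast
    have nU: "norm (U (Suc n) z) = norm z" for z by (simp add: U frame_norm[OF vn] flip_props)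
    have "v (Suc n) = sgn (A (Suc n) (U (Suc n) axis2))" by (simp add: v_def next_axis_def U_def)
    then have "norm (v (Suc n)) = 1" using A_ne[of "U (Suc n) axis2" "Suc n"] nU[of axis2] n2
      by (simp add: norm_sgn)
    moreover have "automorphism (U (Suc n))"
      using automorphism_compose[OF automorphism_flip automorphism_frame(1)[OF vn], of n] by (simp add: U o_def)
    moreover have "bounded_linear (U (Suc n))"
      using bounded_linear_compose[OF bounded_linear_frame(1) bounded_linear_flip] by (simp add: U)
    moreover have "U (Suc n) (k *s z) = k *s U (Suc n) z" for k z by (simp add: U flip_props frame_scaleC)
    moreover have "U (Suc n) (V (Suc n) z) = z" for z by (simp add: U V flip_props frame_inverse[OF vn])
    moreover have "norm (V (Suc n) z) = norm z" for z by (simp add: V flip_props frame_inv_norm[OF vn])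
    ultimately show ?case using nU by blast
  qed
  have vn: "norm (v n) = 1" and Un: "norm (U n z) = norm z" and Us: "U n (k *s z) = k *s U n z"
    and Ul: "bounded_linear (U n)" and Ua: "automorphism (U n)" and UV: "U n (V n z) = z"
    and Vn: "norm (V n z) = norm z" for n k z using frames by blast+
  have U0: "U n 0 = 0" for n using Ul bounded_linear.linear linear_0 by blast
  \<comment> \<open>\<open>f n\<close> read in the frame \<open>U n\<close> at the source and the
    frame of \<open>v n\<close> at the target; the swap is left out here and enters through
    \<open>flip n\<close> and \<open>U (Suc n)\<close>.\<close>
  define F where "F n z = frame_inv (v n) (f n (U n z))" for n z
  define L where "L n z = frame_inv (v n) (A n (U n z))" for n z
  have autF: "automorphism (F n)" for n
  proof -
    have "automorphism (frame_inv (v n) \<circ> (f n \<circ> U n))"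
      by (intro automorphism_compose automorphism_frame vn Ua assms(1))
    then show ?thesis by (simp add: F_def[abs_def] o_def)
  qed
  have bdF: "C * norm z \<le> norm (F n z) \<and> norm (F n z) \<le> D * norm z" if "norm z < 1" for n z
    using bd[of "U n z" n] that by (simp add: F_def frame_inv_norm[OF vn] Un)
  have L: "(F n has_derivative L n) (at 0)" "L n (k *s z) = k *s L n z" for n k z
  proof -
    have "(U n has_derivative U n) (at 0)" by (rule bounded_linear_imp_has_derivative[OF Ul])
    then have "((\<lambda>z. f n (U n z)) has_derivative (\<lambda>z. A n (U n z))) (at 0)"
      by (rule has_derivative_compose) (simp add: A U0)
    from bounded_linear.has_derivative[OF bounded_linear_frame(2) this, of "v n"]
    show "(F n has_derivative L n) (at 0)" by (simp add: F_def[abs_def] L_def[abs_def])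
    show "L n (k *s z) = k *s L n z" by (simp add: L_def Us A frame_inv_scaleC)
  qed
  \<comment> \<open>\<open>v n\<close> is the normalized image of the second axis, and its own frame
    sends it back to the second axis.\<close>
  have tri: "L n axis2 $ 1 = 0" for n
  proof -
    let ?w = "A n (U n axis2)"
    have "?w = of_real (norm ?w) *s v n"
      by (simp only: v_def next_axis_def U_def norm_scale_sgn)
    then have "L n axis2 = of_real (norm ?w) *s frame_inv (v n) (v n)"
      by (metis L_def frame_inv_scaleC)
    then show ?thesis by (simp add: frame_inv_self[OF vn])
  qed
  have "\<forall>n. \<exists>a b c q1 q2 q3 q4 q5 q6. triangular_jet C D (F n) a b c q1 q2 q3 q4 q5 q6"
    using triangular_taylor[OF autF CD(3,1) bdF L tri] by blast
  then obtain a b c q1 q2 q3 q4 q5 q6 where data: "\<And>n. triangular_jet C D (F n) (a n) (b n) (c n) (q1 n) (q2 n) (q3 n) (q4 n) (q5 n) (q6 n)"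
    by metis
  interpret triangular_system t C a b c q1 q2 q3 q4 q5 q6 F
    "\<lambda>n z. vector [a n * z $ 1, b n * z $ 2 + c n * z $ 1]"
    using t t44 data autF bdF unfolding triangular_jet_def t20[symmetric] by unfold_locales blast+
  obtain r where r: "0 < r" "r \<le> 1/100" and bih: "biholomorphic
    {z. \<exists>n. norm (orbit (\<lambda>n z. flip n (F n z)) n z) < r * (t ^ 5) ^ n} (UNIV :: (complex ^ 2) set)"
    using basin_biholomorphic by blast
  \<comment> \<open>As \<open>V 0\<close> is the identity and every \<open>V n\<close> is norm
    preserving, frames and swaps do not change the set of points whose orbits enter the shrinking
    balls.\<close>
  have conj: "orbit (\<lambda>n z. flip n (F n z)) n z = V n (orbit f n z)" for n z
    by (induction n) (simp_all add: V F_def UV)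
  have "basin_of_attraction f = {z. \<exists>n. norm (orbit f n z) < r * (t ^ 5) ^ n}"
    by (rule basin_eq) (use t r bd t20 in auto)
  then show ?thesis using bih by (simp add: conj Vn)
qed

end
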